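(* For any real $x\in2^\omega$ the following are equivalent: (1) $x$ is low for $\Delta^1_1$-Kurtz tests; (2) $x$ is low for $\Delta^1_1$-Kurtz randomness; (3) $x$ is $\Delta^1_1$-dominated and $\Delta^1_1$-semi-traceable.
   Context: $\mu$ is the uniform measure on $2^\omega$. An open set is $\Delta^1_1(x)$ (resp. $\Delta^1_1$) if it is $\bigcup_{\sigma\in W}[\sigma]$ for some $\Delta^1_1(x)$ (resp. $\Delta^1_1$) set $W\subseteq2^{<\omega}$. $x$ is low for $\Delta^1_1$-Kurtz tests if every $\Delta^1_1(x)$ open set of measure $1$ has a $\Delta^1_1$ open subset of measure $1$. A real $y$ is $\Delta^1_1(x)$-Kurtz random if it lies in no closed $\mu$-null $\Delta^1_1(x)$ set; $x$ is low for $\Delta^1_1$-Kurtz randomness if the $\Delta^1_1(x)$-Kurtz random reals coincide with the $\Delta^1_1$-Kurtz random reals. $x$ is $\Delta^1_1$-dominated if every $f:\omega\to\omega$ with $f\le_h x$ is dominated everywhere by a hyperarithmetic function; $x$ is $\Delta^1_1$-semi-traceable if for each $f\le_h x$ there is a hyperarithmetic $g$ with $f(n)=g(n)$ for infinitely many $n$. *)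

theory Defs
  imports "HOL-Probability.Probability" "HOL-Library.Nat_Bijection"
begin

type_synonym cantor = "nat \<Rightarrow> bool"

text \<open>
  Formulas of arithmetic with one function variable and set variables, all second-order variables
  being left unquantified: \<open>Fun t\<close> applies the function variable to \<open>t\<close>, and \<open>Elem i t\<close> says
  that \<open>t\<close> belongs to the \<open>i\<close>-th set. Number variables are named, not de Bruijn indices.
\<close>

datatype arith_term =
    Var nat
  | Zero
  | Succ arith_term
  | Plus arith_term arith_term
  | Times arith_term arith_term
  | Fun arith_term

datatype arith_fm =
    Equals arith_term arith_term
  | Elem nat arith_term
  | Neg arith_fm
  | Conj arith_fm arith_fm
  | Forall nat arith_fm

primrec eval_term :: "(nat \<Rightarrow> nat) \<Rightarrow> (nat \<Rightarrow> nat) \<Rightarrow> arith_term \<Rightarrow> nat" where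
  "eval_term f e (Var i) = e i"
| "eval_term f e Zero = 0"
| "eval_term f e (Succ t) = Suc (eval_term f e t)"
| "eval_term f e (Plus s t) = eval_term f e s + eval_term f e t"
| "eval_term f e (Times s t) = eval_term f e s * eval_term f e t"
| "eval_term f e (Fun t) = f (eval_term f e t)"

primrec sat :: "(nat \<Rightarrow> nat) \<Rightarrow> (nat \<Rightarrow> cantor) \<Rightarrow> (nat \<Rightarrow> nat) \<Rightarrow> arith_fm \<Rightarrow> bool" where
  "sat f X e (Equals s t) \<longleftrightarrow> eval_term f e s = eval_term f e t"
| "sat f X e (Elem i t) \<longleftrightarrow> X i (eval_term f e t)"
| "sat f X e (Neg p) \<longleftrightarrow> \<not> sat f X e p"
| "sat f X e (Conj p q) \<longleftrightarrow> sat f X e p \<and> sat f X e q"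
| "sat f X e (Forall i p) \<longleftrightarrow> (\<forall>n. sat f X (e(i := n)) p)"

text \<open>
  A subset of \<open>\<omega>\<close> is \<open>\<Sigma>\<^sup>1\<^sub>1(x)\<close> if it is defined by a formula \<open>\<exists>f. p\<close> with \<open>p\<close> arithmetical.
  All free number variables of \<open>p\<close> denote the argument, all set variables denote \<open>x\<close>.
\<close>

definition sigma11 :: "cantor \<Rightarrow> nat set \<Rightarrow> bool" where
  "sigma11 x A \<longleftrightarrow> (\<exists>p. \<forall>n. n \<in> A \<longleftrightarrow> (\<exists>f. sat f (\<lambda>_. x) (\<lambda>_. n) p))"

definition delta11 :: "cantor \<Rightarrow> nat set \<Rightarrow> bool" where
  "delta11 x A \<longleftrightarrow> sigma11 x A \<and> sigma11 x (- A)"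

text \<open>
  The same pointclasses for sets of reals: set variable \<open>0\<close> denotes the oracle, every other set
  variable the argument, and free number variables denote \<open>0\<close>.
\<close>

definition sigma11_class :: "cantor \<Rightarrow> cantor set \<Rightarrow> bool" where
  "sigma11_class x C \<longleftrightarrow>
     (\<exists>p. \<forall>y. y \<in> C \<longleftrightarrow> (\<exists>f. sat f (\<lambda>i. if i = 0 then x else y) (\<lambda>_. 0) p))"

definition delta11_class :: "cantor \<Rightarrow> cantor set \<Rightarrow> bool" where
  "delta11_class x C \<longleftrightarrow> sigma11_class x C \<and> sigma11_class x (- C)"

text \<open>The unrelativised classes are those relative to the empty set.\<close>

abbreviation empty_real :: cantor where
  "empty_real \<equiv> \<lambda>_. False"

text \<open>
  \<open>f \<le>\<^sub>h x\<close>, with \<open>f\<close> hyperarithmetic in \<open>x\<close> understood as \<open>\<Delta>\<^sup>1\<^sub>1(x)\<close>.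
\<close>

definition hyp_in :: "(nat \<Rightarrow> nat) \<Rightarrow> cantor \<Rightarrow> bool" where
  "hyp_in f x \<longleftrightarrow> delta11 x (range (\<lambda>n. prod_encode (n, f n)))"

abbreviation hyperarithmetic :: "(nat \<Rightarrow> nat) \<Rightarrow> bool" where
  "hyperarithmetic f \<equiv> hyp_in f empty_real"

definition \<mu> :: "cantor measure" where
  "\<mu> = PiM UNIV (\<lambda>_. uniform_count_measure UNIV)"

definition cylinder :: "bool list \<Rightarrow> cantor set" where
  "cylinder \<sigma> = {y. \<forall>i < length \<sigma>. y i = \<sigma> ! i}"

text \<open>The set of finite binary strings is identified with a computable set of numbers.\<close>

definition string_code :: "bool list \<Rightarrow> nat" where
  "string_code \<sigma> = list_encode (map of_bool \<sigma>)"

definition delta11_open :: "cantor \<Rightarrow> cantor set \<Rightarrow> bool" where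
  "delta11_open x U \<longleftrightarrow> (\<exists>W. delta11 x (string_code ` W) \<and> U = (\<Union>\<sigma>\<in>W. cylinder \<sigma>))"

definition low_for_kurtz_tests :: "cantor \<Rightarrow> bool" where
  "low_for_kurtz_tests x \<longleftrightarrow>
     (\<forall>U. delta11_open x U \<and> emeasure \<mu> U = 1 \<longrightarrow>
        (\<exists>V. delta11_open empty_real V \<and> V \<subseteq> U \<and> emeasure \<mu> V = 1))"

text \<open>
  Here \<open>\<Delta>\<^sup>1\<^sub>1(x)\<close> refers to the pointclass; the closed set is not assumed to come with a
  \<open>\<Delta>\<^sup>1\<^sub>1(x)\<close> set of strings generating its complement.
\<close>

definition kurtz_random :: "cantor \<Rightarrow> cantor \<Rightarrow> bool" where
  "kurtz_random x y \<longleftrightarrow>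
     \<not> (\<exists>C. closed C \<and> C \<in> null_sets \<mu> \<and> delta11_class x C \<and> y \<in> C)"

definition low_for_kurtz_randomness :: "cantor \<Rightarrow> bool" where
  "low_for_kurtz_randomness x \<longleftrightarrow> {y. kurtz_random x y} = {y. kurtz_random empty_real y}"

definition delta11_dominated :: "cantor \<Rightarrow> bool" where
  "delta11_dominated x \<longleftrightarrow>
     (\<forall>f. hyp_in f x \<longrightarrow> (\<exists>g. hyperarithmetic g \<and> (\<forall>n. f n \<le> g n)))"

definition delta11_semi_traceable :: "cantor \<Rightarrow> bool" where
  "delta11_semi_traceable x \<longleftrightarrow>
     (\<forall>f. hyp_in f x \<longrightarrow> (\<exists>g. hyperarithmetic g \<and> infinite {n. f n = g n}))"

end

theory Submission
  imports Defs
begin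

text \<open>
  The \<open>\<Pi>\<^sup>1\<^sub>1\<close> sets of strings are compared through simulations between their trees: of two nodes, either
  the first is simulated by the second or the second by a child of the first, and both relations are
  \<open>\<Sigma>\<^sup>1\<^sub>1\<close>. By the resulting boundedness argument an open set that is \<open>\<Delta>\<^sup>1\<^sub>1\<close> as a class is generated by a
  \<open>\<Delta>\<^sup>1\<^sub>1\<close> set of strings, so a real is Kurtz random iff it lies in every \<open>\<Delta>\<^sup>1\<^sub>1\<close> open set of measure \<open>1\<close>.

  Given domination and semi-traceability, guess clopen covers of measure \<open>2\<^sup>-\<^sup>n\<close> of the null complement
  of \<open>U\<close>; some guess is correct in every interval \<open>[j, g j]\<close> for a hyperarithmetic \<open>g\<close>, and the
  points outside all sufficiently small guesses of one interval form the desired open subset.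

  Conversely, let \<open>C\<close> be the closed null set of reals vanishing at positions \<open>p 0 < p 1 < \<dots>\<close>. If every
  closed null \<open>\<Delta>\<^sup>1\<^sub>1\<close> set is nowhere dense in \<open>C\<close>, a Baire category argument in \<open>C\<close> gives a Kurtz random
  real that is not Kurtz random relative to \<open>x\<close>. Without domination \<open>p\<close> can be chosen with gaps that are
  infinitely often too long for such a set. Without semi-traceability, let \<open>p i\<close> code an initial segment
  of a function that eventually differs from every hyperarithmetic one: the few values of \<open>p i\<close> that
  would preserve a high density of the null set are hyperarithmetically traced, hence avoided.
\<close>

section \<open>Arithmetical predicates\<close>

text \<open>The pointclasses are given by formulas with one function variable, so closure properties
  are established for predicates on encoded types; definability of a concrete set is then a
  syntax-directed check. Kurtz randomness speaks of closed sets that are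
  \<open>\<Delta>\<^sup>1\<^sub>1\<close> only as classes, whereas tests need generating strings.
  Simulations replace ordinal ranks in the boundedness argument, because the existence of a
  simulation is visibly \<open>\<Sigma>\<^sup>1\<^sub>1\<close>. A failure of semi-traceability only
  excludes agreement with single functions, while a finite set of values has to be avoided. If
  \<open>p i\<close> codes \<open>f\<close> below \<open>b\<close>, a set of at most
  \<open>b - c\<close> values can be spread over the arguments from \<open>c\<close> to
  \<open>b\<close>, and one correct value produces an agreement. This needs a hyperarithmetic bound
  on the codes, hence domination. The densities allowed for the null set at stage \<open>i\<close>
  are \<open>i / (i + 1)\<close>. They rise but stay below 1, and the ratio of consecutive ones is
  \<open>1 - 1 / (i + 1)^2\<close>; a union of independent events of relative measure
  \<open>1 - 2^-K\<close> is compatible with it only for small \<open>K\<close>.\<close>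

primrec tvars :: "arith_term \<Rightarrow> nat set" where
  "tvars (Var i) = {i}"
| "tvars Zero = {}"
| "tvars (Succ t) = tvars t"
| "tvars (Plus s t) = tvars s \<union> tvars t"
| "tvars (Times s t) = tvars s \<union> tvars t"
| "tvars (Fun t) = tvars t"

text \<open>Bound variables are included, so a term that mentions only variables outside this set
  cannot be captured when it is substituted.\<close>

primrec fvars :: "arith_fm \<Rightarrow> nat set" where
  "fvars (Equals s t) = tvars s \<union> tvars t"
| "fvars (Elem i t) = tvars t"
| "fvars (Neg p) = fvars p"
| "fvars (Conj p q) = fvars p \<union> fvars q"
| "fvars (Forall i p) = insert i (fvars p)"

lemma finite_tvars [simp]: "finite (tvars t)"
  by (induction t) auto

lemma finite_fvars [simp]: "finite (fvars p)"
  by (induction p) auto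

lemma eval_term_cong: "(\<And>i. i \<in> tvars t \<Longrightarrow> e i = e' i) \<Longrightarrow> eval_term f e t = eval_term f e' t"
  by (induction t) auto

lemma sat_cong: "(\<And>i. i \<in> fvars p \<Longrightarrow> e i = e' i) \<Longrightarrow> sat f X e p = sat f X e' p"
proof (induction p arbitrary: e e')
  case (Equals s t)
  then have "eval_term f e s = eval_term f e' s" "eval_term f e t = eval_term f e' t"
    by (auto intro: eval_term_cong)
  then show ?case by simp
next
  case (Elem i t)
  then have "eval_term f e t = eval_term f e' t" by (auto intro: eval_term_cong)
  then show ?case by simp
next
  case (Neg p)
  then show ?case by (metis fvars.simps(3) sat.simps(3))
next
  case (Conj p q)
  have "sat f X e p = sat f X e' p" "sat f X e q = sat f X e' q"
    by (rule Conj.IH; use Conj.prems in auto)+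
  then show ?case by simp
next
  case (Forall i p)
  have "sat f X (e(i := n)) p = sat f X (e'(i := n)) p" for n
    by (rule Forall.IH) (use Forall.prems in auto)
  then show ?case by simp
qed

section \<open>Substitution for the function variable and the set variables\<close>

primrec tsub :: "(arith_term \<Rightarrow> arith_term) \<Rightarrow> arith_term \<Rightarrow> arith_term" where
  "tsub r (Var i) = Var i"
| "tsub r Zero = Zero"
| "tsub r (Succ t) = Succ (tsub r t)"
| "tsub r (Plus s t) = Plus (tsub r s) (tsub r t)"
| "tsub r (Times s t) = Times (tsub r s) (tsub r t)"
| "tsub r (Fun t) = Fun (r (tsub r t))"

primrec fsub :: "(arith_term \<Rightarrow> arith_term) \<Rightarrow> (nat \<Rightarrow> arith_term \<Rightarrow> arith_fm) \<Rightarrow> arith_fm \<Rightarrow> arith_fm" where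
  "fsub r E (Equals s t) = Equals (tsub r s) (tsub r t)"
| "fsub r E (Elem i t) = E i (tsub r t)"
| "fsub r E (Neg p) = Neg (fsub r E p)"
| "fsub r E (Conj p q) = Conj (fsub r E p) (fsub r E q)"
| "fsub r E (Forall i p) = Forall i (fsub r E p)"

lemma eval_tsub:
  assumes "\<And>t. eval_term f e (r t) = \<rho> (eval_term f e t)"
  shows "eval_term f e (tsub r t) = eval_term (\<lambda>k. f (\<rho> k)) e t"
  by (induction t) (auto simp: assms)

text \<open>The inserted term may mention the parameter \<open>v\<close>; as \<open>v\<close> is not
  even bound in \<open>p\<close>, its value stays \<open>e v\<close> under every quantifier.\<close>

lemma sat_fsub:
  assumes r: "\<And>e t. eval_term f e (r t) = \<rho> (e v) (eval_term f e t)"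
    and E: "\<And>e i t. sat f X e (E i t) \<longleftrightarrow> Y i (eval_term f e t)"
    and v: "v \<notin> fvars p"
  shows "sat f X e (fsub r E p) \<longleftrightarrow> sat (\<lambda>k. f (\<rho> (e v) k)) Y e p"
  using v
proof (induction p arbitrary: e)
  case (Equals s t)
  have "eval_term f e (tsub r u) = eval_term (\<lambda>k. f (\<rho> (e v) k)) e u" for u
    by (rule eval_tsub) (rule r)
  then show ?case by simp
next
  case (Elem i t)
  have "eval_term f e (tsub r u) = eval_term (\<lambda>k. f (\<rho> (e v) k)) e u" for u
    by (rule eval_tsub) (rule r)
  then show ?case by (simp add: E)
qed auto

section \<open>Arithmetical definability as a semantic notion\<close>

definition ar_term :: "((nat \<Rightarrow> nat) \<Rightarrow> (nat \<Rightarrow> nat) \<Rightarrow> nat) \<Rightarrow> bool" where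
  "ar_term t \<longleftrightarrow> (\<exists>s. \<forall>f e. t f e = eval_term f e s)"

definition arith :: "((nat \<Rightarrow> nat) \<Rightarrow> (nat \<Rightarrow> cantor) \<Rightarrow> (nat \<Rightarrow> nat) \<Rightarrow> bool) \<Rightarrow> bool" where
  "arith A \<longleftrightarrow> (\<exists>p. \<forall>f X e. A f X e \<longleftrightarrow> sat f X e p)"

abbreviation ar_closed :: "((nat \<Rightarrow> nat) \<Rightarrow> (nat \<Rightarrow> cantor) \<Rightarrow> bool) \<Rightarrow> bool" where
  "ar_closed A \<equiv> arith (\<lambda>f X e. A f X)"

lemma ar_term_var: "ar_term (\<lambda>f e. e i)"
  unfolding ar_term_def by (rule exI[where x = "Var i"]) simp

lemma ar_term_Suc: assumes "ar_term s" shows "ar_term (\<lambda>f e. Suc (s f e))"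
proof -
  obtain s' where s': "\<And>f e. s f e = eval_term f e s'" using assms unfolding ar_term_def by blast
  show ?thesis unfolding ar_term_def by (rule exI[where x = "Succ s'"]) (simp add: s')
qed

lemma ar_term_plus: assumes "ar_term s" "ar_term t" shows "ar_term (\<lambda>f e. s f e + t f e)"
proof -
  obtain s' where s': "\<And>f e. s f e = eval_term f e s'" using assms(1) unfolding ar_term_def by blast
  obtain t' where t': "\<And>f e. t f e = eval_term f e t'" using assms(2) unfolding ar_term_def by blast
  show ?thesis unfolding ar_term_def by (rule exI[where x = "Plus s' t'"]) (simp add: s' t')
qed

lemma ar_term_times: assumes "ar_term s" "ar_term t" shows "ar_term (\<lambda>f e. s f e * t f e)"
proof -
  obtain s' where s': "\<And>f e. s f e = eval_term f e s'" using assms(1) unfolding ar_term_def by blast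
  obtain t' where t': "\<And>f e. t f e = eval_term f e t'" using assms(2) unfolding ar_term_def by blast
  show ?thesis unfolding ar_term_def by (rule exI[where x = "Times s' t'"]) (simp add: s' t')
qed

lemma ar_term_Fun: assumes "ar_term s" shows "ar_term (\<lambda>f e. f (s f e))"
proof -
  obtain s' where s': "\<And>f e. s f e = eval_term f e s'" using assms unfolding ar_term_def by blast
  show ?thesis unfolding ar_term_def by (rule exI[where x = "Fun s'"]) (simp add: s')
qed

lemma ar_term_const: "ar_term (\<lambda>f e. c)"
proof (induction c)
  case 0
  then show ?case unfolding ar_term_def by (intro exI[where x = Zero]) simp
next
  case (Suc c)
  then show ?case by (rule ar_term_Suc)
qed

lemma arith_eq: assumes "ar_term s" "ar_term t" shows "arith (\<lambda>f X e. s f e = t f e)"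
proof -
  obtain s' where s': "\<And>f e. s f e = eval_term f e s'" using assms(1) unfolding ar_term_def by blast
  obtain t' where t': "\<And>f e. t f e = eval_term f e t'" using assms(2) unfolding ar_term_def by blast
  show ?thesis unfolding arith_def by (rule exI[where x = "Equals s' t'"]) (simp add: s' t')
qed

lemma arith_elem: assumes "ar_term t" shows "arith (\<lambda>f X e. X i (t f e))"
proof -
  obtain t' where t': "\<And>f e. t f e = eval_term f e t'" using assms unfolding ar_term_def by blast
  show ?thesis unfolding arith_def by (rule exI[where x = "Elem i t'"]) (simp add: t')
qed

lemma arith_not: assumes "arith A" shows "arith (\<lambda>f X e. \<not> A f X e)"
proof -
  obtain p where p: "\<And>f X e. A f X e \<longleftrightarrow> sat f X e p" using assms unfolding arith_def by blast
  show ?thesis unfolding arith_def by (rule exI[where x = "Neg p"]) (simp add: p)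
qed

lemma arith_conj: assumes "arith A" "arith B" shows "arith (\<lambda>f X e. A f X e \<and> B f X e)"
proof -
  obtain p where p: "\<And>f X e. A f X e \<longleftrightarrow> sat f X e p" using assms(1) unfolding arith_def by blast
  obtain q where q: "\<And>f X e. B f X e \<longleftrightarrow> sat f X e q" using assms(2) unfolding arith_def by blast
  show ?thesis unfolding arith_def by (rule exI[where x = "Conj p q"]) (simp add: p q)
qed

lemma arith_disj: "arith A \<Longrightarrow> arith B \<Longrightarrow> arith (\<lambda>f X e. A f X e \<or> B f X e)"
  using arith_not[OF arith_conj[OF arith_not arith_not, of A B]] by simp

lemma arith_imp: "arith A \<Longrightarrow> arith B \<Longrightarrow> arith (\<lambda>f X e. A f X e \<longrightarrow> B f X e)"
  using arith_not[OF arith_conj[OF _ arith_not, of A B]] by simp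

lemma arith_iff: "arith A \<Longrightarrow> arith B \<Longrightarrow> arith (\<lambda>f X e. A f X e \<longleftrightarrow> B f X e)"
  using arith_conj[OF arith_imp[of A B] arith_imp[of B A]] by (simp add: iff_conv_conj_imp)

text \<open>Variables are named, so the quantified one must be fresh: the first hypothesis states
  this semantically, namely that \<open>B\<close> ignores variable \<open>i\<close> outside its last
  argument.\<close>

lemma arith_all:
  assumes "\<And>f X e n m. B f X (e(i := n)) m = B f X e m"
    and "arith (\<lambda>f X e. B f X e (e i))"
  shows "arith (\<lambda>f X e. \<forall>m. B f X e m)"
proof -
  obtain p where p: "\<And>f X e. B f X e (e i) = sat f X e p"
    using assms(2) unfolding arith_def by blast
  have "(\<forall>m. B f X e m) = sat f X e (Forall i p)" for f X e
    using p[of f X "e(i := _)"] assms(1) by simp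
  then show ?thesis unfolding arith_def by blast
qed

lemma arith_ex:
  assumes "\<And>f X e n m. B f X (e(i := n)) m = B f X e m"
    and "arith (\<lambda>f X e. B f X e (e i))"
  shows "arith (\<lambda>f X e. \<exists>m. B f X e m)"
  using arith_not[OF arith_all[where i = i and B = "\<lambda>f X e m. \<not> B f X e m", OF _ arith_not[OF assms(2)]]]
  by (simp add: assms(1))

text \<open>Reindexings of the function variable that a term can express. The variable carrying the
  parameter is arbitrary, so that a fresh one can be chosen.\<close>

definition poly_fun :: "(nat \<Rightarrow> nat \<Rightarrow> nat) \<Rightarrow> bool" where
  "poly_fun \<rho> \<longleftrightarrow> (\<forall>v. \<exists>r. \<forall>f e t. eval_term f e (r t) = \<rho> (e v) (eval_term f e t))"

lemma poly_fun_param: "poly_fun (\<lambda>n k. n)"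
  unfolding poly_fun_def
proof
  fix v
  show "\<exists>r. \<forall>f e t. eval_term f e (r t) = e v" by (rule exI[where x = "\<lambda>_. Var v"]) simp
qed

lemma poly_fun_arg: "poly_fun (\<lambda>n k. k)"
  unfolding poly_fun_def by (intro allI exI[where x = "\<lambda>t. t"]) simp

lemma poly_fun_const: "poly_fun (\<lambda>n k. c)"
  unfolding poly_fun_def
proof
  fix v
  obtain s where "\<forall>f e. c = eval_term f e s" using ar_term_const[of c] unfolding ar_term_def by blast
  then show "\<exists>r. \<forall>f e t. eval_term f e (r t) = c" by (intro exI[where x = "\<lambda>_. s"]) simp
qed

lemma poly_fun_Suc: assumes "poly_fun a" shows "poly_fun (\<lambda>n k. Suc (a n k))"
  unfolding poly_fun_def
proof
  fix v
  obtain r where "\<And>f e t. eval_term f e (r t) = a (e v) (eval_term f e t)"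
    using assms[unfolded poly_fun_def, rule_format, of v] by blast
  then show "\<exists>r. \<forall>f e t. eval_term f e (r t) = Suc (a (e v) (eval_term f e t))"
    by (intro exI[where x = "\<lambda>t. Succ (r t)"]) simp
qed

lemma poly_fun_plus: assumes "poly_fun a" "poly_fun b" shows "poly_fun (\<lambda>n k. a n k + b n k)"
  unfolding poly_fun_def
proof
  fix v
  obtain r where r: "\<And>f e t. eval_term f e (r t) = a (e v) (eval_term f e t)"
    using assms(1)[unfolded poly_fun_def, rule_format, of v] by blast
  obtain s where s: "\<And>f e t. eval_term f e (s t) = b (e v) (eval_term f e t)"
    using assms(2)[unfolded poly_fun_def, rule_format, of v] by blast
  show "\<exists>r. \<forall>f e t. eval_term f e (r t) = a (e v) (eval_term f e t) + b (e v) (eval_term f e t)"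
    by (rule exI[where x = "\<lambda>t. Plus (r t) (s t)"]) (simp add: r s)
qed

lemma poly_fun_times: assumes "poly_fun a" "poly_fun b" shows "poly_fun (\<lambda>n k. a n k * b n k)"
  unfolding poly_fun_def
proof
  fix v
  obtain r where r: "\<And>f e t. eval_term f e (r t) = a (e v) (eval_term f e t)"
    using assms(1)[unfolded poly_fun_def, rule_format, of v] by blast
  obtain s where s: "\<And>f e t. eval_term f e (s t) = b (e v) (eval_term f e t)"
    using assms(2)[unfolded poly_fun_def, rule_format, of v] by blast
  show "\<exists>r. \<forall>f e t. eval_term f e (r t) = a (e v) (eval_term f e t) * b (e v) (eval_term f e t)"
    by (rule exI[where x = "\<lambda>t. Times (r t) (s t)"]) (simp add: r s)
qed

text \<open>Injective, and unlike \<^const>\<open>prod_encode\<close> a term of the language of arithmetic.\<close>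

definition poly_pair :: "nat \<Rightarrow> nat \<Rightarrow> nat" where
  "poly_pair m n = (m + n) * (m + n) + m"

lemma poly_pair_inj: assumes "poly_pair m n = poly_pair m' n'" shows "m = m' \<and> n = n'"
proof -
  have *: "poly_pair a b < poly_pair c d" if "a + b < c + d" for a b c d
  proof -
    have "poly_pair a b \<le> (a+b)*(a+b) + (a+b)" by (simp add: poly_pair_def)
    also have "\<dots> < Suc (a+b) * Suc (a+b)" by simp
    also have "\<dots> \<le> (c+d)*(c+d)" using that by (intro mult_le_mono) auto
    also have "\<dots> \<le> poly_pair c d" by (simp add: poly_pair_def)
    finally show ?thesis .
  qed
  have "m + n = m' + n'" using *[of m n m' n'] *[of m' n' m n] assms by linarith
  then show ?thesis using assms by (simp add: poly_pair_def)
qed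

lemma poly_fun_poly_pair: "poly_fun a \<Longrightarrow> poly_fun b \<Longrightarrow> poly_fun (\<lambda>n k. poly_pair (a n k) (b n k))"
  unfolding poly_pair_def by (intro poly_fun_plus poly_fun_times)

lemma ar_term_poly_pair: "ar_term a \<Longrightarrow> ar_term b \<Longrightarrow> ar_term (\<lambda>f e. poly_pair (a f e) (b f e))"
  unfolding poly_pair_def by (intro ar_term_plus ar_term_times)

text \<open>The formula for \<open>A\<close> may mention \<open>v\<close> although \<open>A\<close>
  ignores the assignment. The parameter is therefore read from a fresh variable \<open>w\<close>,
  and a quantifier bounded by \<open>n = e v\<close> passes the value on.\<close>

lemma arith_subst:
  assumes "ar_closed A" "poly_fun \<rho>"
    and E: "\<And>f X e i t. sat f X e (E i t) \<longleftrightarrow> Y f X i (eval_term f e t)"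
  shows "arith (\<lambda>f X e. A (\<lambda>k. f (\<rho> (e v) k)) (Y f X))"
proof -
  obtain p where p: "\<And>f X e. A f X = sat f X e p" using assms(1) unfolding arith_def by blast
  have "finite (insert v (fvars p))" by simp
  then obtain w where w: "w \<notin> insert v (fvars p)" using ex_new_if_finite infinite_UNIV_nat by blast
  obtain r where r: "\<And>f e t. eval_term f e (r t) = \<rho> (e w) (eval_term f e t)"
    using assms(2)[unfolded poly_fun_def, rule_format, of w] by blast
  let ?q = "fsub r E p"
  have q: "sat f X e ?q = A (\<lambda>k. f (\<rho> (e w) k)) (Y f X)" for f X e
    using sat_fsub[of f r \<rho> w X E "Y f X" p e] r E w p by simp
  have "arith (\<lambda>f X e. e w = e v \<longrightarrow> sat f X e ?q)"
    by (intro arith_imp arith_eq ar_term_var) (auto simp: arith_def)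
  then have *: "arith (\<lambda>f X e. e w = e v \<longrightarrow> A (\<lambda>k. f (\<rho> (e w) k)) (Y f X))"
    unfolding q .
  have "arith (\<lambda>f X e. \<forall>n. n = e v \<longrightarrow> A (\<lambda>k. f (\<rho> n k)) (Y f X))"
  proof (rule arith_all[where i = w])
    show "arith (\<lambda>f X e. e w = e v \<longrightarrow> A (\<lambda>k. f (\<rho> (e w) k)) (Y f X))"
      by (rule *)
  qed (use w in simp)
  then show ?thesis by simp
qed

lemma arith_reindex:
  assumes "ar_closed A" "poly_fun \<rho>"
  shows "arith (\<lambda>f X e. A (\<lambda>k. f (\<rho> (e v) k)) X)"
  by (rule arith_subst[OF assms, of Elem "\<lambda>f X. X"]) simp

lemma arith_reindex0:
  assumes "ar_closed A" "poly_fun (\<lambda>n. \<rho>)"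
  shows "arith (\<lambda>f X e. A (\<lambda>k. f (\<rho> k)) X)"
  using arith_reindex[OF assms] .

text \<open>In \<open>sigma11\<close> every free number variable denotes the argument, so all of them are bound to one value.\<close>

lemma arith_sat_const: "arith (\<lambda>f X e. sat f X (\<lambda>_. e v) p)"
proof -
  obtain N where N: "fvars p \<subseteq> {..<N}" using finite_nat_bounded[OF finite_fvars] by blast
  \<comment> \<open>The variables below \<open>n\<close> are overwritten one at a time by
    \<open>e w\<close>, where \<open>w\<close> lies above all of them.\<close>
  have *: "arith (\<lambda>f X e. sat f X (\<lambda>i. if i < n then e w else e i) p)" if "n \<le> w" for n w
    using that
  proof (induction n)
    case 0
    then show ?case by (auto simp: arith_def)
  next
    case (Suc n)
    then have IH: "arith (\<lambda>f X e. sat f X (\<lambda>i. if i < n then e w else e i) p)" by simp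
    have "arith (\<lambda>f X e. \<forall>m. m = e w \<longrightarrow> sat f X (\<lambda>i. if i < n then e w else if i = n then m else e i) p)"
    proof (rule arith_all[where i = n])
      fix f X and e :: "nat \<Rightarrow> nat" and k m
      show "(m = (e(n := k)) w \<longrightarrow> sat f X (\<lambda>i. if i < n then (e(n := k)) w else if i = n then m else (e(n := k)) i) p) =
         (m = e w \<longrightarrow> sat f X (\<lambda>i. if i < n then e w else if i = n then m else e i) p)"
      proof -
        have "(e(n := k)) w = e w" using Suc.prems by simp
        moreover have "(\<lambda>i. if i < n then e w else if i = n then m else (e(n := k)) i) =
            (\<lambda>i. if i < n then e w else if i = n then m else e i)" by (rule ext) simp
        ultimately show ?thesis by (simp only:)
      qed
    next
      have "(\<lambda>i. if i < n then e w else if i = n then e n else e i) = (\<lambda>i. if i < n then e w else e i)" for e :: "nat \<Rightarrow> nat"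
        by auto
      then show "arith (\<lambda>f X e. e n = e w \<longrightarrow> sat f X (\<lambda>i. if i < n then e w else if i = n then e n else e i) p)"
        using IH by (intro arith_imp arith_eq ar_term_var) simp
    qed
    moreover have "(\<lambda>i. if i < Suc n then e w else e i) = (\<lambda>i. if i < n then e w else if i = n then e w else e i)" for e :: "nat \<Rightarrow> nat"
      by (auto simp: less_Suc_eq)
    ultimately show ?case by simp
  qed
  define w where "w = Suc (max N v)"
  have w: "w \<ge> N" "w \<noteq> v" by (auto simp: w_def)
  have "sat f X (\<lambda>i. if i < N then e w else e i) p = sat f X (\<lambda>_. e w) p" for f X e
    by (rule sat_cong) (use N in auto)
  with *[OF w(1)] have *: "arith (\<lambda>f X e. sat f X (\<lambda>_. e w) p)" by simp
  have "arith (\<lambda>f X e. \<forall>m. m = e v \<longrightarrow> sat f X (\<lambda>_. m) p)"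
  proof (rule arith_all[where i = w])
    show "arith (\<lambda>f X e. e w = e v \<longrightarrow> sat f X (\<lambda>_. e w) p)"
      by (intro arith_imp arith_eq ar_term_var *)
  qed (use w in simp)
  then show ?thesis by simp
qed

lemma arith_sat_const_term:
  assumes "ar_term t" "\<And>f e n. t f (e(0 := n)) = t f e"
  shows "arith (\<lambda>f X e. sat f X (\<lambda>_. t f e) p)"
proof -
  have "arith (\<lambda>f X e. \<forall>m. m = t f e \<longrightarrow> sat f X (\<lambda>_. m) p)"
  proof (rule arith_all[where i = 0])
    show "arith (\<lambda>f X e. e 0 = t f e \<longrightarrow> sat f X (\<lambda>_. e 0) p)"
      by (intro arith_imp arith_eq ar_term_var arith_sat_const assms(1))
  qed (simp add: assms(2))
  then show ?thesis by simp
qed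

section \<open>The pointclass of lightface analytic sets\<close>

lemmas arith_intros = arith_eq arith_elem arith_not arith_conj arith_disj arith_imp arith_iff
lemmas ar_term_intros = ar_term_var ar_term_const ar_term_Suc ar_term_plus ar_term_times ar_term_Fun ar_term_poly_pair
lemmas poly_fun_intros = poly_fun_param poly_fun_arg poly_fun_const poly_fun_Suc poly_fun_plus poly_fun_times poly_fun_poly_pair

text \<open>The even places of the witness \<open>F\<close> hold the point, the odd places the existential function.\<close>

definition sigma1_real :: "cantor \<Rightarrow> ((nat \<Rightarrow> nat) \<Rightarrow> bool) \<Rightarrow> bool" where
  "sigma1_real x A \<longleftrightarrow> (\<exists>B. ar_closed B \<and> (\<forall>z. A z \<longleftrightarrow> (\<exists>F. (\<forall>k. F (2 * k) = z k) \<and> B F (\<lambda>_. x))))"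

definition interleave :: "(nat \<Rightarrow> nat) \<Rightarrow> (nat \<Rightarrow> nat) \<Rightarrow> nat \<Rightarrow> nat" where
  "interleave z w k = (if even k then z (k div 2) else w (k div 2))"

lemma interleave_simps [simp]: "interleave z w (2 * k) = z k" "interleave z w (Suc (2 * k)) = w k" "interleave z w 0 = z 0" "interleave z w (Suc 0) = w 0"
  "interleave z w (Suc (Suc (Suc 0))) = w (Suc 0)"
  by (auto simp: interleave_def)

lemma interleave_unique: "(\<forall>k. G k = interleave u v k) \<longleftrightarrow> (\<forall>k. G (2 * k) = u k \<and> G (Suc (2 * k)) = v k)"
proof
  assume *: "\<forall>k. G (2 * k) = u k \<and> G (Suc (2 * k)) = v k"
  show "\<forall>k. G k = interleave u v k"
  proof
    fix k
    have "k = 2 * (k div 2) \<or> k = Suc (2 * (k div 2))" by presburger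
    then show "G k = interleave u v k" using * by (metis interleave_simps(1,2))
  qed
qed simp

lemma interleave_eta: "interleave (\<lambda>k. G (2 * k)) (\<lambda>k. G (Suc (2 * k))) = G"
  using interleave_unique[of G "\<lambda>k. G (2 * k)" "\<lambda>k. G (Suc (2 * k))"] by (metis ext)

text \<open>Since \<open>poly_pair\<close> is injective, the places
  \<open>Suc (2 * poly_pair i k)\<close> can be prescribed independently; the other odd places are
  arbitrary.\<close>

lemma exists_columns: "\<exists>G :: nat \<Rightarrow> nat. (\<forall>k. G (2 * k) = z k) \<and> (\<forall>i k. G (Suc (2 * poly_pair i k)) = H i k)"
proof -
  define w where "w m = (THE v. \<exists>i k. m = poly_pair i k \<and> v = H i k)" for m
  have "w (poly_pair i k) = H i k" for i k
    unfolding w_def by (rule the_equality) (use poly_pair_inj in blast)+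
  then show ?thesis by (intro exI[where x = "interleave z w"]) simp
qed

lemma sigma1_real_arith: "ar_closed B \<Longrightarrow> sigma1_real x (\<lambda>z. B z (\<lambda>_. x))"
proof -
  assume B: "ar_closed B"
  have h1: "ar_closed (\<lambda>F X. B (\<lambda>k. F (2 * k)) X)" by (intro arith_reindex0[OF B] poly_fun_intros)
  have h2: "B z (\<lambda>_. x) \<longleftrightarrow> (\<exists>F. (\<forall>k. F (2 * k) = z k) \<and> B (\<lambda>k. F (2 * k)) (\<lambda>_. x))" for z
  proof
    assume "B z (\<lambda>_. x)"
    then show "\<exists>F. (\<forall>k. F (2 * k) = z k) \<and> B (\<lambda>k. F (2 * k)) (\<lambda>_. x)"
      by (intro exI[where x = "interleave z z"]) simp
  qed (metis ext)
  show ?thesis unfolding sigma1_real_def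
    by (rule exI[where x = "\<lambda>F. B (\<lambda>k. F (2 * k))"], intro conjI allI h1 h2)
qed

lemma sigma1_real_conj:
  assumes "sigma1_real x A" "sigma1_real x A'" shows "sigma1_real x (\<lambda>z. A z \<and> A' z)"
proof -
  obtain B where B: "ar_closed B" "\<And>z. A z \<longleftrightarrow> (\<exists>F. (\<forall>k. F (2 * k) = z k) \<and> B F (\<lambda>_. x))"
    using assms(1) unfolding sigma1_real_def by blast
  obtain B' where B': "ar_closed B'" "\<And>z. A' z \<longleftrightarrow> (\<exists>F. (\<forall>k. F (2 * k) = z k) \<and> B' F (\<lambda>_. x))"
    using assms(2) unfolding sigma1_real_def by blast
  define C where "C G X \<longleftrightarrow> B (\<lambda>k. G (Suc (2 * poly_pair 0 k))) X \<and> B' (\<lambda>k. G (Suc (2 * poly_pair 1 k))) X \<and>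
     (\<forall>k. G (Suc (2 * poly_pair 0 (2 * k))) = G (2 * k) \<and> G (Suc (2 * poly_pair 1 (2 * k))) = G (2 * k))" for G X
  have "ar_closed C" unfolding C_def
    by (intro arith_intros arith_reindex0[OF B(1)] arith_reindex0[OF B'(1)] poly_fun_intros arith_all[where i = 0] ar_term_intros) simp
  moreover have "A z \<and> A' z \<longleftrightarrow> (\<exists>F. (\<forall>k. F (2 * k) = z k) \<and> C F (\<lambda>_. x))" for z
  proof
    assume "A z \<and> A' z"
    then obtain F F' where F: "\<And>k. F (2 * k) = z k" "B F (\<lambda>_. x)" "\<And>k. F' (2 * k) = z k" "B' F' (\<lambda>_. x)"
      unfolding B B' by blast
    obtain G where G: "\<And>k. G (2 * k) = z k" "\<And>i k. G (Suc (2 * poly_pair i k)) = (if i = 0 then F k else F' k)"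
      using exists_columns[of z "\<lambda>i k. (if i = 0 then F k else F' k)"] by blast
    have "C G (\<lambda>_. x)" unfolding C_def G using F by simp
    then show "\<exists>F. (\<forall>k. F (2 * k) = z k) \<and> C F (\<lambda>_. x)" using G by blast
  next
    assume "\<exists>F. (\<forall>k. F (2 * k) = z k) \<and> C F (\<lambda>_. x)"
    then obtain G where G: "\<And>k. G (2 * k) = z k" "C G (\<lambda>_. x)" by blast
    have "A z" unfolding B by (rule exI[where x = "\<lambda>k. G (Suc (2 * poly_pair 0 k))"]) (use G in \<open>simp add: C_def\<close>)
    moreover have "A' z" unfolding B' by (rule exI[where x = "\<lambda>k. G (Suc (2 * poly_pair 1 k))"]) (use G in \<open>simp add: C_def\<close>)
    ultimately show "A z \<and> A' z" ..
  qed
  ultimately show ?thesis unfolding sigma1_real_def by blast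
qed

lemma sigma1_real_disj:
  assumes "sigma1_real x A" "sigma1_real x A'" shows "sigma1_real x (\<lambda>z. A z \<or> A' z)"
proof -
  obtain B where B: "ar_closed B" "\<And>z. A z \<longleftrightarrow> (\<exists>F. (\<forall>k. F (2 * k) = z k) \<and> B F (\<lambda>_. x))"
    using assms(1) unfolding sigma1_real_def by blast
  obtain B' where B': "ar_closed B'" "\<And>z. A' z \<longleftrightarrow> (\<exists>F. (\<forall>k. F (2 * k) = z k) \<and> B' F (\<lambda>_. x))"
    using assms(2) unfolding sigma1_real_def by blast
  have h1: "ar_closed (\<lambda>F X. B F X \<or> B' F X)" by (intro arith_intros B B')
  have h2: "A z \<or> A' z \<longleftrightarrow> (\<exists>F. (\<forall>k. F (2 * k) = z k) \<and> (B F (\<lambda>_. x) \<or> B' F (\<lambda>_. x)))" for z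
    unfolding B B' by blast
  show ?thesis unfolding sigma1_real_def
    by (rule exI[where x = "\<lambda>F X. B F X \<or> B' F X"], intro conjI allI h1 h2)
qed

text \<open>Countable choice merges the witnesses for all \<open>n\<close> into one function: column
  \<open>0\<close> of the new witness stores \<open>G\<close>, column \<open>Suc n\<close> the
  witness for \<open>n\<close>. Closure under function quantifiers, number quantifiers and
  substitution is derived from this.\<close>

lemma sigma1_real_main:
  assumes A: "sigma1_real x A" and C: "ar_closed C"
  shows "sigma1_real x (\<lambda>z. \<exists>G. (\<forall>k. G (2 * k) = z k) \<and> C G (\<lambda>_. x) \<and> (\<forall>n. A (\<lambda>k. G (Suc (2 * poly_pair n k)))))"
    (is "sigma1_real x ?P")
proof -
  obtain B where B: "ar_closed B" "\<And>z. A z \<longleftrightarrow> (\<exists>F. (\<forall>k. F (2 * k) = z k) \<and> B F (\<lambda>_. x))"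
    using A unfolding sigma1_real_def by blast
  define D where "D G X \<longleftrightarrow> C (\<lambda>k. G (Suc (2 * poly_pair 0 k))) X \<and> (\<forall>k. G (Suc (2 * poly_pair 0 (2 * k))) = G (2 * k)) \<and>
     (\<forall>n. B (\<lambda>k. G (Suc (2 * poly_pair (Suc n) k))) X \<and>
        (\<forall>k. G (Suc (2 * poly_pair (Suc n) (2 * k))) = G (Suc (2 * poly_pair 0 (Suc (2 * poly_pair n k))))))" for G X
  have "ar_closed D" unfolding D_def
    apply (intro arith_intros arith_reindex0[OF C] poly_fun_intros)
     apply (intro arith_all[where i = 0] arith_intros ar_term_intros; simp)
    apply (rule arith_all[where i = 0], simp)
    apply (intro arith_intros arith_reindex[OF B(1)] poly_fun_intros)
    apply (intro arith_all[where i = 1] arith_intros ar_term_intros; simp)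
    done
  moreover have "?P z \<longleftrightarrow> (\<exists>F. (\<forall>k. F (2 * k) = z k) \<and> D F (\<lambda>_. x))" for z
  proof
    assume "?P z"
    then obtain G where G: "\<And>k. G (2 * k) = z k" "C G (\<lambda>_. x)" "\<And>n. A (\<lambda>k. G (Suc (2 * poly_pair n k)))"
      by blast
    obtain F where F: "\<And>n k. F n (2 * k) = G (Suc (2 * poly_pair n k))" "\<And>n. B (F n) (\<lambda>_. x)"
      using G(3) unfolding B by metis
    obtain H where H: "\<And>k. H (2 * k) = z k" "\<And>i k. H (Suc (2 * poly_pair i k)) = (if i = 0 then G k else F (i - 1) k)"
      using exists_columns[of z "\<lambda>i k. (if i = 0 then G k else F (i - 1) k)"] by blast
    have "D H (\<lambda>_. x)" unfolding D_def H using G F by simp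
    then show "\<exists>F. (\<forall>k. F (2 * k) = z k) \<and> D F (\<lambda>_. x)" using H by blast
  next
    assume "\<exists>F. (\<forall>k. F (2 * k) = z k) \<and> D F (\<lambda>_. x)"
    then obtain H where H: "\<And>k. H (2 * k) = z k" "D H (\<lambda>_. x)" by blast
    show "?P z"
    proof (intro exI conjI allI)
      fix n
      show "A (\<lambda>k. H (Suc (2 * poly_pair 0 (Suc (2 * poly_pair n k)))))"
        unfolding B by (rule exI[where x = "\<lambda>k. H (Suc (2 * poly_pair (Suc n) k))"]) (use H in \<open>simp add: D_def\<close>)
    qed (use H in \<open>simp_all add: D_def\<close>)
  qed
  ultimately show ?thesis unfolding sigma1_real_def by blast
qed

lemma sigma1_real_ex:
  assumes "sigma1_real x A" shows "sigma1_real x (\<lambda>z. \<exists>w. A (interleave z w))"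
proof -
  \<comment> \<open>All columns are forced to be the same \<open>interleave z w\<close>, so the
    conjunction over \<open>n\<close> collapses to one instance of \<open>A\<close>.\<close>
  define C where "C (G :: nat \<Rightarrow> nat) (X :: nat \<Rightarrow> cantor) \<longleftrightarrow> (\<forall>n k. G (Suc (2 * poly_pair n (2 * k))) = G (2 * k) \<and>
     G (Suc (2 * poly_pair n (Suc (2 * k)))) = G (Suc (2 * poly_pair 0 (Suc (2 * k)))))" for G X
  have C: "ar_closed C" unfolding C_def
    by (rule arith_all[where i = 0], simp, rule arith_all[where i = 1], simp, intro arith_intros ar_term_intros)
  have "(\<exists>G. (\<forall>k. G (2 * k) = z k) \<and> C G (\<lambda>_. x) \<and> (\<forall>n. A (\<lambda>k. G (Suc (2 * poly_pair n k))))) \<longleftrightarrow> (\<exists>w. A (interleave z w))" for z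
  proof
    assume "\<exists>G. (\<forall>k. G (2 * k) = z k) \<and> C G (\<lambda>_. x) \<and> (\<forall>n. A (\<lambda>k. G (Suc (2 * poly_pair n k))))"
    then obtain G where G: "\<And>k. G (2 * k) = z k" "C G (\<lambda>_. x)" "A (\<lambda>k. G (Suc (2 * poly_pair 0 k)))" by blast
    have "(\<lambda>k. G (Suc (2 * poly_pair 0 k))) = interleave z (\<lambda>k. G (Suc (2 * poly_pair 0 (Suc (2 * k)))))"
      by (rule ext, rule interleave_unique[THEN iffD2, rule_format]) (use G(1,2) in \<open>simp add: C_def\<close>)
    then show "\<exists>w. A (interleave z w)" using G(3) by metis
  next
    assume "\<exists>w. A (interleave z w)"
    then obtain w where w: "A (interleave z w)" ..
    obtain G where G: "\<And>k. G (2 * k) = z k" "\<And>i k. G (Suc (2 * poly_pair i k)) = interleave z w k"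
      using exists_columns[of z "\<lambda>i k. interleave z w k"] by blast
    have "C G (\<lambda>_. x)" unfolding C_def G by simp
    moreover have "A (\<lambda>k. G (Suc (2 * poly_pair n k)))" for n unfolding G using w by simp
    ultimately show "\<exists>G. (\<forall>k. G (2 * k) = z k) \<and> C G (\<lambda>_. x) \<and> (\<forall>n. A (\<lambda>k. G (Suc (2 * poly_pair n k))))"
      using G(1) by blast
  qed
  with sigma1_real_main[OF assms C] show ?thesis by simp
qed

text \<open>The columns of the guessed function are pinned down by an arithmetical condition, so an
  existential guess amounts to a substitution.\<close>

lemma sigma1_real_trans_all:
  assumes A: "sigma1_real x A" and C: "ar_closed (\<lambda>G X. \<forall>n k. G (Suc (2 * poly_pair n k)) = T (\<lambda>k. G (2 * k)) n k)"
  shows "sigma1_real x (\<lambda>z. \<forall>n. A (T z n))"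
proof -
  have "(\<exists>G. (\<forall>k. G (2 * k) = z k) \<and> (\<forall>n k. G (Suc (2 * poly_pair n k)) = T (\<lambda>k. G (2 * k)) n k) \<and>
     (\<forall>n. A (\<lambda>k. G (Suc (2 * poly_pair n k))))) \<longleftrightarrow> (\<forall>n. A (T z n))" for z
  proof
    assume "\<exists>G. (\<forall>k. G (2 * k) = z k) \<and> (\<forall>n k. G (Suc (2 * poly_pair n k)) = T (\<lambda>k. G (2 * k)) n k) \<and>
     (\<forall>n. A (\<lambda>k. G (Suc (2 * poly_pair n k))))"
    then obtain G where G: "\<And>k. G (2 * k) = z k" "\<And>n k. G (Suc (2 * poly_pair n k)) = T (\<lambda>k. G (2 * k)) n k"
      "\<And>n. A (\<lambda>k. G (Suc (2 * poly_pair n k)))" by blast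
    then show "\<forall>n. A (T z n)" by simp
  next
    assume *: "\<forall>n. A (T z n)"
    obtain G where G: "\<And>k. G (2 * k) = z k" "\<And>i k. G (Suc (2 * poly_pair i k)) = T z i k"
      using exists_columns[of z "\<lambda>i k. T z i k"] by blast
    show "\<exists>G. (\<forall>k. G (2 * k) = z k) \<and> (\<forall>n k. G (Suc (2 * poly_pair n k)) = T (\<lambda>k. G (2 * k)) n k) \<and>
     (\<forall>n. A (\<lambda>k. G (Suc (2 * poly_pair n k))))"
      by (rule exI[where x = G]) (use G * in simp)
  qed
  with sigma1_real_main[OF A C] show ?thesis by simp
qed

lemma sigma1_real_trans:
  assumes A: "sigma1_real x A" and C: "ar_closed (\<lambda>G X. \<forall>n k. G (Suc (2 * poly_pair n k)) = T (\<lambda>k. G (2 * k)) k)"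
  shows "sigma1_real x (\<lambda>z. A (T z))"
  using sigma1_real_trans_all[OF A C] by simp

text \<open>Objects become reals through \<open>enc\<close>. The range must be
  \<open>\<Sigma>\<^sup>1\<^sub>1\<close> for every oracle, so that a quantifier over the type can
  be turned into one over reals.\<close>

class point =
  fixes enc :: "'a \<Rightarrow> nat \<Rightarrow> nat"
  assumes sigma1_real_range_enc: "sigma1_real x (\<lambda>z. z \<in> range enc)"

definition sigma1 :: "cantor \<Rightarrow> ('a::point \<Rightarrow> bool) \<Rightarrow> bool" where
  "sigma1 x P \<longleftrightarrow> (\<exists>A. sigma1_real x A \<and> (\<forall>a. P a = A (enc a)))"

instantiation nat :: point
begin
definition "enc n = (\<lambda>k::nat. n::nat)"
instance
proof
  have eq: "(\<forall>k. z k = z 0) \<longleftrightarrow> z \<in> range (enc :: nat \<Rightarrow> _)" for z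
    by (force simp: enc_nat_def)
  have "sigma1_real x (\<lambda>z. \<forall>k. z k = z 0)" for x
    by (rule sigma1_real_arith, rule arith_all[where i = 0], simp, intro arith_intros ar_term_intros)
  then show "sigma1_real x (\<lambda>z. z \<in> range (enc :: nat \<Rightarrow> _))" for x
    unfolding eq .
qed
end

instantiation bool :: point
begin
definition "enc b = (\<lambda>k::nat. of_bool b :: nat)"
instance
proof
  have eq: "(\<forall>k. z k = z 0) \<and> (z 0 = 0 \<or> z 0 = 1) \<longleftrightarrow> z \<in> range (enc :: bool \<Rightarrow> _)" for z
  proof
    assume *: "(\<forall>k. z k = z 0) \<and> (z 0 = 0 \<or> z 0 = 1)"
    then have "z = enc (z 0 = 1)" by (auto simp: enc_bool_def)
    then show "z \<in> range (enc :: bool \<Rightarrow> _)" by blast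
  qed (force simp: enc_bool_def)
  have "sigma1_real x (\<lambda>z. (\<forall>k. z k = z 0) \<and> (z 0 = 0 \<or> z 0 = 1))" for x
    by (rule sigma1_real_arith, rule arith_conj, rule arith_all[where i = 0], simp; intro arith_intros ar_term_intros)
  then show "sigma1_real x (\<lambda>z. z \<in> range (enc :: bool \<Rightarrow> _))" for x
    unfolding eq .
qed
end

lemma sigma1_real_ev:
  assumes "sigma1_real x A" shows "sigma1_real x (\<lambda>z. A (\<lambda>k. z (2 * k)))"
proof -
  have "ar_closed (\<lambda>G X. \<forall>n k. G (Suc (2 * poly_pair n k)) = G (2 * (2 * k)))"
    by (rule arith_all[where i = 0], simp, rule arith_all[where i = 1], simp, intro arith_intros ar_term_intros)
  then show ?thesis by (rule sigma1_real_trans[OF assms, where T = "\<lambda>z k. z (2 * k)"])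
qed

lemma sigma1_real_od:
  assumes "sigma1_real x A" shows "sigma1_real x (\<lambda>z. A (\<lambda>k. z (Suc (2 * k))))"
proof -
  have "ar_closed (\<lambda>G X. \<forall>n k. G (Suc (2 * poly_pair n k)) = G (2 * Suc (2 * k)))"
    by (rule arith_all[where i = 0], simp, rule arith_all[where i = 1], simp, intro arith_intros ar_term_intros)
  then show ?thesis by (rule sigma1_real_trans[OF assms, where T = "\<lambda>z k. z (Suc (2 * k))"])
qed

instantiation prod :: (point, point) point
begin
definition "enc p = interleave (enc (fst p)) (enc (snd p))"
instance
proof
  have eq: "(\<lambda>k. z (2 * k)) \<in> range (enc :: 'a \<Rightarrow> _) \<and> (\<lambda>k. z (Suc (2 * k))) \<in> range (enc :: 'b \<Rightarrow> _)
     \<longleftrightarrow> z \<in> range (enc :: 'a \<times> 'b \<Rightarrow> _)" for z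
  proof
    assume "(\<lambda>k. z (2 * k)) \<in> range (enc :: 'a \<Rightarrow> _) \<and> (\<lambda>k. z (Suc (2 * k))) \<in> range (enc :: 'b \<Rightarrow> _)"
    then obtain a b where ab: "(\<lambda>k. z (2 * k)) = enc (a::'a)" "(\<lambda>k. z (Suc (2 * k))) = enc (b::'b)" by blast
    then have "z = enc (a, b)" by (metis enc_prod_def fst_conv interleave_eta snd_conv)
    then show "z \<in> range (enc :: 'a \<times> 'b \<Rightarrow> _)" by blast
  qed (force simp: enc_prod_def)
  have "sigma1_real x (\<lambda>z. (\<lambda>k. z (2 * k)) \<in> range (enc :: 'a \<Rightarrow> _) \<and> (\<lambda>k. z (Suc (2 * k))) \<in> range (enc :: 'b \<Rightarrow> _))" for x
    by (intro sigma1_real_conj sigma1_real_ev[OF sigma1_real_range_enc] sigma1_real_od[OF sigma1_real_range_enc])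
  then show "sigma1_real x (\<lambda>z. z \<in> range (enc :: 'a \<times> 'b \<Rightarrow> _))" for x
    unfolding eq .
qed
end

lemma enc_Pair: "enc (a, b) = interleave (enc a) (enc b)"
  by (simp add: enc_prod_def)

lemma sigma1_conj:
  assumes "sigma1 x P" "sigma1 x Q" shows "sigma1 x (\<lambda>a. P a \<and> Q a)"
proof -
  obtain A where A: "sigma1_real x A" "\<And>a. P a = A (enc a)"
    using assms(1) unfolding sigma1_def by blast
  obtain B where B: "sigma1_real x B" "\<And>a. Q a = B (enc a)"
    using assms(2) unfolding sigma1_def by blast
  show ?thesis unfolding sigma1_def
    by (intro exI conjI allI, rule sigma1_real_conj[OF A(1) B(1)]) (simp add: A B)
qed

lemma sigma1_disj:
  assumes "sigma1 x P" "sigma1 x Q" shows "sigma1 x (\<lambda>a. P a \<or> Q a)"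
proof -
  obtain A where A: "sigma1_real x A" "\<And>a. P a = A (enc a)"
    using assms(1) unfolding sigma1_def by blast
  obtain B where B: "sigma1_real x B" "\<And>a. Q a = B (enc a)"
    using assms(2) unfolding sigma1_def by blast
  show ?thesis unfolding sigma1_def
    by (intro exI conjI allI, rule sigma1_real_disj[OF A(1) B(1)]) (simp add: A B)
qed

lemma sigma1_ex:
  fixes P :: "'a::point \<Rightarrow> 'b::point \<Rightarrow> bool"
  assumes "sigma1 x (\<lambda>p. P (fst p) (snd p))" shows "sigma1 x (\<lambda>a. \<exists>b. P a b)"
proof -
  obtain A where A: "sigma1_real x A" "\<And>a b. P a b = A (enc (a, b))"
    using assms unfolding sigma1_def by auto
  have "sigma1_real x (\<lambda>z. \<exists>w. A (interleave z w) \<and> (\<lambda>k. interleave z w (Suc (2 * k))) \<in> range (enc :: 'b \<Rightarrow> _))"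
    by (intro sigma1_real_ex sigma1_real_conj A sigma1_real_od sigma1_real_range_enc)
  moreover have "(\<exists>b. P a b) \<longleftrightarrow> (\<exists>w. A (interleave (enc a) w) \<and> (\<lambda>k. interleave (enc a) w (Suc (2 * k))) \<in> range (enc :: 'b \<Rightarrow> _))" for a
    unfolding A enc_Pair by auto
  ultimately show ?thesis unfolding sigma1_def by blast
qed

lemma sigma1_all_nat:
  fixes P :: "'a::point \<Rightarrow> nat \<Rightarrow> bool"
  assumes "sigma1 x (\<lambda>p. P (fst p) (snd p))" shows "sigma1 x (\<lambda>a. \<forall>b. P a b)"
proof -
  obtain A where A: "sigma1_real x A" "\<And>a b. P a b = A (enc (a, b))"
    using assms unfolding sigma1_def by auto
  have "ar_closed (\<lambda>G X. \<forall>n. (\<forall>k. G (Suc (2 * poly_pair n k)) = interleave (\<lambda>k. G (2 * k)) (\<lambda>_. n) k))"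
    unfolding interleave_unique
    by (rule arith_all[where i = 0], simp, rule arith_all[where i = 1], simp, intro arith_intros ar_term_intros)
  from sigma1_real_trans_all[OF A(1) this]
  have "sigma1_real x (\<lambda>z. \<forall>n. A (interleave z (\<lambda>_. n)))" .
  then show ?thesis unfolding sigma1_def by (intro exI conjI) (auto simp: A(2) enc_Pair enc_nat_def)
qed

text \<open>One notion for functions and predicates. A \<open>\<Sigma>\<^sup>1\<^sub>1\<close> graph
  suffices, because uniqueness of the value makes its complement
  \<open>\<Sigma>\<^sup>1\<^sub>1\<close> as well; for boolean values this is ordinary
  \<open>\<Delta>\<^sup>1\<^sub>1\<close>, see \<open>delta1_bool\<close>.\<close>

definition delta1 :: "cantor \<Rightarrow> ('a::point \<Rightarrow> 'b::point) \<Rightarrow> bool" where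
  "delta1 x g \<longleftrightarrow> sigma1 x (\<lambda>p. enc (g (fst p)) (fst (snd p)) = snd (snd p))"

lemma delta1_graphE:
  assumes "delta1 x g"
  obtains Q where "sigma1_real x Q" "\<And>a i j. Q (interleave (enc a) (interleave (\<lambda>_. i) (\<lambda>_. j))) \<longleftrightarrow> enc (g a) i = j"
proof -
  obtain Q where Q: "sigma1_real x Q" "\<And>p. (enc (g (fst p)) (fst (snd p)) = snd (snd p)) = Q (enc p)"
    using assms unfolding delta1_def sigma1_def by blast
  show ?thesis
    by (rule that[OF Q(1)]) (use Q(2)[of "(_, _, _)"] in \<open>simp add: enc_Pair enc_nat_def\<close>)
qed

text \<open>The encoding of \<open>g a\<close> is guessed as a real \<open>w\<close> and checked
  against the graph of \<open>g\<close> place by place, so that \<open>g\<close> may take reals as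
  values.\<close>

lemma sigma1_subst:
  assumes "sigma1 x P" "delta1 x g" shows "sigma1 x (\<lambda>a. P (g a))"
proof -
  obtain A where A: "sigma1_real x A" "\<And>a. P a = A (enc a)"
    using assms(1) unfolding sigma1_def by blast
  obtain Q where Q: "sigma1_real x Q" "\<And>a i j. Q (interleave (enc a) (interleave (\<lambda>_. i) (\<lambda>_. j))) \<longleftrightarrow> enc (g a) i = j"
    using delta1_graphE[OF assms(2)] by blast
  have C: "ar_closed (\<lambda>G X. \<forall>n. \<forall>k. G (Suc (2 * poly_pair n k)) =
      interleave (\<lambda>k. G (2 * (2 * k))) (interleave (\<lambda>_. n) (\<lambda>_. G (2 * Suc (2 * n)))) k)"
    unfolding interleave_unique all_conj_distrib
    by (intro arith_intros; rule arith_all[where i = 0], simp, rule arith_all[where i = 1], simp, intro arith_intros ar_term_intros)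
  have "sigma1_real x (\<lambda>y. \<forall>n. Q (interleave (\<lambda>k. y (2 * k)) (interleave (\<lambda>_. n) (\<lambda>_. y (Suc (2 * n))))))"
    by (rule sigma1_real_trans_all[OF Q(1), where T = "\<lambda>y n. interleave (\<lambda>k. y (2 * k)) (interleave (\<lambda>_. n) (\<lambda>_. y (Suc (2 * n))))"]) (rule C)
  then have "sigma1_real x (\<lambda>z. \<exists>w. A (\<lambda>k. interleave z w (Suc (2 * k))) \<and>
      (\<forall>n. Q (interleave (\<lambda>k. interleave z w (2 * k)) (interleave (\<lambda>_. n) (\<lambda>_. interleave z w (Suc (2 * n)))))))"
    by (intro sigma1_real_ex sigma1_real_conj A sigma1_real_od)
  moreover have "P (g a) \<longleftrightarrow> (\<exists>w. A (\<lambda>k. interleave (enc a) w (Suc (2 * k))) \<and>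
      (\<forall>n. Q (interleave (\<lambda>k. interleave (enc a) w (2 * k)) (interleave (\<lambda>_. n) (\<lambda>_. interleave (enc a) w (Suc (2 * n)))))))" for a
  proof -
    have "(\<exists>w. A w \<and> (\<forall>n. enc (g a) n = w n)) = A (enc (g a))" by (metis ext)
    then show ?thesis by (simp add: Q A)
  qed
  ultimately show ?thesis unfolding sigma1_def by blast
qed

lemma sigma1_arith:
  assumes "ar_closed B" "\<And>a. P a \<longleftrightarrow> B (enc a) (\<lambda>_. x)" shows "sigma1 x P"
  unfolding sigma1_def by (rule exI, rule conjI, rule sigma1_real_arith[OF assms(1)]) (simp add: assms(2))

text \<open>In the encoding of \<open>(a, i, j)\<close> the places \<open>2 * k\<close> hold
  \<open>enc a k\<close>, place \<open>1\<close> holds \<open>i\<close> and place \<open>3\<close>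
  holds \<open>j\<close>; the formulas of this and the next lemmas read these places.\<close>

lemma delta1_id: "delta1 x (\<lambda>a. a)"
  unfolding delta1_def
  by (rule sigma1_arith[where B = "\<lambda>z X. z (2 * z (Suc 0)) = z (Suc (Suc (Suc 0)))"])
    (intro arith_intros ar_term_intros, auto simp: enc_prod_def enc_nat_def interleave_def)

lemma delta1_fst0: "delta1 x fst"
  unfolding delta1_def
  by (rule sigma1_arith[where B = "\<lambda>z X. z (2 * (2 * z (Suc 0))) = z (Suc (Suc (Suc 0)))"])
    (intro arith_intros ar_term_intros, auto simp: enc_prod_def enc_nat_def interleave_def)

lemma delta1_snd0: "delta1 x snd"
  unfolding delta1_def
  by (rule sigma1_arith[where B = "\<lambda>z X. z (2 * Suc (2 * z (Suc 0))) = z (Suc (Suc (Suc 0)))"])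
    (intro arith_intros ar_term_intros, auto simp: enc_prod_def enc_nat_def interleave_def)

lemma delta1_fstfst0: "delta1 x (\<lambda>p. fst (fst p))"
  unfolding delta1_def
  by (rule sigma1_arith[where B = "\<lambda>z X. z (2 * (2 * (2 * z (Suc 0)))) = z (Suc (Suc (Suc 0)))"])
    (intro arith_intros ar_term_intros, auto simp: enc_prod_def enc_nat_def interleave_def)

lemma delta1_pair:
  assumes "delta1 x g" "delta1 x h" shows "delta1 x (\<lambda>a. (g a, h a))"
proof -
  \<comment> \<open>This treats the places \<open>i\<close> of one parity \<open>c\<close>. The
    quotient is \<open>w 0\<close> for a guessed function \<open>w\<close>, as closure is available
    for function quantifiers at this level.\<close>
  have half: "sigma1_real x (\<lambda>z. \<exists>w::nat \<Rightarrow> nat. z 1 = 2 * w 0 + c \<and> (Q :: _ \<Rightarrow> bool) (interleave (\<lambda>k. z (2 * k)) (interleave (\<lambda>_. w 0) (\<lambda>_. z 3))))"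
    if Q: "sigma1_real x Q" for Q c
  proof -
    let ?T = "\<lambda>y. interleave (\<lambda>k. y (2 * (2 * k))) (interleave (\<lambda>_. y 1) (\<lambda>_. y (2 * 3)))"
    have C: "ar_closed (\<lambda>G X. \<forall>n k. G (Suc (2 * poly_pair n k)) =
        interleave (\<lambda>k. G (2 * (2 * (2 * k)))) (interleave (\<lambda>_. G (2 * 1)) (\<lambda>_. G (2 * (2 * 3)))) k)"
      unfolding interleave_unique all_conj_distrib
      by (intro arith_intros; rule arith_all[where i = 0], simp, rule arith_all[where i = 1], simp, intro arith_intros ar_term_intros)
    have "sigma1_real x (\<lambda>y. Q (?T y))"
      by (rule sigma1_real_trans[OF Q, where T = ?T]) (rule C)
    moreover have "sigma1_real x (\<lambda>y. y (2 * 1) = 2 * y 1 + c)"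
      by (rule sigma1_real_arith[where B = "\<lambda>y X. y (2 * 1) = 2 * y 1 + c"]) (intro arith_intros ar_term_intros)
    ultimately have "sigma1_real x (\<lambda>z. \<exists>w. interleave z w (2 * 1) = 2 * interleave z w 1 + c \<and> Q (?T (interleave z w)))"
      by (intro sigma1_real_ex sigma1_real_conj)
    then show ?thesis unfolding interleave_simps by simp
  qed
  obtain Q where Q: "sigma1_real x Q" "\<And>a i j. Q (interleave (enc a) (interleave (\<lambda>_. i) (\<lambda>_. j))) \<longleftrightarrow> enc (g a) i = j"
    using delta1_graphE[OF assms(1)] by blast
  obtain R where R: "sigma1_real x R" "\<And>a i j. R (interleave (enc a) (interleave (\<lambda>_. i) (\<lambda>_. j))) \<longleftrightarrow> enc (h a) i = j"
    using delta1_graphE[OF assms(2)] by blast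
  have eq: "enc (g a, h a) i = j \<longleftrightarrow>
    (\<exists>w::nat\<Rightarrow>nat. i = 2 * w 0 + 0 \<and> enc (g a) (w 0) = j) \<or> (\<exists>w::nat\<Rightarrow>nat. i = 2 * w 0 + 1 \<and> enc (h a) (w 0) = j)" for a i j
  proof -
    have ex: "(\<exists>w::nat\<Rightarrow>nat. S (w 0)) = (\<exists>n. S n)" for S
    proof
      assume "\<exists>n. S n"
      then obtain n where "S ((\<lambda>_::nat. n) 0)" by blast
      then show "\<exists>w::nat\<Rightarrow>nat. S (w 0)" by (rule exI[where x = "\<lambda>_. n"])
    qed blast
    have "i = 2 * (i div 2) \<or> i = Suc (2 * (i div 2))" by presburger
    then obtain m where "i = 2 * m \<or> i = Suc (2 * m)" by blast
    then show ?thesis unfolding ex[of "\<lambda>n. i = 2 * n + 0 \<and> enc (g a) n = j"] ex[of "\<lambda>n. i = 2 * n + 1 \<and> enc (h a) n = j"]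
      by (auto simp: enc_Pair)
  qed
  show ?thesis unfolding delta1_def sigma1_def
  proof (rule exI, rule conjI, rule sigma1_real_disj[OF half[OF Q(1), of 0] half[OF R(1), of 1]], rule allI)
    fix p :: "'a \<times> nat \<times> nat"
    obtain a i j where p: "p = (a, i, j)" by (cases p rule: prod_cases3)
    have enc3: "enc (a, i, j) = interleave (enc a) (interleave (\<lambda>_. i) (\<lambda>_. j))"
      by (simp add: enc_Pair enc_nat_def)
    have j: "interleave z w 1 = w 0" "interleave z w 3 = w 1" for z w by (simp_all add: interleave_def)
    show "(enc (g (fst p), h (fst p)) (fst (snd p)) = snd (snd p)) =
       ((\<exists>w::nat \<Rightarrow> nat. enc p 1 = 2 * w 0 + 0 \<and> Q (interleave (\<lambda>k. enc p (2 * k)) (interleave (\<lambda>_. w 0) (\<lambda>_. enc p 3)))) \<or>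
        (\<exists>w::nat \<Rightarrow> nat. enc p 1 = 2 * w 0 + 1 \<and> R (interleave (\<lambda>k. enc p (2 * k)) (interleave (\<lambda>_. w 0) (\<lambda>_. enc p 3)))))"
      unfolding p fst_conv snd_conv enc3 j interleave_simps Q R eq ..
  qed
qed

lemma delta1_comp_fst: "delta1 x g \<Longrightarrow> delta1 x (\<lambda>p. g (fst p))"
proof -
  assume g: "delta1 x g"
  have "sigma1 x (\<lambda>p. enc (g (fst (fst (fst p), snd p))) (fst (snd (fst (fst p), snd p))) = snd (snd (fst (fst p), snd p)))"
    by (rule sigma1_subst[OF g[unfolded delta1_def]]) (intro delta1_pair delta1_fstfst0 delta1_snd0)
  then show ?thesis unfolding delta1_def by simp
qed

lemma delta1_comp:
  assumes h: "delta1 x h" and g: "delta1 x g" shows "delta1 x (\<lambda>a. h (g a))"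
proof -
  have "sigma1 x (\<lambda>p. enc (h (fst (g (fst p), snd p))) (fst (snd (g (fst p), snd p))) = snd (snd (g (fst p), snd p)))"
    by (rule sigma1_subst[OF h[unfolded delta1_def]]) (intro delta1_pair delta1_comp_fst g delta1_snd0)
  then show ?thesis unfolding delta1_def by simp
qed

lemma delta1_fst: "delta1 x g \<Longrightarrow> delta1 x (\<lambda>a. fst (g a))"
  by (rule delta1_comp[OF delta1_fst0])

lemma delta1_snd: "delta1 x g \<Longrightarrow> delta1 x (\<lambda>a. snd (g a))"
  by (rule delta1_comp[OF delta1_snd0])

lemmas delta1_basic = delta1_fst delta1_snd delta1_id delta1_pair

text \<open>Codes are total both ways: \<open>decode\<close> is onto, so quantifiers over a coded type become number quantifiers.\<close>

class coded = point +
  fixes code :: "'a \<Rightarrow> nat" and decode :: "nat \<Rightarrow> 'a"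
  assumes decode_code [simp]: "decode (code a) = a"
    and enc_code: "enc a = (\<lambda>_. code a)"
    and sigma1_decode: "sigma1 x (\<lambda>p. code (decode (fst p)) = snd p)"

lemma code_eq_iff [simp]: "code (a::'a::coded) = code b \<longleftrightarrow> a = b"
  by (metis decode_code)

instantiation nat :: coded
begin
definition "code n = (n::nat)"
definition "decode n = (n::nat)"
instance
  by standard (auto simp: code_nat_def decode_nat_def enc_nat_def enc_prod_def
     intro!: sigma1_arith[where B = "\<lambda>z X. z 0 = z (Suc 0)"] arith_intros ar_term_intros)
end

lemma delta1_const: "delta1 x (\<lambda>a. c :: 'b::coded)"
  unfolding delta1_def enc_code
  by (rule sigma1_arith[where B = "\<lambda>z X. code c = z (Suc (Suc (Suc 0)))"])
    (intro arith_intros ar_term_intros, auto simp: enc_prod_def enc_nat_def interleave_def)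

lemma delta1_coded_iff: "delta1 x (g :: 'a::point \<Rightarrow> 'b::coded) \<longleftrightarrow> sigma1 x (\<lambda>p. code (g (fst p)) = snd p)"
proof
  assume "delta1 x g"
  then have "sigma1 x (\<lambda>p :: 'a \<times> nat \<times> nat. code (g (fst p)) = snd (snd p))" unfolding delta1_def enc_code .
  from sigma1_subst[OF this, of "\<lambda>p. (fst p, 0::nat, snd p)"]
  show "sigma1 x (\<lambda>p. code (g (fst p)) = snd p)"
    by (simp add: delta1_basic delta1_const)
next
  assume "sigma1 x (\<lambda>p. code (g (fst p)) = snd p)"
  then have "sigma1 x (\<lambda>p :: 'a \<times> nat \<times> nat. code (g (fst (fst p, snd (snd p)))) = snd (fst p, snd (snd p)))"
    by (rule sigma1_subst) (intro delta1_basic)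
  then show "delta1 x g" by (simp add: delta1_def enc_code)
qed

lemma delta1_decode: "delta1 x (decode :: nat \<Rightarrow> 'a::coded)"
  unfolding delta1_coded_iff by (rule sigma1_decode)

lemma delta1_code: "delta1 x (code :: 'a::coded \<Rightarrow> nat)"
  unfolding delta1_coded_iff code_nat_def
  by (rule sigma1_arith[where B = "\<lambda>z X. z 0 = z (Suc 0)"])
     (intro arith_intros ar_term_intros, auto simp: enc_prod_def enc_nat_def enc_code)

instantiation bool :: coded
begin
definition "code b = (of_bool b :: nat)"
definition "decode n = (n \<noteq> (0::nat))"
instance
  by standard (auto simp: code_bool_def decode_bool_def enc_nat_def enc_prod_def enc_bool_def
     intro!: sigma1_arith[where B = "\<lambda>z X. z 0 = 0 \<and> z (Suc 0) = 0 \<or> \<not> z 0 = 0 \<and> z (Suc 0) = 1"] arith_intros ar_term_intros)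
end

lemma sigma1_eq0: "sigma1 x (\<lambda>p::nat \<times> nat. fst p = snd p)"
  by (rule sigma1_arith[where B = "\<lambda>z X. z 0 = z (Suc 0)"])
     (intro arith_intros ar_term_intros, auto simp: enc_prod_def enc_nat_def enc_code)

lemma sigma1_neq0: "sigma1 x (\<lambda>p::nat \<times> nat. fst p \<noteq> snd p)"
  by (rule sigma1_arith[where B = "\<lambda>z X. \<not> z 0 = z (Suc 0)"])
     (intro arith_intros ar_term_intros, auto simp: enc_prod_def enc_nat_def enc_code)

lemma delta1_bool: "delta1 x P \<longleftrightarrow> sigma1 x P \<and> sigma1 x (\<lambda>a. \<not> P a)"
proof (intro iffI conjI)
  assume "delta1 x P"
  then have *: "sigma1 x (\<lambda>p. code (P (fst p)) = snd p)" unfolding delta1_coded_iff .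
  from sigma1_subst[OF *, of "\<lambda>a. (a, 1)"] show "sigma1 x P"
    by (simp add: delta1_basic delta1_const code_bool_def del: One_nat_def)
  from sigma1_subst[OF *, of "\<lambda>a. (a, 0)"] show "sigma1 x (\<lambda>a. \<not> P a)"
    by (simp add: delta1_basic delta1_const code_bool_def del: One_nat_def)
next
  assume *: "sigma1 x P \<and> sigma1 x (\<lambda>a. \<not> P a)"
  have eq: "code b = j \<longleftrightarrow> b \<and> fst (j, 1::nat) = snd (j, 1::nat) \<or> \<not> b \<and> fst (j, 0::nat) = snd (j, 0::nat)" for b j
    by (auto simp: code_bool_def)
  show "delta1 x P" unfolding delta1_coded_iff eq
    by (intro sigma1_conj sigma1_disj sigma1_subst[OF conjunct1[OF *]] sigma1_subst[OF conjunct2[OF *]]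
       sigma1_subst[OF sigma1_eq0] delta1_basic delta1_const)
qed

lemma delta1_imp_sigma1: "delta1 x P \<Longrightarrow> sigma1 x P"
  by (simp add: delta1_bool)

lemma delta1_not: "delta1 x P \<Longrightarrow> delta1 x (\<lambda>a. \<not> P a)"
  by (simp add: delta1_bool)

lemma delta1_conj: "delta1 x P \<Longrightarrow> delta1 x Q \<Longrightarrow> delta1 x (\<lambda>a. P a \<and> Q a)"
  unfolding delta1_bool de_Morgan_conj by (intro conjI sigma1_conj sigma1_disj) auto

lemma delta1_disj: "delta1 x P \<Longrightarrow> delta1 x Q \<Longrightarrow> delta1 x (\<lambda>a. P a \<or> Q a)"
  unfolding delta1_bool de_Morgan_disj by (intro conjI sigma1_conj sigma1_disj) auto

lemma delta1_imp: "delta1 x P \<Longrightarrow> delta1 x Q \<Longrightarrow> delta1 x (\<lambda>a. P a \<longrightarrow> Q a)"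
  unfolding imp_conv_disj by (intro delta1_disj delta1_not)

lemma delta1_iff: "delta1 x P \<Longrightarrow> delta1 x Q \<Longrightarrow> delta1 x (\<lambda>a. P a \<longleftrightarrow> Q a)"
  unfolding iff_conv_conj_imp by (intro delta1_conj delta1_imp)

lemma sigma1_imp: "delta1 x P \<Longrightarrow> sigma1 x Q \<Longrightarrow> sigma1 x (\<lambda>a. P a \<longrightarrow> Q a)"
  unfolding imp_conv_disj by (rule sigma1_disj[OF delta1_imp_sigma1[OF delta1_not]])

lemma sigma1_all:
  fixes P :: "'a::point \<Rightarrow> 'b::coded \<Rightarrow> bool"
  assumes "sigma1 x (\<lambda>p. P (fst p) (snd p))" shows "sigma1 x (\<lambda>a. \<forall>b. P a b)"
proof -
  have "sigma1 x (\<lambda>p. P (fst p) (decode (snd p)))"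
    using sigma1_subst[OF assms, of "\<lambda>p. (fst p, decode (snd p))"]
    by (simp add: delta1_basic delta1_comp[OF delta1_decode])
  then have "sigma1 x (\<lambda>a. \<forall>n. P a (decode n))" by (rule sigma1_all_nat)
  moreover have "(\<forall>n. P a (decode n)) = (\<forall>b. P a b)" for a by (metis decode_code)
  ultimately show ?thesis by simp
qed

lemma delta1_all:
  fixes P :: "'a::point \<Rightarrow> 'b::coded \<Rightarrow> bool"
  assumes "delta1 x (\<lambda>p. P (fst p) (snd p))" shows "delta1 x (\<lambda>a. \<forall>b. P a b)"
  using assms unfolding delta1_bool not_all by (intro conjI sigma1_all sigma1_ex) auto

lemma delta1_ex:
  fixes P :: "'a::point \<Rightarrow> 'b::coded \<Rightarrow> bool"
  assumes "delta1 x (\<lambda>p. P (fst p) (snd p))" shows "delta1 x (\<lambda>a. \<exists>b. P a b)"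
  using assms unfolding delta1_bool not_ex by (intro conjI sigma1_all sigma1_ex) auto

lemma delta1_eq: "delta1 x s \<Longrightarrow> delta1 x t \<Longrightarrow> delta1 x (\<lambda>a. s a = (t a :: 'b::coded))"
proof -
  assume st: "delta1 x s" "delta1 x t"
  have "delta1 x (\<lambda>p::nat \<times> nat. fst p = snd p)" by (simp add: delta1_bool sigma1_eq0 sigma1_neq0)
  from delta1_comp[OF this, of "\<lambda>a. (code (s a), code (t a))"] show ?thesis
    by (simp add: delta1_basic delta1_comp[OF delta1_code] st)
qed

lemma delta1_graph:
  fixes g :: "'a::point \<Rightarrow> 'b::coded"
  assumes "sigma1 x (\<lambda>p. g (fst p) = snd p)" shows "delta1 x g"
proof -
  have "sigma1 x (\<lambda>p. g (fst (fst (fst p), snd p)) = snd (fst (fst p), snd p))"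
    by (rule sigma1_subst[OF assms]) (intro delta1_basic)
  then have 1: "sigma1 x (\<lambda>p. g (fst (fst p)) = snd p)" by simp
  have 2: "sigma1 x (\<lambda>p. code (snd p :: 'b) = snd (fst p))"
    by (intro delta1_imp_sigma1 delta1_eq delta1_basic delta1_comp[OF delta1_code])
  have "sigma1 x (\<lambda>p. \<exists>b. g (fst p) = b \<and> code b = snd p)"
    by (rule sigma1_ex, rule sigma1_conj, rule 1, rule 2)
  then show ?thesis by (simp only: delta1_coded_iff simp_thms ex_simps)
qed

lemma delta1_if:
  fixes s t :: "'a::point \<Rightarrow> 'b::coded"
  assumes "delta1 x P" "delta1 x s" "delta1 x t" shows "delta1 x (\<lambda>a. if P a then s a else t a)"
proof (rule delta1_graph)
  have "sigma1 x (\<lambda>p. P (fst p) \<and> s (fst p) = snd p \<or> \<not> P (fst p) \<and> t (fst p) = snd p)"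
    by (intro sigma1_disj sigma1_conj delta1_imp_sigma1 delta1_not delta1_comp[OF assms(1)] delta1_eq delta1_comp[OF assms(2)]
      delta1_comp[OF assms(3)] delta1_basic)
  then show "sigma1 x (\<lambda>p. (if P (fst p) then s (fst p) else t (fst p)) = snd p)"
    by (rule back_subst[of "sigma1 x"]) auto
qed

lemma delta1_plus0: "delta1 x (\<lambda>p::nat \<times> nat. fst p + snd p)"
  unfolding delta1_coded_iff code_nat_def
  by (rule sigma1_arith[where B = "\<lambda>z X. z 0 + z (2 * 1) = z 1"])
     (intro arith_intros ar_term_intros, auto simp: enc_prod_def enc_nat_def enc_code interleave_def)

lemma delta1_times0: "delta1 x (\<lambda>p::nat \<times> nat. fst p * snd p)"
  unfolding delta1_coded_iff code_nat_def
  by (rule sigma1_arith[where B = "\<lambda>z X. z 0 * z (2 * 1) = z 1"])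
     (intro arith_intros ar_term_intros, auto simp: enc_prod_def enc_nat_def enc_code interleave_def)

lemma delta1_plus: "delta1 x s \<Longrightarrow> delta1 x t \<Longrightarrow> delta1 x (\<lambda>a. s a + (t a :: nat))"
  using delta1_comp[OF delta1_plus0 delta1_pair, of x s t] by simp

lemma delta1_times: "delta1 x s \<Longrightarrow> delta1 x t \<Longrightarrow> delta1 x (\<lambda>a. s a * (t a :: nat))"
  using delta1_comp[OF delta1_times0 delta1_pair, of x s t] by simp

lemma delta1_Suc: "delta1 x s \<Longrightarrow> delta1 x (\<lambda>a. Suc (s a))"
  using delta1_plus[OF _ delta1_const[where c = 1], of x s] by simp

lemma delta1_le: "delta1 x s \<Longrightarrow> delta1 x t \<Longrightarrow> delta1 x (\<lambda>a. s a \<le> (t a :: nat))"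
proof -
  assume s: "delta1 x s" and t: "delta1 x t"
  have "delta1 x (\<lambda>a. \<exists>k. t a = s a + k)"
    by (intro delta1_ex delta1_eq delta1_plus delta1_comp[OF s] delta1_comp[OF t] delta1_basic)
  then show ?thesis unfolding le_iff_add .
qed

lemma delta1_less: "delta1 x s \<Longrightarrow> delta1 x t \<Longrightarrow> delta1 x (\<lambda>a. s a < (t a :: nat))"
  unfolding Suc_le_eq[symmetric] by (intro delta1_le delta1_Suc)

section \<open>Codes for functions and lists\<close>

text \<open>For arguments of functions: \<open>code\<close> is a bijection, so a function and its
  sequence of coded values determine each other.\<close>

class index_point = coded +
  assumes code_decode [simp]: "code (decode n) = n"

text \<open>For values of functions: if the codes are all numbers or an initial segment of them, the
  sequences of codes form an arithmetical set.\<close>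

class value_point = coded +
  assumes range_code: "range code = UNIV \<or> (\<exists>b. range code = {..<b})"

instance nat :: index_point by standard (simp add: code_nat_def decode_nat_def)
instance nat :: value_point by standard (simp add: code_nat_def[abs_def])
instance bool :: value_point
proof
  have "range (code :: bool \<Rightarrow> nat) = {..<2}"
    unfolding UNIV_bool by (auto simp: code_bool_def)
  then show "range (code :: bool \<Rightarrow> nat) = UNIV \<or> (\<exists>b. range (code :: bool \<Rightarrow> nat) = {..<b})" by blast
qed

instantiation "fun" :: (index_point, value_point) point
begin
definition "enc f = (\<lambda>i. code (f (decode i)))"
instance
proof
  have eq: "(\<forall>i. z i \<in> range (code :: 'b \<Rightarrow> nat)) \<longleftrightarrow> z \<in> range (enc :: ('a \<Rightarrow> 'b) \<Rightarrow> _)" for z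
  proof
    assume "\<forall>i. z i \<in> range (code :: 'b \<Rightarrow> nat)"
    then have "\<forall>i. \<exists>b. z i = code (b :: 'b)" by blast
    from choice[OF this] obtain g where "\<And>i. z i = code (g i :: 'b)" by blast
    then have "z = enc (\<lambda>a::'a. g (code a))" by (auto simp: enc_fun_def)
    then show "z \<in> range (enc :: ('a \<Rightarrow> 'b) \<Rightarrow> _)" by blast
  qed (auto simp: enc_fun_def)
  have "sigma1_real x (\<lambda>z. \<forall>i. z i \<in> range (code :: 'b \<Rightarrow> nat))" for x
  proof (cases "range (code :: 'b \<Rightarrow> nat) = UNIV")
    case True
    have "sigma1_real x (\<lambda>z. z 0 = z 0)"
      by (rule sigma1_real_arith[where B = "\<lambda>z X. z 0 = z 0"]) (intro arith_intros ar_term_intros)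
    then show ?thesis by (simp add: True)
  next
    case False
    then obtain b where b: "range (code :: 'b \<Rightarrow> nat) = {..<b}" using range_code by blast
    have "ar_closed (\<lambda>z X. \<forall>i. \<exists>k. Suc (z i + k) = b)"
      by (rule arith_all[where i = 0], simp, rule arith_ex[where i = 1], simp, intro arith_intros ar_term_intros)
    from sigma1_real_arith[OF this] have "sigma1_real x (\<lambda>z. \<forall>i. \<exists>k. Suc (z i + k) = b)" .
    moreover have "(\<exists>k. Suc (m + k) = b) \<longleftrightarrow> m \<in> {..<b}" for m
      by (auto simp: less_iff_Suc_add)
    ultimately show ?thesis by (simp add: b)
  qed
  then show "sigma1_real x (\<lambda>z. z \<in> range (enc :: ('a \<Rightarrow> 'b) \<Rightarrow> _))" for x
    unfolding eq .
qed
end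

lemma enc_real [simp]: "enc (z :: nat \<Rightarrow> nat) = z"
  by (simp add: enc_fun_def code_nat_def decode_nat_def)

lemma sigma1_real_iff_sigma1: "sigma1_real x A \<longleftrightarrow> sigma1 x A"
proof
  assume "sigma1 x A"
  then obtain B where B: "sigma1_real x B" "\<And>a. A a = B a" by (auto simp: sigma1_def)
  have "A = B" by (rule ext) (rule B(2))
  with B(1) show "sigma1_real x A" by simp
qed (auto simp: sigma1_def)

lemma delta1_lambda:
  fixes g :: "'a::point \<Rightarrow> 'b::index_point \<Rightarrow> 'c::value_point"
  assumes "delta1 x (\<lambda>p. g (fst p) (snd p))"
  shows "delta1 x (\<lambda>a. (\<lambda>n. g a n))"
proof -
  have 1: "sigma1 x (\<lambda>p :: ('a \<times> 'b) \<times> nat. code (g (fst (fst p)) (snd (fst p))) = snd p)"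
    using assms unfolding delta1_coded_iff .
  have "sigma1 x (\<lambda>p :: 'a \<times> nat \<times> nat. code (g (fst (fst ((fst p, decode (fst (snd p)) :: 'b), snd (snd p))))
       (snd (fst ((fst p, decode (fst (snd p)) :: 'b), snd (snd p))))) = snd ((fst p, decode (fst (snd p)) :: 'b), snd (snd p)))"
    by (rule sigma1_subst[OF 1]) (intro delta1_basic delta1_comp[OF delta1_decode])
  then show ?thesis by (simp add: delta1_def enc_fun_def)
qed

lemma delta1_app:
  fixes f :: "'a::point \<Rightarrow> 'b::index_point \<Rightarrow> 'c::value_point"
  assumes f: "delta1 x f" and t: "delta1 x t"
  shows "delta1 x (\<lambda>a. f a (t a))"
proof -
  have "sigma1 x (\<lambda>p :: 'a \<times> nat. enc (f (fst (fst p, code (t (fst p)), snd p))) (fst (snd (fst p, code (t (fst p)), snd p)))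
      = snd (snd (fst p, code (t (fst p)), snd p)))"
    by (rule sigma1_subst[OF f[unfolded delta1_def]]) (intro delta1_basic delta1_comp[OF delta1_code] delta1_comp[OF t])
  then show ?thesis by (simp add: delta1_coded_iff enc_fun_def)
qed

lemmas delta1_app_id = delta1_app[OF delta1_id]
lemmas delta1_app_fst = delta1_app[OF delta1_fst]
lemmas delta1_app_snd = delta1_app[OF delta1_snd]

lemma delta1_oracle: "delta1 x x"
  unfolding delta1_coded_iff
  by (rule sigma1_arith[where B = "\<lambda>z X. X 0 (z 0) \<and> z (Suc 0) = 1 \<or> \<not> X 0 (z 0) \<and> z (Suc 0) = 0"])
    (intro arith_intros ar_term_intros, auto simp: enc_prod_def enc_nat_def code_bool_def)

text \<open>Set atoms are replaced by a false formula, which hard-wires the empty oracle whatever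
  the set variables denote.\<close>

lemma sigma1_mono:
  assumes "sigma1 empty_real P" shows "sigma1 x P"
proof -
  obtain A where A: "sigma1_real empty_real A" "\<And>a. P a = A (enc a)"
    using assms unfolding sigma1_def by blast
  obtain B where B: "ar_closed B" "\<And>z. A z \<longleftrightarrow> (\<exists>F. (\<forall>k. F (2 * k) = z k) \<and> B F (\<lambda>_. empty_real))"
    using A(1) unfolding sigma1_real_def by blast
  have h: "arith (\<lambda>F X e. B (\<lambda>k. F k) (\<lambda>_. empty_real))"
    by (rule arith_subst[OF B(1) poly_fun_arg, where E = "\<lambda>i t. Neg (Equals Zero Zero)"]) simp
  have "sigma1_real x A" unfolding sigma1_real_def
    by (rule exI[where x = "\<lambda>F X. B F (\<lambda>_. empty_real)"]) (use h B(2) in simp)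
  then show ?thesis using A(2) unfolding sigma1_def by blast
qed

lemma delta1_mono: "delta1 empty_real g \<Longrightarrow> delta1 x g"
  unfolding delta1_def by (rule sigma1_mono)

lemmas delta1_logic = delta1_not delta1_conj delta1_disj delta1_imp delta1_iff delta1_all delta1_ex delta1_eq delta1_le delta1_less
lemmas delta1_arith = delta1_plus delta1_times delta1_Suc delta1_const
lemmas delta1_intros = delta1_logic delta1_arith delta1_basic

lemma delta1_Least:
  assumes "delta1 x (\<lambda>p. P (fst p) (snd p))" shows "delta1 x (\<lambda>a. LEAST n::nat. P a n)"
proof (rule delta1_graph)
  \<comment> \<open>If no number satisfies \<open>P a\<close>, the value is this fixed unspecified
    number, so the graph still has a definition by cases.\<close>
  define c where "c = (LEAST n::nat. False)"
  note P = delta1_comp[OF assms delta1_pair, simplified]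
  have eq: "(LEAST n. P a n) = v \<longleftrightarrow> (P a v \<and> (\<forall>m. m < v \<longrightarrow> \<not> P a m)) \<or> ((\<forall>n. \<not> P a n) \<and> v = c)" for a v
  proof (cases "\<exists>n. P a n")
    case True
    then have "P a (LEAST n. P a n)" by (metis LeastI)
    moreover have "(LEAST n. P a n) = v" if "P a v" "\<forall>m. m < v \<longrightarrow> \<not> P a m"
      by (rule Least_equality) (use that in \<open>auto simp: not_less[symmetric]\<close>)
    ultimately show ?thesis using not_less_Least by blast
  next
    case False
    then have "P a = (\<lambda>_. False)" by auto
    then show ?thesis by (auto simp: c_def)
  qed
  show "sigma1 x (\<lambda>p. (LEAST n. P (fst p) n) = snd p)"
    unfolding eq by (rule delta1_imp_sigma1) (intro delta1_intros P)
qed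

lemma delta1_minus: assumes "delta1 x s" "delta1 x t" shows "delta1 x (\<lambda>a. s a - (t a :: nat))"
proof (rule delta1_graph)
  have eq: "m - n = v \<longleftrightarrow> m = n + v \<or> (m < n \<and> v = 0)" for m n v :: nat by auto
  show "sigma1 x (\<lambda>p. s (fst p) - t (fst p) = snd p)"
    unfolding eq by (rule delta1_imp_sigma1) (intro delta1_intros delta1_comp[OF assms(1)] delta1_comp[OF assms(2)])
qed

text \<open>The graph quantifies over the whole course of values \<open>h\<close> as a real; this is
  harmless since a \<open>\<Sigma>\<^sup>1\<^sub>1\<close> graph suffices.\<close>

lemma delta1_rec:
  fixes z :: "'a::point \<Rightarrow> nat"
  assumes z: "delta1 x z" and s: "delta1 x (\<lambda>p. s (fst p) (fst (snd p)) (snd (snd p)))" and n: "delta1 x n"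
  shows "delta1 x (\<lambda>a. rec_nat (z a) (\<lambda>k r. s a k r) (n a))"
proof (rule delta1_graph)
  have eq: "rec_nat (z a) (\<lambda>k r. s a k r) (n a) = v \<longleftrightarrow>
      (\<exists>h :: nat \<Rightarrow> nat. h 0 = z a \<and> (\<forall>k. h (Suc k) = s a k (h k)) \<and> h (n a) = v)" for a v
  proof
    assume "rec_nat (z a) (\<lambda>k r. s a k r) (n a) = v"
    then show "\<exists>h :: nat \<Rightarrow> nat. h 0 = z a \<and> (\<forall>k. h (Suc k) = s a k (h k)) \<and> h (n a) = v"
      by (intro exI[where x = "rec_nat (z a) (\<lambda>k r. s a k r)"]) simp
  next
    assume "\<exists>h :: nat \<Rightarrow> nat. h 0 = z a \<and> (\<forall>k. h (Suc k) = s a k (h k)) \<and> h (n a) = v"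
    then obtain h :: "nat \<Rightarrow> nat" where h: "h 0 = z a" "\<And>k. h (Suc k) = s a k (h k)" "h (n a) = v" by blast
    have "h m = rec_nat (z a) (\<lambda>k r. s a k r) m" for m by (induction m) (simp_all add: h)
    then show "rec_nat (z a) (\<lambda>k r. s a k r) (n a) = v" using h(3) by simp
  qed
  note s' = delta1_comp[OF s delta1_pair[OF _ delta1_pair], simplified]
  show "sigma1 x (\<lambda>p. rec_nat (z (fst p)) (\<lambda>k r. s (fst p) k r) (n (fst p)) = snd p)"
    unfolding eq
    by (rule sigma1_ex, rule delta1_imp_sigma1) (intro delta1_intros delta1_app_snd s' delta1_comp[OF z] delta1_comp[OF n])
qed

lemma delta1_power: assumes "delta1 x s" "delta1 x t" shows "delta1 x (\<lambda>a. s a ^ t a :: nat)"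
proof -
  have "m ^ n = rec_nat 1 (\<lambda>k r. r * m) n" for m n :: nat by (induction n) auto
  then show ?thesis by (simp only:) (intro delta1_rec assms delta1_intros delta1_comp[OF assms(1)])
qed

lemma delta1_prod_encode0: "delta1 x prod_encode"
proof (rule delta1_graph)
  have eq: "prod_encode p = v \<longleftrightarrow> 2 * v = (fst p + snd p) * Suc (fst p + snd p) + 2 * fst p" for p v
  proof -
    have "even (k * Suc k)" for k :: nat by simp
    then have "2 * triangle k = k * Suc k" for k :: nat unfolding triangle_def by (rule dvd_mult_div_cancel)
    then have "2 * prod_encode p = (fst p + snd p) * Suc (fst p + snd p) + 2 * fst p"
      by (cases p) (simp add: prod_encode_def distrib_left)
    then show ?thesis by auto
  qed
  show "sigma1 x (\<lambda>p. prod_encode (fst p) = snd p)"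
    unfolding eq by (rule delta1_imp_sigma1) (intro delta1_intros)
qed

lemmas delta1_prod_encode = delta1_comp[OF delta1_prod_encode0]

lemma prod_decode_fst_iff: "fst (prod_decode n) = m \<longleftrightarrow> (\<exists>k. prod_encode (m, k) = n)"
  by (metis prod.collapse prod_decode_inverse prod_encode_inverse fst_conv)

lemma prod_decode_snd_iff: "snd (prod_decode n) = m \<longleftrightarrow> (\<exists>k. prod_encode (k, m) = n)"
  by (metis prod.collapse prod_decode_inverse prod_encode_inverse snd_conv)

lemma delta1_fst_prod_decode: "delta1 x t \<Longrightarrow> delta1 x (\<lambda>a. fst (prod_decode (t a)))"
proof (rule delta1_comp[of x "\<lambda>n. fst (prod_decode n)"], rule delta1_graph)
  show "sigma1 x (\<lambda>p. fst (prod_decode (fst p)) = snd p)"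
    unfolding prod_decode_fst_iff by (rule delta1_imp_sigma1) (intro delta1_intros delta1_prod_encode)
qed

lemma delta1_snd_prod_decode: "delta1 x t \<Longrightarrow> delta1 x (\<lambda>a. snd (prod_decode (t a)))"
proof (rule delta1_comp[of x "\<lambda>n. snd (prod_decode n)"], rule delta1_graph)
  show "sigma1 x (\<lambda>p. snd (prod_decode (fst p)) = snd p)"
    unfolding prod_decode_snd_iff by (rule delta1_imp_sigma1) (intro delta1_intros delta1_prod_encode)
qed

text \<open>The code of the \<open>i\<close>-th tail. A non-empty list is coded by the successor of
  a pair of its head and the code of its tail, and \<open>0\<close> codes the empty list.\<close>

definition ltl :: "nat \<Rightarrow> nat \<Rightarrow> nat" where
  "ltl n i = rec_nat n (\<lambda>k r. if r = 0 then 0 else snd (prod_decode (r - 1))) i"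

lemma ltl_eq: "ltl n i = list_encode (drop i (list_decode n))"
proof (induction i)
  case 0
  then show ?case by (simp add: ltl_def)
next
  case (Suc i)
  have "ltl n (Suc i) = (if ltl n i = 0 then 0 else snd (prod_decode (ltl n i - 1)))"
    by (simp add: ltl_def)
  moreover have "drop (Suc i) xs = tl (drop i xs)" for xs :: "nat list" by (simp add: drop_Suc tl_drop)
  ultimately show ?case unfolding Suc by (cases "drop i (list_decode n)") auto
qed

definition llen :: "nat \<Rightarrow> nat" where "llen n = length (list_decode n)"

definition lget :: "nat \<Rightarrow> nat \<Rightarrow> nat" where
  "lget n i = (if i < length (list_decode n) then list_decode n ! i else 0)"

lemma delta1_ltl: "delta1 x s \<Longrightarrow> delta1 x t \<Longrightarrow> delta1 x (\<lambda>a. ltl (s a) (t a))"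
  unfolding ltl_def by (intro delta1_rec delta1_if delta1_intros delta1_snd_prod_decode delta1_minus)

lemma list_encode_0_iff: "list_encode xs = 0 \<longleftrightarrow> xs = []"
  by (cases xs) auto

lemma delta1_llen: "delta1 x s \<Longrightarrow> delta1 x (\<lambda>a. llen (s a))"
proof (rule delta1_comp[of x llen])
  have "llen n = (LEAST i. ltl n i = 0)" for n
    by (rule Least_equality[symmetric]) (auto simp: ltl_eq llen_def list_encode_0_iff)
  then have eq: "llen = (\<lambda>n. LEAST i. ltl n i = 0)" by (rule ext)
  show "delta1 x llen"
    unfolding eq by (intro delta1_Least delta1_intros delta1_ltl)
qed

lemma delta1_lget: "delta1 x s \<Longrightarrow> delta1 x t \<Longrightarrow> delta1 x (\<lambda>a. lget (s a) (t a))"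
proof -
  have eq: "lget n i = (if ltl n i = 0 then 0 else fst (prod_decode (ltl n i - 1)))" for n i
  proof (cases "i < length (list_decode n)")
    case True
    then have "drop i (list_decode n) = list_decode n ! i # drop (Suc i) (list_decode n)"
      by (rule Cons_nth_drop_Suc[symmetric])
    then show ?thesis using True by (simp add: ltl_eq lget_def)
  qed (simp add: ltl_eq lget_def)
  show "delta1 x s \<Longrightarrow> delta1 x t \<Longrightarrow> delta1 x (\<lambda>a. lget (s a) (t a))"
    unfolding eq by (intro delta1_if delta1_intros delta1_ltl delta1_fst_prod_decode delta1_minus)
qed

lemma list_encode_eq_iff: "list_encode xs = j \<longleftrightarrow> length xs = llen j \<and> (\<forall>i. i < length xs \<longrightarrow> xs ! i = lget j i)"
proof -
  have "list_encode xs = j \<longleftrightarrow> xs = list_decode j" by (metis list_decode_inverse list_encode_inverse)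
  also have "\<dots> \<longleftrightarrow> length xs = length (list_decode j) \<and> (\<forall>i<length xs. xs ! i = list_decode j ! i)"
    by (rule list_eq_iff_nth_eq)
  finally show ?thesis by (simp add: llen_def lget_def cong: conj_cong)
qed

text \<open>Decoding and recoding all entries normalises a list code. The map is needed for
  \<open>sigma1_decode\<close>, and its fixed points are exactly the codes of lists over the entry
  type.\<close>

lemma sigma1_list_norm: "sigma1 x (\<lambda>p. list_encode (map (\<lambda>n. code (decode n :: 'a::coded)) (list_decode (fst p))) = snd p)"
proof -
  have eq: "list_encode (map (\<lambda>n. code (decode n :: 'a::coded)) (list_decode m)) = j \<longleftrightarrow>
    llen m = llen j \<and> (\<forall>i. i < llen m \<longrightarrow> code (decode (lget m i) :: 'a) = lget j i)" for m j
    unfolding list_encode_eq_iff by (auto simp: llen_def lget_def)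
  show ?thesis unfolding eq
    by (rule delta1_imp_sigma1) (intro delta1_intros delta1_llen delta1_lget delta1_comp[OF delta1_code] delta1_comp[OF delta1_decode])
qed

instantiation list :: (coded) coded
begin
definition "code xs = list_encode (map code xs)"
definition "decode n = map decode (list_decode n)"
definition "enc (xs :: 'a list) = (\<lambda>_::nat. list_encode (map code xs))"
instance
proof
  show "decode (code a) = a" for a :: "'a list"
    by (simp add: code_list_def decode_list_def comp_def)
  show "enc a = (\<lambda>_. code a)" for a :: "'a list"
    by (simp add: enc_list_def code_list_def)
  show "sigma1 x (\<lambda>p. code (decode (fst p) :: 'a list) = snd p)" for x
    unfolding code_list_def decode_list_def map_map comp_def by (rule sigma1_list_norm)
  have eq: "z \<in> range (enc :: 'a list \<Rightarrow> _) \<longleftrightarrow> (\<forall>k. z k = z 0) \<and>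
      list_encode (map (\<lambda>n. code (decode n :: 'a::coded)) (list_decode (z 0))) = z 0" for z
  proof
    assume *: "(\<forall>k. z k = z 0) \<and> list_encode (map (\<lambda>n. code (decode n :: 'a::coded)) (list_decode (z 0))) = z 0"
    then have "z = enc (map (\<lambda>n. decode n :: 'a) (list_decode (z 0)))"
      by (auto simp: enc_list_def comp_def)
    then show "z \<in> range (enc :: 'a list \<Rightarrow> _)" by blast
  qed (auto simp: enc_list_def comp_def)
  have "sigma1 x (\<lambda>z :: nat \<Rightarrow> nat. list_encode (map (\<lambda>n. code (decode n :: 'a::coded)) (list_decode (fst (z 0, z 0)))) = snd (z 0, z 0))" for x
    by (rule sigma1_subst[OF sigma1_list_norm]) (intro delta1_basic delta1_app_id delta1_const)
  then have "sigma1 x (\<lambda>z :: nat \<Rightarrow> nat. (\<forall>k. z k = z 0) \<and>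
      list_encode (map (\<lambda>n. code (decode n :: 'a::coded)) (list_decode (z 0))) = z 0)" for x
    by (intro sigma1_conj) (rule delta1_imp_sigma1, intro delta1_intros delta1_app_fst delta1_app_id, simp)
  then show "sigma1_real x (\<lambda>z. z \<in> range (enc :: 'a list \<Rightarrow> _))" for x
    unfolding eq sigma1_real_iff_sigma1 .
qed
end

lemma delta1_length: "delta1 x t \<Longrightarrow> delta1 x (\<lambda>a. length (t a :: 'b::coded list))"
  using delta1_llen[OF delta1_comp[OF delta1_code], of x t] by (simp add: llen_def code_list_def)

text \<open>Totality makes access \<open>\<Delta>\<^sup>1\<^sub>1\<close> without side conditions.
  The default also pads an initial segment to a full real, which is used to approximate reals by
  their prefixes.\<close>

definition nth0 :: "'a::coded list \<Rightarrow> nat \<Rightarrow> 'a" where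
  "nth0 xs i = (if i < length xs then xs ! i else decode 0)"

lemma nth0_nth [simp]: "i < length xs \<Longrightarrow> nth0 xs i = xs ! i"
  by (simp add: nth0_def)

lemma delta1_nth0: "delta1 x s \<Longrightarrow> delta1 x t \<Longrightarrow> delta1 x (\<lambda>a. nth0 (s a :: 'b::coded list) (t a))"
proof -
  have eq: "nth0 xs i = decode (lget (code xs) i)" for xs :: "'b list" and i
    by (simp add: nth0_def lget_def code_list_def)
  show "delta1 x s \<Longrightarrow> delta1 x t \<Longrightarrow> delta1 x (\<lambda>a. nth0 (s a :: 'b::coded list) (t a))"
    unfolding eq by (intro delta1_comp[OF delta1_decode] delta1_lget delta1_comp[OF delta1_code])
qed

lemma delta1_map_upt:
  assumes n: "delta1 x n" and g: "delta1 x (\<lambda>p. g (fst p) (snd p))"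
  shows "delta1 x (\<lambda>a. map (\<lambda>i. g a i :: 'b::coded) [0..<n a])"
proof (rule delta1_graph)
  have eq: "map (\<lambda>i. g a i) [0..<n a] = xs \<longleftrightarrow> length xs = n a \<and> (\<forall>i. i < n a \<longrightarrow> nth0 xs i = g a i)" for a xs
    by (auto simp: list_eq_iff_nth_eq)
  note g' = delta1_comp[OF g delta1_pair, simplified]
  show "sigma1 x (\<lambda>p. map (\<lambda>i. g (fst p) i :: 'b::coded) [0..<n (fst p)] = snd p)"
    unfolding eq by (rule delta1_imp_sigma1) (intro delta1_intros delta1_length delta1_nth0 delta1_comp[OF n] g')
qed

lemma delta1_take: "delta1 x n \<Longrightarrow> delta1 x t \<Longrightarrow> delta1 x (\<lambda>a. take (n a) (t a :: 'b::coded list))"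
proof -
  have eq: "take k xs = map (\<lambda>i. nth0 xs i) [0..<if k \<le> length xs then k else length xs]" for k and xs :: "'b list"
    by (rule nth_equalityI) auto
  assume nt: "delta1 x n" "delta1 x t"
  show ?thesis unfolding eq
    by (intro delta1_map_upt delta1_nth0 delta1_if delta1_intros delta1_length nt delta1_comp[OF nt(2)])
qed

lemma delta1_member: "delta1 x s \<Longrightarrow> delta1 x t \<Longrightarrow> delta1 x (\<lambda>a. (s a :: 'b::coded) \<in> set (t a))"
proof -
  assume st: "delta1 x s" "delta1 x t"
  have eq: "y \<in> set xs \<longleftrightarrow> (\<exists>i. i < length xs \<and> nth0 xs i = y)" for y :: 'b and xs
    by (auto simp: in_set_conv_nth)
  show ?thesis unfolding eq
    by (intro delta1_intros delta1_nth0 delta1_length delta1_comp[OF st(1)] delta1_comp[OF st(2)])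
qed

lemma delta1_distinct: "delta1 x t \<Longrightarrow> delta1 x (\<lambda>a. distinct (t a :: 'b::coded list))"
proof -
  assume t: "delta1 x t"
  have eq: "distinct xs \<longleftrightarrow> (\<forall>i j. i < length xs \<longrightarrow> j < i \<longrightarrow> nth0 xs i \<noteq> nth0 xs j)" for xs :: "'b list"
    unfolding distinct_conv_nth by (auto simp: nth0_def) (metis linorder_neqE_nat order.strict_trans)
  show ?thesis unfolding eq
    by (intro delta1_intros delta1_nth0 delta1_length delta1_comp[OF t])
qed

text \<open>A finite set is exhibited by a repetition-free list, and lists are coded by numbers, so
  no real quantifier arises.\<close>

lemma delta1_card:
  fixes P :: "'a::point \<Rightarrow> 'b::coded \<Rightarrow> bool"
  assumes fin: "\<And>a. finite {b. P a b}" and P: "delta1 x (\<lambda>p. P (fst p) (snd p))"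
  shows "delta1 x (\<lambda>a. card {b. P a b})"
proof (rule delta1_graph)
  have eq: "card {b. P a b} = v \<longleftrightarrow> (\<exists>xs. distinct xs \<and> length xs = v \<and> (\<forall>b. b \<in> set xs \<longleftrightarrow> P a b))" for a v
  proof -
    obtain ys where "distinct ys" "set ys = {b. P a b}" using finite_distinct_list[OF fin] by blast
    moreover have "length xs = card {b. P a b}" if "distinct xs" "\<forall>b. b \<in> set xs \<longleftrightarrow> P a b" for xs
    proof -
      have "set xs = {b. P a b}" using that(2) by blast
      then show ?thesis using distinct_card[OF that(1)] by simp
    qed
    ultimately show ?thesis by (auto simp: set_eq_iff)
  qed
  note P' = delta1_comp[OF P delta1_pair, simplified]
  show "sigma1 x (\<lambda>p. card {b. P (fst p) b} = snd p)"
    unfolding eq by (rule delta1_imp_sigma1) (intro delta1_intros delta1_distinct delta1_length delta1_member P')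
qed

section \<open>Agreement with the definitions by formulas\<close>

lemma sat_subst_ex:
  assumes "poly_fun (\<lambda>n. \<rho>)"
    and E: "\<And>f X e i t. sat f X e (E i t) \<longleftrightarrow> Y f X i (eval_term f e t)"
  shows "\<exists>q. \<forall>f X e. sat f X e q \<longleftrightarrow> sat (\<lambda>k. f (\<rho> k)) (Y f X) e p"
proof -
  obtain w where w: "w \<notin> fvars p" using ex_new_if_finite infinite_UNIV_nat finite_fvars by blast
  obtain r where r: "\<And>f e t. eval_term f e (r t) = \<rho> (eval_term f e t)"
    using assms(1) unfolding poly_fun_def by blast
  have "sat f X e (fsub r E p) \<longleftrightarrow> sat (\<lambda>k. f ((\<lambda>_. \<rho>) (e w) k)) (Y f X) e p" for f X e
    by (rule sat_fsub[where v = w]) (simp_all add: r E w)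
  then show ?thesis by blast
qed

lemma arith_E:
  assumes "arith A" obtains p where "\<And>f X e. sat f X e p \<longleftrightarrow> A f X e"
  using assms unfolding arith_def by auto

lemma poly_fun_odd: "poly_fun (\<lambda>n k. Suc (2 * k))"
  by (intro poly_fun_intros)

lemma sigma11_iff_sigma1: "sigma11 x A \<longleftrightarrow> sigma1 x (\<lambda>n. n \<in> A)"
proof
  assume "sigma11 x A"
  then obtain p where p: "\<And>n. n \<in> A \<longleftrightarrow> (\<exists>f. sat f (\<lambda>_. x) (\<lambda>_. n) p)"
    unfolding sigma11_def by blast
  obtain q where q: "\<And>f X e. sat f X e q \<longleftrightarrow> sat (\<lambda>k. f (Suc (2 * k))) X e p"
    using sat_subst_ex[OF poly_fun_odd, of Elem "\<lambda>f X. X" p] by auto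
  have "ar_closed (\<lambda>F X. sat F X (\<lambda>_. F 0) q)"
    by (rule arith_sat_const_term) (intro ar_term_intros, simp)
  from sigma1_real_ex[OF sigma1_real_arith[OF this]]
  have "sigma1_real x (\<lambda>z. \<exists>w. sat (interleave z w) (\<lambda>_. x) (\<lambda>_. interleave z w 0) q)" .
  moreover have "n \<in> A \<longleftrightarrow> (\<exists>w. sat (interleave (enc n) w) (\<lambda>_. x) (\<lambda>_. interleave (enc n) w 0) q)" for n
    unfolding p q interleave_simps enc_nat_def ..
  ultimately show "sigma1 x (\<lambda>n. n \<in> A)" unfolding sigma1_def by blast
next
  assume "sigma1 x (\<lambda>n. n \<in> A)"
  then obtain B where B: "ar_closed B" "\<And>n. n \<in> A \<longleftrightarrow> (\<exists>F. (\<forall>k. F (2 * k) = enc n k) \<and> B F (\<lambda>_. x))"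
    unfolding sigma1_def sigma1_real_def by blast
  \<comment> \<open>\<open>sigma11\<close> assigns the argument to every number variable; it is read
    from variable \<open>1\<close>, since variable \<open>0\<close> gets bound.\<close>
  have "arith (\<lambda>F X e. (\<forall>k. F (2 * k) = e 1) \<and> B F X)"
    by (intro arith_conj B(1) arith_all[where i = 0], simp, intro arith_intros ar_term_intros)
  then obtain p where p: "\<And>F X e. sat F X e p \<longleftrightarrow> (\<forall>k. F (2 * k) = e 1) \<and> B F X"
    by (rule arith_E) (rule that)
  show "sigma11 x A" unfolding sigma11_def
    by (rule exI[where x = p]) (simp add: p B(2) enc_nat_def)
qed

lemma delta11_iff_delta1: "delta11 x A \<longleftrightarrow> delta1 x (\<lambda>n. n \<in> A)"
  by (simp add: delta11_def sigma11_iff_sigma1 delta1_bool)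

lemma enc_cantor: "enc (y :: cantor) = (\<lambda>k. of_bool (y k))"
  by (simp add: enc_fun_def code_bool_def decode_nat_def)

lemma sigma11_class_iff_sigma1: "sigma11_class x C \<longleftrightarrow> sigma1 x (\<lambda>y. y \<in> C)"
proof
  assume "sigma11_class x C"
  then obtain p where p: "\<And>y. y \<in> C \<longleftrightarrow> (\<exists>f. sat f (\<lambda>i. if i = 0 then x else y) (\<lambda>_. 0) p)"
    unfolding sigma11_class_def by blast
  \<comment> \<open>Within \<open>sigma1\<close> the argument \<open>y\<close> is no set variable:
    it sits at the even places of the function, with entry \<open>1\<close> exactly at the elements
    of \<open>y\<close>. Only set variable \<open>0\<close> keeps the oracle.\<close>
  let ?Y = "\<lambda>f (X :: nat \<Rightarrow> cantor) i. if i = (0::nat) then X 0 else (\<lambda>k. f (2 * k) = (1::nat))"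
  let ?E = "\<lambda>i t. if i = 0 then Elem 0 t else Equals (Fun (Times (Succ (Succ Zero)) t)) (Succ Zero)"
  obtain q where q: "\<And>f X e. sat f X e q \<longleftrightarrow> sat (\<lambda>k. f (Suc (2 * k))) (?Y f X) e p"
  proof -
    have "\<exists>q. \<forall>f X e. sat f X e q \<longleftrightarrow> sat (\<lambda>k. f (Suc (2 * k))) (?Y f X) e p"
      by (rule sat_subst_ex[OF poly_fun_odd, where E = ?E]) (auto simp: mult_2)
    then show ?thesis using that by blast
  qed
  have "ar_closed (\<lambda>F X. sat F X (\<lambda>_. 0) q)"
    by (rule arith_sat_const_term) (intro ar_term_intros, simp)
  from sigma1_real_ex[OF sigma1_real_arith[OF this]]
  have "sigma1_real x (\<lambda>z. \<exists>w. sat (interleave z w) (\<lambda>_. x) (\<lambda>_. 0) q)" .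
  moreover have "y \<in> C \<longleftrightarrow> (\<exists>w. sat (interleave (enc y) w) (\<lambda>_. x) (\<lambda>_. 0) q)" for y
  proof -
    have "?Y (interleave (enc y) w) (\<lambda>_. x) = (\<lambda>i. if i = 0 then x else y)" for w
      by (rule ext) (simp add: enc_cantor)
    then show ?thesis unfolding p q interleave_simps by simp
  qed
  ultimately show "sigma1 x (\<lambda>y. y \<in> C)" unfolding sigma1_def by blast
next
  assume "sigma1 x (\<lambda>y. y \<in> C)"
  then obtain B where B: "ar_closed B" "\<And>y. y \<in> C \<longleftrightarrow> (\<exists>F. (\<forall>k. F (2 * k) = enc y k) \<and> B F (\<lambda>_. x))"
    unfolding sigma1_def sigma1_real_def by blast
  have h: "arith (\<lambda>F X e. B (\<lambda>k. F k) (\<lambda>_. X 0))"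
    by (rule arith_subst[OF B(1) poly_fun_arg, where E = "\<lambda>i t. Elem 0 t"]) simp
  have "arith (\<lambda>F X e. (\<forall>k. X 1 k \<and> F (2 * k) = 1 \<or> \<not> X 1 k \<and> F (2 * k) = 0) \<and> B F (\<lambda>_. X 0))"
  proof (rule arith_conj)
    show "arith (\<lambda>F X e. \<forall>k. X 1 k \<and> F (2 * k) = 1 \<or> \<not> X 1 k \<and> F (2 * k) = 0)"
    proof (rule arith_all[where i = 0])
      show "arith (\<lambda>F X e. X 1 (e 0) \<and> F (2 * e 0) = 1 \<or> \<not> X 1 (e 0) \<and> F (2 * e 0) = 0)"
        by (intro arith_disj arith_conj arith_not arith_eq arith_elem ar_term_intros)
    qed simp
    show "arith (\<lambda>F X e. B F (\<lambda>_. X 0))" using h by simp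
  qed
  then obtain p where p: "\<And>F X e. sat F X e p \<longleftrightarrow>
      (\<forall>k. X 1 k \<and> F (2 * k) = 1 \<or> \<not> X 1 k \<and> F (2 * k) = 0) \<and> B F (\<lambda>_. X 0)"
    by (rule arith_E) (rule that)
  have "F (2 * k) = enc y k \<longleftrightarrow> y k \<and> F (2 * k) = 1 \<or> \<not> y k \<and> F (2 * k) = 0" for F y k
    by (simp add: enc_cantor)
  then show "sigma11_class x C" unfolding sigma11_class_def
    by (intro exI[where x = p]) (simp add: p B(2))
qed

lemma delta11_class_iff_delta1: "delta11_class x C \<longleftrightarrow> delta1 x (\<lambda>y. y \<in> C)"
  by (simp add: delta11_class_def sigma11_class_iff_sigma1 delta1_bool)

lemma hyp_in_iff_delta1: "hyp_in f x \<longleftrightarrow> delta1 x f"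
proof
  assume "hyp_in f x"
  then have *: "delta1 x (\<lambda>m. m \<in> range (\<lambda>n. prod_encode (n, f n)))"
    by (simp add: hyp_in_def delta11_iff_delta1)
  have eq: "f n = j \<longleftrightarrow> prod_encode (n, j) \<in> range (\<lambda>n. prod_encode (n, f n))" for n j
    by auto
  show "delta1 x f"
  proof (rule delta1_graph)
    show "sigma1 x (\<lambda>p. f (fst p) = snd p)"
      unfolding eq by (rule delta1_imp_sigma1) (intro delta1_comp[OF *] delta1_prod_encode delta1_basic)
  qed
next
  assume f: "delta1 x (f :: nat \<Rightarrow> nat)"
  then have f: "delta1 x (\<lambda>n. f n)" by simp
  show "hyp_in f x" unfolding hyp_in_def delta11_iff_delta1 image_def mem_Collect_eq bex_UNIV
    by (intro delta1_intros delta1_prod_encode delta1_comp[OF f])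
qed

lemma string_code_eq_code: "string_code \<sigma> = code \<sigma>"
  by (simp add: string_code_def code_list_def code_bool_def[abs_def])

lemma delta11_strings_iff_delta1: "delta11 x (string_code ` W) \<longleftrightarrow> delta1 x (\<lambda>\<sigma>. \<sigma> \<in> W)"
proof
  assume "delta11 x (string_code ` W)"
  then have *: "delta1 x (\<lambda>n. n \<in> string_code ` W)" by (simp add: delta11_iff_delta1)
  have eq: "\<sigma> \<in> W \<longleftrightarrow> code \<sigma> \<in> string_code ` W" for \<sigma>
    by (auto simp: string_code_eq_code)
  show "delta1 x (\<lambda>\<sigma>. \<sigma> \<in> W)" unfolding eq by (intro delta1_comp[OF *] delta1_code)
next
  assume *: "delta1 x (\<lambda>\<sigma>. \<sigma> \<in> W)"
  have "delta1 x (\<lambda>n. \<exists>\<sigma>. \<sigma> \<in> W \<and> n = code \<sigma>)"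
    by (intro delta1_intros delta1_comp[OF *] delta1_comp[OF delta1_code])
  moreover have "(\<exists>\<sigma>. \<sigma> \<in> W \<and> n = code \<sigma>) \<longleftrightarrow> n \<in> string_code ` W" for n
    by (auto simp: string_code_eq_code)
  ultimately show "delta11 x (string_code ` W)" by (simp add: delta11_iff_delta1)
qed

lemma delta11_open_iff: "delta11_open x U \<longleftrightarrow> (\<exists>W. delta1 x (\<lambda>\<sigma>. \<sigma> \<in> W) \<and> U = (\<Union>\<sigma>\<in>W. cylinder \<sigma>))"
  by (simp add: delta11_open_def delta11_strings_iff_delta1)

lemma delta1_cylinder: "delta1 x s \<Longrightarrow> delta1 x t \<Longrightarrow> delta1 x (\<lambda>a. s a \<in> cylinder (t a))"
proof -
  assume st: "delta1 x s" "delta1 x t"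
  have eq: "y \<in> cylinder \<sigma> \<longleftrightarrow> map y [0..<length \<sigma>] = \<sigma>" for y \<sigma>
    unfolding cylinder_def list_eq_iff_nth_eq by simp
  show ?thesis unfolding eq
    by (intro delta1_eq delta1_map_upt delta1_length st(2) delta1_app[OF delta1_comp[OF st(1)]] delta1_basic)
qed

section \<open>Tree normal form\<close>

abbreviation init :: "(nat \<Rightarrow> 'a) \<Rightarrow> nat \<Rightarrow> 'a list" where
  "init z k \<equiv> map z [0..<k]"

text \<open>Projection of the branches of a \<open>\<Delta>\<^sup>1\<^sub>1\<close> tree of pairs.
  \<open>R\<close> need not be closed under initial segments, because it is tested at every
  length.\<close>

definition nf :: "cantor \<Rightarrow> ((nat \<Rightarrow> nat) \<Rightarrow> bool) \<Rightarrow> bool" where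
  "nf x A \<longleftrightarrow> (\<exists>R. delta1 x (\<lambda>p. R (fst p) (snd p)) \<and> (\<forall>z. A z \<longleftrightarrow> (\<exists>f. \<forall>k. R (init z k) (init f k :: nat list))))"

lemma nfI:
  assumes "delta1 x (\<lambda>p. R (fst p) (snd p))"
    and "\<And>z f. (\<And>k. R (init z k) (init f k :: nat list)) \<Longrightarrow> A z"
    and "\<And>z. A z \<Longrightarrow> \<exists>f. \<forall>k. R (init z k) (init f k)"
  shows "nf x A"
  unfolding nf_def using assms by blast

text \<open>Entry \<open>0\<close> of the witness is the stage from which the padded approximations have the right truth value.\<close>

lemma nf_clopen:
  assumes A: "delta1 x A" and cont: "\<And>z. \<exists>j. \<forall>k\<ge>j. A (nth0 (init z k)) = A z"
  shows "nf x A"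
proof (rule nfI)
  show "delta1 x (\<lambda>p. length (snd p) = 0 \<or> length (fst p) < nth0 (snd p) 0 \<or> A (nth0 (fst p)))"
    by (intro delta1_intros delta1_length delta1_nth0 delta1_comp[OF A] delta1_lambda)
next
  fix z f assume *: "\<And>k. length (init f k) = 0 \<or> length (init z k) < nth0 (init f k) 0 \<or> A (nth0 (init z k))"
  obtain j where "\<And>k. k \<ge> j \<Longrightarrow> A (nth0 (init z k)) = A z" using cont by blast
  then show "A z" using *[of "Suc (max j (f 0))"] by (auto simp: nth0_def simp del: upt_Suc)
next
  fix z assume z: "A z"
  obtain j where j: "\<And>k. k \<ge> j \<Longrightarrow> A (nth0 (init z k)) = A z" using cont by blast
  show "\<exists>f. \<forall>k. length (init f k) = 0 \<or> length (init z k) < nth0 (init f k) 0 \<or> A (nth0 (init z k))"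
  proof (intro exI allI)
    fix k
    show "length (init (\<lambda>_. j) k) = 0 \<or> length (init z k) < nth0 (init (\<lambda>_. j) k) 0 \<or> A (nth0 (init z k))"
      using j[of k] z by (cases "k = 0"; cases "k < j") auto
  qed
qed

lemma nfE:
  assumes "nf x A"
  obtains R where "delta1 x (\<lambda>p. R (fst p) (snd p))" "\<And>z. A z \<longleftrightarrow> (\<exists>f. \<forall>k. R (init z k) (init f k :: nat list))"
  using assms unfolding nf_def by blast

lemma take_init: "take m (init z k) = init z (min m k)"
  by (rule nth_equalityI) auto

text \<open>The even and odd entries of one witness are the two witnesses. A prefix of length
  \<open>k\<close> shows each only up to about half of \<open>k\<close>, so the tests are made at
  all lengths that are already visible.\<close>

lemma nf_conj:
  assumes "nf x A" "nf x B" shows "nf x (\<lambda>z. A z \<and> B z)"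
proof -
  obtain R where R: "delta1 x (\<lambda>p. R (fst p) (snd p))" "\<And>z. A z \<longleftrightarrow> (\<exists>f. \<forall>k. R (init z k) (init f k :: nat list))"
    using nfE[OF assms(1)] by blast
  obtain S where S: "delta1 x (\<lambda>p. S (fst p) (snd p))" "\<And>z. B z \<longleftrightarrow> (\<exists>f. \<forall>k. S (init z k) (init f k :: nat list))"
    using nfE[OF assms(2)] by blast
  note R' = delta1_comp[OF R(1) delta1_pair, simplified] and S' = delta1_comp[OF S(1) delta1_pair, simplified]
  let ?R = "\<lambda>u w. \<forall>m. 2 * m \<le> length w \<longrightarrow>
       R (take m u) (map (\<lambda>i. nth0 w (2 * i)) [0..<m]) \<and> S (take m u) (map (\<lambda>i. nth0 w (Suc (2 * i))) [0..<m])"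
  have eq: "?R (init z k) (init f k) \<longleftrightarrow> (\<forall>m. 2 * m \<le> k \<longrightarrow> R (init z m) (init (\<lambda>i. f (2 * i)) m) \<and>
      S (init z m) (init (\<lambda>i. f (Suc (2 * i))) m))" for z f k
  proof -
    have E: "take m (init z k) = init z m" "init (\<lambda>i. nth0 (init f k) (2 * i)) m = init (\<lambda>i. f (2 * i)) m"
       "init (\<lambda>i. nth0 (init f k) (Suc (2 * i))) m = init (\<lambda>i. f (Suc (2 * i))) m" if "2 * m \<le> k" for m
      using that by (auto simp: take_init)
    show ?thesis unfolding length_map length_upt diff_zero
      by (intro iff_allI imp_cong refl) (simp only: E)
  qed
  show ?thesis
  proof (rule nfI)
    show "delta1 x (\<lambda>p. ?R (fst p) (snd p))"
      by (intro delta1_intros delta1_length delta1_nth0 delta1_map_upt delta1_take R' S')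
  next
    fix z and f :: "nat \<Rightarrow> nat" assume *: "\<And>k. ?R (init z k) (init f k)"
    have "R (init z k) (init (\<lambda>i. f (2 * i)) k)" "S (init z k) (init (\<lambda>i. f (Suc (2 * i))) k)" for k
      using *[of "2 * k", unfolded eq] by blast+
    then show "A z \<and> B z" unfolding R(2) S(2) by blast
  next
    fix z assume "A z \<and> B z"
    then obtain f g where "\<And>k. R (init z k) (init f k :: nat list)" "\<And>k. S (init z k) (init g k :: nat list)"
      unfolding R(2) S(2) by blast
    then show "\<exists>f. \<forall>k. ?R (init z k) (init f k)"
      by (intro exI[where x = "interleave f g"], unfold eq) simp
  qed
qed

text \<open>Entry \<open>0\<close> of the witness selects the disjunct; the remaining entries are
  the witness for it, delayed by one place.\<close>

lemma nf_disj:
  assumes "nf x A" "nf x B" shows "nf x (\<lambda>z. A z \<or> B z)"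
proof -
  obtain R where R: "delta1 x (\<lambda>p. R (fst p) (snd p))" "\<And>z. A z \<longleftrightarrow> (\<exists>f. \<forall>k. R (init z k) (init f k :: nat list))"
    using nfE[OF assms(1)] by blast
  obtain S where S: "delta1 x (\<lambda>p. S (fst p) (snd p))" "\<And>z. B z \<longleftrightarrow> (\<exists>f. \<forall>k. S (init z k) (init f k :: nat list))"
    using nfE[OF assms(2)] by blast
  note R' = delta1_comp[OF R(1) delta1_pair, simplified] and S' = delta1_comp[OF S(1) delta1_pair, simplified]
  let ?R = "\<lambda>u w. \<forall>m. m < length w \<longrightarrow>
       (nth0 w 0 = 0 \<longrightarrow> R (take m u) (map (\<lambda>i. nth0 w (Suc i)) [0..<m])) \<and>
       (nth0 w 0 \<noteq> 0 \<longrightarrow> S (take m u) (map (\<lambda>i. nth0 w (Suc i)) [0..<m]))"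
  have eq: "?R (init z k) (init f k) \<longleftrightarrow> (\<forall>m. m < k \<longrightarrow> (f 0 = 0 \<longrightarrow> R (init z m) (init (\<lambda>i. f (Suc i)) m)) \<and>
      (f 0 \<noteq> 0 \<longrightarrow> S (init z m) (init (\<lambda>i. f (Suc i)) m)))" for z f k
  proof -
    have E: "take m (init z k) = init z m" "init (\<lambda>i. nth0 (init f k) (Suc i)) m = init (\<lambda>i. f (Suc i)) m"
       "nth0 (init f k) 0 = f 0" if "m < k" for m
      using that by (auto simp: take_init)
    show ?thesis unfolding length_map length_upt diff_zero
      by (intro iff_allI imp_cong refl) (simp only: E)
  qed
  show ?thesis
  proof (rule nfI)
    show "delta1 x (\<lambda>p. ?R (fst p) (snd p))"
      by (intro delta1_intros delta1_length delta1_nth0 delta1_map_upt delta1_take R' S')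
  next
    fix z and f :: "nat \<Rightarrow> nat" assume *: "\<And>k. ?R (init z k) (init f k)"
    have "f 0 = 0 \<longrightarrow> R (init z k) (init (\<lambda>i. f (Suc i)) k)" "f 0 \<noteq> 0 \<longrightarrow> S (init z k) (init (\<lambda>i. f (Suc i)) k)" for k
      using *[of "Suc k", unfolded eq] by blast+
    then show "A z \<or> B z" unfolding R(2) S(2) by blast
  next
    fix z assume "A z \<or> B z"
    then show "\<exists>f. \<forall>k. ?R (init z k) (init f k)"
    proof
      assume "A z"
      then obtain f where "\<And>k. R (init z k) (init f k :: nat list)" unfolding R(2) by blast
      then show ?thesis
        by (intro exI[where x = "case_nat 0 f"], unfold eq) simp
    next
      assume "B z"
      then obtain f where "\<And>k. S (init z k) (init f k :: nat list)" unfolding S(2) by blast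
      then show ?thesis
        by (intro exI[where x = "case_nat 1 f"], unfold eq) simp
    qed
  qed
qed

text \<open>Entry \<open>0\<close> of the witness is the number to be placed at
  \<open>i\<close>.\<close>

lemma nf_ex:
  assumes "nf x A" shows "nf x (\<lambda>z. \<exists>n. A (z(i := n)))"
proof -
  obtain R where R: "delta1 x (\<lambda>p. R (fst p) (snd p))" "\<And>z. A z \<longleftrightarrow> (\<exists>f. \<forall>k. R (init z k) (init f k :: nat list))"
    using nfE[OF assms(1)] by blast
  note R' = delta1_comp[OF R(1) delta1_pair, simplified]
  let ?R = "\<lambda>u w. \<forall>m. m < length w \<longrightarrow>
       R (map (\<lambda>k. if k = i then nth0 w 0 else nth0 u k) [0..<m]) (map (\<lambda>i. nth0 w (Suc i)) [0..<m])"
  have eq: "?R (init z k) (init f k) \<longleftrightarrow> (\<forall>m. m < k \<longrightarrow> R (init (z(i := f 0)) m) (init (\<lambda>i. f (Suc i)) m))" for z f k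
  proof -
    have E: "init (\<lambda>j. if j = i then nth0 (init f k) 0 else nth0 (init z k) j) m = init (z(i := f 0)) m"
      "init (\<lambda>i. nth0 (init f k) (Suc i)) m = init (\<lambda>i. f (Suc i)) m" if "m < k" for m
      using that by auto
    show ?thesis unfolding length_map length_upt diff_zero
      by (intro iff_allI imp_cong refl) (simp only: E)
  qed
  show ?thesis
  proof (rule nfI)
    show "delta1 x (\<lambda>p. ?R (fst p) (snd p))"
      by (intro delta1_intros delta1_length delta1_nth0 delta1_map_upt delta1_if R')
  next
    fix z and f :: "nat \<Rightarrow> nat" assume *: "\<And>k. ?R (init z k) (init f k)"
    have "R (init (z(i := f 0)) k) (init (\<lambda>i. f (Suc i)) k)" for k
      using *[of "Suc k", unfolded eq] by blast
    then show "\<exists>n. A (z(i := n))" unfolding R(2) by blast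
  next
    fix z assume "\<exists>n. A (z(i := n))"
    then obtain n f where "\<And>k. R (init (z(i := n)) k) (init f k :: nat list)" unfolding R(2) by blast
    then show "\<exists>f. \<forall>k. ?R (init z k) (init f k)"
      by (intro exI[where x = "case_nat n f"], unfold eq) simp
  qed
qed

text \<open>The witness consists of one column for each \<open>n\<close>, addressed by
  \<open>prod_encode\<close>; a test of column \<open>n\<close> waits until its entries lie inside
  the visible prefix.\<close>

lemma nf_all:
  assumes "nf x A" shows "nf x (\<lambda>z. \<forall>n. A (z(i := n)))"
proof -
  obtain R where R: "delta1 x (\<lambda>p. R (fst p) (snd p))" "\<And>z. A z \<longleftrightarrow> (\<exists>f. \<forall>k. R (init z k) (init f k :: nat list))"
    using nfE[OF assms(1)] by blast
  note R' = delta1_comp[OF R(1) delta1_pair, simplified]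
  let ?R = "\<lambda>u w. \<forall>n m. m \<le> length u \<longrightarrow> (\<forall>k. k < m \<longrightarrow> prod_encode (n, k) < length w) \<longrightarrow>
       R (map (\<lambda>k. if k = i then n else nth0 u k) [0..<m]) (map (\<lambda>k. nth0 w (prod_encode (n, k))) [0..<m])"
  have eq: "?R (init z k) (init f k) \<longleftrightarrow> (\<forall>n m. m \<le> k \<longrightarrow> (\<forall>j. j < m \<longrightarrow> prod_encode (n, j) < k) \<longrightarrow>
      R (init (z(i := n)) m) (init (\<lambda>j. f (prod_encode (n, j))) m))" for z f k
  proof -
    have E: "init (\<lambda>j. if j = i then n else nth0 (init z k) j) m = init (z(i := n)) m"
      "init (\<lambda>j. nth0 (init f k) (prod_encode (n, j))) m = init (\<lambda>j. f (prod_encode (n, j))) m"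
      if "m \<le> k" "\<forall>j. j < m \<longrightarrow> prod_encode (n, j) < k" for m n
      using that by auto
    show ?thesis unfolding length_map length_upt diff_zero
      by (intro iff_allI imp_cong refl) (simp only: E)
  qed
  show ?thesis
  proof (rule nfI)
    show "delta1 x (\<lambda>p. ?R (fst p) (snd p))"
      by (intro delta1_intros delta1_length delta1_nth0 delta1_map_upt delta1_if delta1_prod_encode R')
  next
    fix z and f :: "nat \<Rightarrow> nat" assume *: "\<And>k. ?R (init z k) (init f k)"
    have "R (init (z(i := n)) k) (init (\<lambda>j. f (prod_encode (n, j))) k)" for n k
    proof -
      obtain N where "\<forall>j \<in> (\<lambda>j. prod_encode (n, j)) ` {..<k} \<union> {k}. j < N"
        using finite_nat_set_iff_bounded[of "(\<lambda>j. prod_encode (n, j)) ` {..<k} \<union> {k}"] by auto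
      then show ?thesis using *[of N, unfolded eq] by (auto simp: less_imp_le)
    qed
    then show "\<forall>n. A (z(i := n))" unfolding R(2) by blast
  next
    fix z assume "\<forall>n. A (z(i := n))"
    then have "\<forall>n. \<exists>f. \<forall>k. R (init (z(i := n)) k) (init f k :: nat list)" unfolding R(2) .
    from choice[OF this] obtain f where "\<And>n k. R (init (z(i := n)) k) (init (f n) k :: nat list)" by blast
    then show "\<exists>f. \<forall>k. ?R (init z k) (init f k)"
      by (intro exI[where x = "\<lambda>m. f (fst (prod_decode m)) (snd (prod_decode m))"], unfold eq) simp
  qed
qed

text \<open>One real \<open>z\<close> carries both sorts of variables: number variable
  \<open>i\<close> is \<open>z i\<close>, and the function variable starts at place
  \<open>v\<close>.\<close>

lemma delta1_eval_term: "delta1 x (\<lambda>z. eval_term (\<lambda>i. z (v + i)) z t)"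
proof (induction t)
  case (Var i)
  then show ?case by (simp, intro delta1_app_id delta1_intros)
next
  case (Fun t)
  then show ?case by (simp, intro delta1_app_id delta1_intros)
qed (simp_all, (intro delta1_intros | assumption)+)

lemma eval_term_continuous:
  "\<forall>\<^sub>F k in sequentially. eval_term (\<lambda>i. nth0 (init z k) (v + i)) (nth0 (init z k)) t = eval_term (\<lambda>i. z (v + i)) z t"
proof (induction t)
  case (Var i)
  show ?case using eventually_gt_at_top[of i] by eventually_elim simp
next
  case (Plus s t)
  then show ?case by eventually_elim simp
next
  case (Times s t)
  then show ?case by eventually_elim simp
next
  case (Fun t)
  show ?case using Fun.IH eventually_gt_at_top[of "v + eval_term (\<lambda>i. z (v + i)) z t"]
    by eventually_elim simp
qed simp_all

text \<open>Normal forms are not closed under complement, so the formula and its negation are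
  carried through the induction together. The bound \<open>v\<close> keeps quantified number
  variables clear of the part of \<open>z\<close> that holds the function.\<close>

lemma nf_sat:
  assumes "fvars p \<subseteq> {..<v}"
  shows "nf x (\<lambda>z. sat (\<lambda>i. z (v + i)) (\<lambda>_. x) z p) \<and> nf x (\<lambda>z. \<not> sat (\<lambda>i. z (v + i)) (\<lambda>_. x) z p)"
  using assms
proof (induction p)
  case (Equals s t)
  have d: "delta1 x (\<lambda>z. eval_term (\<lambda>i. z (v + i)) z s = eval_term (\<lambda>i. z (v + i)) z t)"
    by (intro delta1_eq delta1_eval_term)
  have c: "\<exists>j. \<forall>k\<ge>j. (eval_term (\<lambda>i. nth0 (init z k) (v + i)) (nth0 (init z k)) s = eval_term (\<lambda>i. nth0 (init z k) (v + i)) (nth0 (init z k)) t) =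
     (eval_term (\<lambda>i. z (v + i)) z s = eval_term (\<lambda>i. z (v + i)) z t)" for z
    unfolding eventually_sequentially[symmetric]
    using eval_term_continuous[of z v s] eval_term_continuous[of z v t] by eventually_elim simp
  show ?case unfolding sat.simps
  proof
    show "nf x (\<lambda>z. eval_term (\<lambda>i. z (v + i)) z s = eval_term (\<lambda>i. z (v + i)) z t)"
      by (rule nf_clopen[OF d c])
    show "nf x (\<lambda>z. eval_term (\<lambda>i. z (v + i)) z s \<noteq> eval_term (\<lambda>i. z (v + i)) z t)"
      by (rule nf_clopen[OF delta1_not[OF d]]) (use c in simp)
  qed
next
  case (Elem i t)
  have d: "delta1 x (\<lambda>z. x (eval_term (\<lambda>i. z (v + i)) z t))"
    by (intro delta1_comp[OF delta1_oracle] delta1_eval_term)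
  have c: "\<exists>j. \<forall>k\<ge>j. x (eval_term (\<lambda>i. nth0 (init z k) (v + i)) (nth0 (init z k)) t) =
     x (eval_term (\<lambda>i. z (v + i)) z t)" for z
    unfolding eventually_sequentially[symmetric]
    using eval_term_continuous[of z v t] by eventually_elim simp
  show ?case unfolding sat.simps
  proof
    show "nf x (\<lambda>z. x (eval_term (\<lambda>i. z (v + i)) z t))"
      by (rule nf_clopen[OF d c])
    show "nf x (\<lambda>z. \<not> x (eval_term (\<lambda>i. z (v + i)) z t))"
      by (rule nf_clopen[OF delta1_not[OF d]]) (use c in simp)
  qed
next
  case (Neg p)
  then show ?case by simp
next
  case (Conj p q)
  then have "nf x (\<lambda>z. sat (\<lambda>i. z (v + i)) (\<lambda>_. x) z p)" "nf x (\<lambda>z. \<not> sat (\<lambda>i. z (v + i)) (\<lambda>_. x) z p)"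
    "nf x (\<lambda>z. sat (\<lambda>i. z (v + i)) (\<lambda>_. x) z q)" "nf x (\<lambda>z. \<not> sat (\<lambda>i. z (v + i)) (\<lambda>_. x) z q)" by auto
  then show ?case unfolding sat.simps de_Morgan_conj by (intro conjI nf_conj nf_disj)
next
  case (Forall i p)
  then have IH: "nf x (\<lambda>z. sat (\<lambda>i. z (v + i)) (\<lambda>_. x) z p)" "nf x (\<lambda>z. \<not> sat (\<lambda>i. z (v + i)) (\<lambda>_. x) z p)"
    and i: "i < v" by auto
  have "(\<lambda>j. (z(i := n)) (v + j)) = (\<lambda>j. z (v + j))" for z :: "nat \<Rightarrow> nat" and n using i by auto
  then show ?case using nf_all[OF IH(1), of i] nf_ex[OF IH(2), of i] by simp
qed

section \<open>Selection of a generating set of strings\<close>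

theorem sigma1_normal_form:
  fixes P :: "nat \<Rightarrow> bool"
  assumes "sigma1 x P"
  obtains R where "delta1 x (\<lambda>p. R (fst p) (snd p))" "\<And>n. P n \<longleftrightarrow> (\<exists>h. \<forall>k. R n (init h k :: nat list))"
proof -
  obtain B where B: "ar_closed B" "\<And>n. P n \<longleftrightarrow> (\<exists>F. (\<forall>k. F (2 * k) = enc n k) \<and> B F (\<lambda>_. x))"
    using assms unfolding sigma1_def sigma1_real_def by blast
  obtain p where p: "\<And>F X e. B F X = sat F X e p" using B(1) unfolding arith_def by blast
  obtain v where v: "fvars p \<subseteq> {..<v}" using finite_nat_bounded[OF finite_fvars] by blast
  obtain S where S: "delta1 x (\<lambda>p. S (fst p) (snd p))"
    "\<And>z. sat (\<lambda>i. z (v + i)) (\<lambda>_. x) z p \<longleftrightarrow> (\<exists>f. \<forall>k. S (init z k) (init f k :: nat list))"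
    using nfE[OF conjunct1[OF nf_sat[OF v]]] by blast
  note S' = delta1_comp[OF S(1) delta1_pair, simplified]
  \<comment> \<open>One branch packs the layout real \<open>z\<close> and its witness. The even
    entries of the function, at the places \<open>v + 2 * j\<close> of \<open>z\<close>, must equal
    the argument \<open>n\<close>.\<close>
  define R where "R n s \<longleftrightarrow> S (map (\<lambda>i. fst (prod_decode (nth0 s i))) [0..<length s])
       (map (\<lambda>i. snd (prod_decode (nth0 s i))) [0..<length s]) \<and>
     (\<forall>i. i < length s \<longrightarrow> (\<forall>j. i = v + 2 * j \<longrightarrow> fst (prod_decode (nth0 s i)) = n))" for n :: nat and s
  have R: "delta1 x (\<lambda>p. R (fst p) (snd p))"
    unfolding R_def by (intro delta1_intros S' delta1_map_upt delta1_nth0 delta1_length delta1_fst_prod_decode delta1_snd_prod_decode)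
  have R_init: "R n (init h k) \<longleftrightarrow> S (init (\<lambda>i. fst (prod_decode (h i))) k) (init (\<lambda>i. snd (prod_decode (h i))) k) \<and>
     (\<forall>i<k. \<forall>j. i = v + 2 * j \<longrightarrow> fst (prod_decode (h i)) = n)" for n h k
  proof -
    have E: "init (\<lambda>i. fst (prod_decode (nth0 (init h k) i))) k = init (\<lambda>i. fst (prod_decode (h i))) k"
      "init (\<lambda>i. snd (prod_decode (nth0 (init h k) i))) k = init (\<lambda>i. snd (prod_decode (h i))) k" by auto
    show ?thesis unfolding R_def length_map length_upt diff_zero E by auto
  qed
  have "P n \<longleftrightarrow> (\<exists>h. \<forall>k. R n (init h k :: nat list))" for n
  proof
    assume "P n"
    then obtain F where F: "\<And>k. F (2 * k) = n" "\<And>e. sat F (\<lambda>_. x) e p"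
      unfolding B p by (auto simp: enc_nat_def p[symmetric])
    \<comment> \<open>The number variables may be set to anything, here \<open>0\<close>, because
      \<open>B\<close> does not depend on them.\<close>
    define z where "z i = (if i < v then 0 else F (i - v))" for i
    have "(\<lambda>i. z (v + i)) = F" by (rule ext) (simp add: z_def)
    then have "sat (\<lambda>i. z (v + i)) (\<lambda>_. x) z p" using F(2) by simp
    then obtain f where f: "\<And>k. S (init z k) (init f k :: nat list)" unfolding S(2) by blast
    have zv: "z (v + 2 * j) = n" for j by (simp add: z_def F(1))
    have "R n (init (\<lambda>i. prod_encode (z i, f i)) k)" for k
      unfolding R_init prod_encode_inverse fst_conv snd_conv using f zv by auto
    then show "\<exists>h. \<forall>k. R n (init h k :: nat list)" by blast
  next
    assume "\<exists>h. \<forall>k. R n (init h k :: nat list)"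
    then obtain h where h: "\<And>k. R n (init h k)" by blast
    define z where "z i = fst (prod_decode (h i))" for i
    have "\<exists>f. \<forall>k. S (init z k) (init f k :: nat list)"
      using h unfolding R_init z_def by blast
    then have "sat (\<lambda>i. z (v + i)) (\<lambda>_. x) z p" unfolding S(2) .
    moreover have "z (v + 2 * k) = n" for k
      using conjunct2[OF h[of "Suc (v + 2 * k)", unfolded R_init], rule_format, of "v + 2 * k" k]
      by (simp add: z_def)
    ultimately show "P n" unfolding B enc_nat_def
      by (intro exI[where x = "\<lambda>i. z (v + i)"]) (simp add: p[of _ _ z])
  qed
  with R show ?thesis using that by blast
qed

text \<open>Between well-founded trees this says that the rank of \<open>s\<close> is at most the
  rank of \<open>t\<close>; a node \<open>t\<close> with an infinite path simulates everything. The
  explicit \<open>Z\<close> keeps the relation \<open>\<Sigma>\<^sup>1\<^sub>1\<close> for coded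
  nodes.\<close>

definition simul :: "('a \<Rightarrow> 'a \<Rightarrow> bool) \<Rightarrow> ('b \<Rightarrow> 'b \<Rightarrow> bool) \<Rightarrow> 'a \<Rightarrow> 'b \<Rightarrow> bool" where
  "simul E E' s t \<longleftrightarrow> (\<exists>Z. Z s t \<and> (\<forall>s t s'. Z s t \<longrightarrow> E s s' \<longrightarrow> (\<exists>t'. E' t t' \<and> Z s' t')))"

definition inf_path :: "('a \<Rightarrow> 'a \<Rightarrow> bool) \<Rightarrow> 'a \<Rightarrow> bool" where
  "inf_path E s \<longleftrightarrow> (\<exists>p. p 0 = s \<and> (\<forall>k::nat. E (p k) (p (Suc k))))"

lemma simul_step: "simul E E' s t \<Longrightarrow> E s s' \<Longrightarrow> \<exists>t'. E' t t' \<and> simul E E' s' t'"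
  unfolding simul_def by blast

lemma simulI:
  assumes "\<And>s'. E s s' \<Longrightarrow> \<exists>t'. E' t t' \<and> simul E E' s' t'" shows "simul E E' s t"
  unfolding simul_def
proof (rule exI[where x = "\<lambda>a b. simul E E' a b \<or> a = s \<and> b = t"], intro conjI allI impI)
  fix a b a' assume Z: "simul E E' a b \<or> a = s \<and> b = t" and E: "E a a'"
  have "\<exists>t'. E' b t' \<and> simul E E' a' t'"
    using Z simul_step[of E E' a b a'] assms[of a'] E by auto
  then show "\<exists>t'. E' b t' \<and> (simul E E' a' t' \<or> a' = s \<and> t' = t)" by auto
qed simp

lemma simul_trans: "simul E E' s t \<Longrightarrow> simul E' E'' t u \<Longrightarrow> simul E E'' s u"
  unfolding simul_def[of E E'' s u]
proof (rule exI[where x = "\<lambda>a c. \<exists>b. simul E E' a b \<and> simul E' E'' b c"], intro conjI allI impI)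
  fix a c a' assume "\<exists>b. simul E E' a b \<and> simul E' E'' b c" and E: "E a a'"
  then obtain b where b: "simul E E' a b" "simul E' E'' b c" by auto
  obtain b' where b': "E' b b'" "simul E E' a' b'" using simul_step[OF b(1) E] by auto
  obtain c' where c': "E'' c c'" "simul E' E'' b' c'" using simul_step[OF b(2) b'(1)] by auto
  show "\<exists>c'. E'' c c' \<and> (\<exists>b. simul E E' a' b \<and> simul E' E'' b c')" using b' c' by auto
qed auto

lemma pathI:
  assumes s: "Q s" and step: "\<And>t. Q t \<Longrightarrow> \<exists>t'. E t t' \<and> Q t'" shows "inf_path E s"
proof -
  have "\<forall>t. \<exists>t'. Q t \<longrightarrow> E t t' \<and> Q t'" using step by auto
  from choice[OF this] obtain g where g: "\<And>t. Q t \<Longrightarrow> E t (g t) \<and> Q (g t)" by auto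
  have Q: "Q ((g ^^ k) s)" for k by (induction k) (simp_all add: s g)
  show ?thesis unfolding inf_path_def
    by (rule exI[where x = "\<lambda>k. (g ^^ k) s"]) (simp add: g Q)
qed

lemma path_step: assumes "inf_path E s" shows "\<exists>s'. E s s' \<and> inf_path E s'"
proof -
  obtain p where p: "p 0 = s" "\<And>k. E (p k) (p (Suc k))" using assms unfolding inf_path_def by auto
  have "inf_path E (p (Suc 0))" unfolding inf_path_def
    by (rule exI[where x = "\<lambda>k. p (Suc k)"]) (simp add: p(2))
  then show ?thesis using p(1) p(2)[of 0] by auto
qed

lemma path_Cons: assumes "E s s'" "inf_path E s'" shows "inf_path E s"
proof (rule pathI[where Q = "\<lambda>a. a = s \<or> inf_path E a"])
  show "\<exists>t'. E t t' \<and> (t' = s \<or> inf_path E t')" if "t = s \<or> inf_path E t" for t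
    using that assms path_step[of E t] by auto
qed simp

lemma path_imp_simul: assumes "inf_path E' t" shows "simul E E' s t"
  unfolding simul_def
proof (rule exI[where x = "\<lambda>a b. inf_path E' b"], intro conjI allI impI)
  show "\<exists>t'. E' t t' \<and> inf_path E' t'" if "inf_path E' t" for t using that by (rule path_step)
qed (rule assms)

lemma simul_path: assumes "simul E E' s t" "inf_path E s" shows "inf_path E' t"
proof (rule pathI[where Q = "\<lambda>b. \<exists>a. simul E E' a b \<and> inf_path E a"])
  fix b assume "\<exists>a. simul E E' a b \<and> inf_path E a"
  then obtain a a' where a: "simul E E' a b" "E a a'" "inf_path E a'" using path_step by fastforce
  show "\<exists>b'. E' b b' \<and> (\<exists>a. simul E E' a b' \<and> inf_path E a)" using simul_step[OF a(1,2)] a(3) by auto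
qed (use assms in auto)

text \<open>By dependent choice, the absence of an infinite path is well-foundedness.\<close>

lemma no_path_induct:
  assumes "\<not> inf_path E s" "\<And>s. (\<And>s'. E s s' \<Longrightarrow> Q s') \<Longrightarrow> Q s" shows "Q s"
proof (rule ccontr)
  assume "\<not> Q s"
  then have "inf_path E s" by (rule pathI[where Q = "\<lambda>s. \<not> Q s"]) (use assms(2) in blast)
  with assms(1) show False ..
qed

text \<open>Induction on the tree of \<open>t\<close>, which has no infinite path, as it would
  otherwise simulate \<open>s\<close>. Some child \<open>s'\<close> of \<open>s\<close> is simulated
  by no child of \<open>t\<close>; by induction each child of \<open>t\<close> is simulated by a
  child of \<open>s'\<close>, hence \<open>t\<close> by \<open>s'\<close>.\<close>

lemma not_simul: assumes "\<not> simul E E' s t" shows "\<exists>s'. E s s' \<and> simul E' E t s'"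
proof -
  have "\<not> inf_path E' t" using assms path_imp_simul[of E' t E s] by auto
  then have "\<forall>s. \<not> simul E E' s t \<longrightarrow> (\<exists>s'. E s s' \<and> simul E' E t s')"
  proof (rule no_path_induct, intro allI impI)
    fix t s
    assume IH: "\<And>t'. E' t t' \<Longrightarrow> \<forall>s. \<not> simul E E' s t' \<longrightarrow> (\<exists>s'. E s s' \<and> simul E' E t' s')"
      and "\<not> simul E E' s t"
    then obtain s' where s': "E s s'" "\<And>t'. E' t t' \<Longrightarrow> \<not> simul E E' s' t'" using simulI[of E s E' t] by blast
    have "simul E' E t s'" by (rule simulI) (use IH s'(2) in blast)
    then show "\<exists>s'. E s s' \<and> simul E' E t s'" using s'(1) by blast
  qed
  then show ?thesis using assms by blast
qed

text \<open>Otherwise \<open>t\<close> would be simulated by one of its own children. Repeating this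
  step descends forever and yields an infinite path from \<open>t\<close>.\<close>

lemma not_simul_child:
  assumes "\<not> inf_path E' t" "simul E E' s t" "E s s'" shows "\<not> simul E' E t s'"
proof
  assume "simul E' E t s'"
  obtain t' where t': "E' t t'" "simul E E' s' t'" using simul_step[OF assms(2,3)] by blast
  have "simul E' E' t t'" by (rule simul_trans[OF \<open>simul E' E t s'\<close> t'(2)])
  have "inf_path E' t"
  proof (rule pathI[where Q = "\<lambda>a. \<exists>b. E' a b \<and> simul E' E' a b"])
    show "\<exists>b. E' t b \<and> simul E' E' t b" using t'(1) \<open>simul E' E' t t'\<close> by auto
    fix a assume "\<exists>b. E' a b \<and> simul E' E' a b"
    then obtain b where b: "E' a b" "simul E' E' a b" by auto
    show "\<exists>c. E' a c \<and> (\<exists>b. E' c b \<and> simul E' E' c b)"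
      using simul_step[OF b(2,1)] b(1) by auto
  qed
  with assms(1) show False ..
qed

text \<open>The condition \<open>R\<close> is imposed on the source of a step, so a node violating
  \<open>R\<close> is a leaf and an infinite path has \<open>R\<close> at every length.\<close>

definition ext_step :: "('a \<Rightarrow> nat list \<Rightarrow> bool) \<Rightarrow> 'a \<Rightarrow> nat list \<Rightarrow> nat list \<Rightarrow> bool" where
  "ext_step R a s s' \<longleftrightarrow> R a s \<and> take (length s) s' = s \<and> length s' = Suc (length s)"

lemma path_ext: "inf_path (ext_step R a) [] \<longleftrightarrow> (\<exists>h. \<forall>k. R a (init h k))"
proof
  assume "inf_path (ext_step R a) []"
  then obtain p where p: "p 0 = []" "\<And>k. ext_step R a (p k) (p (Suc k))" unfolding inf_path_def by auto
  define h where "h k = p (Suc k) ! k" for k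
  have "p k = init h k" for k
  proof (induction k)
    case (Suc k)
    have "take k (p (Suc k)) = init h k" "length (p (Suc k)) = Suc k"
      using p(2)[of k] Suc by (auto simp: ext_step_def)
    then have "p (Suc k) = init h k @ [p (Suc k) ! k]"
      by (metis lessI take_Suc_conv_app_nth take_all_iff order_refl)
    then have "p (Suc k) = init h k @ [h k]" by (simp only: h_def[of k])
    then show ?case by simp
  qed (simp add: p)
  then show "\<exists>h. \<forall>k. R a (init h k)" using p(2) unfolding ext_step_def by metis
next
  assume "\<exists>h. \<forall>k. R a (init h k)"
  then obtain h where h: "\<And>k. R a (init h k)" by blast
  show "inf_path (ext_step R a) []" unfolding inf_path_def
    by (rule exI[where x = "init h"]) (use h in \<open>auto simp: ext_step_def\<close>)
qed

text \<open>A relation between nodes becomes a set of pair codes, so the existence of a simulation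
  is a single quantifier over \<open>cantor\<close> in front of a
  \<open>\<Delta>\<^sup>1\<^sub>1\<close> condition.\<close>

lemma sigma1_simul:
  assumes R: "delta1 x (\<lambda>p. R (fst p) (snd p))"
    and a: "delta1 x a" "delta1 x b" "delta1 x s" "delta1 x t"
  shows "sigma1 x (\<lambda>c. simul (ext_step R (a c :: 'a::coded)) (ext_step R (b c)) (s c) (t c))"
proof -
  let ?e = "\<lambda>s t :: nat list. prod_encode (code s, code t)"
  have eq: "simul E E' s t \<longleftrightarrow> (\<exists>Z :: cantor. Z (?e s t) \<and>
     (\<forall>s t s'. Z (?e s t) \<longrightarrow> E s s' \<longrightarrow> (\<exists>t'. E' t t' \<and> Z (?e s' t'))))" for E E' s t
  proof
    assume "simul E E' s t"
    then show "\<exists>Z :: cantor. Z (?e s t) \<and>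
     (\<forall>s t s'. Z (?e s t) \<longrightarrow> E s s' \<longrightarrow> (\<exists>t'. E' t t' \<and> Z (?e s' t')))"
      by (intro exI[where x = "\<lambda>m. simul E E' (decode (fst (prod_decode m))) (decode (snd (prod_decode m)))"])
        (use simul_step in fastforce)
  next
    assume "\<exists>Z :: cantor. Z (?e s t) \<and>
     (\<forall>s t s'. Z (?e s t) \<longrightarrow> E s s' \<longrightarrow> (\<exists>t'. E' t t' \<and> Z (?e s' t')))"
    then obtain Z where "Z (?e s t) \<and> (\<forall>s t s'. Z (?e s t) \<longrightarrow> E s s' \<longrightarrow> (\<exists>t'. E' t t' \<and> Z (?e s' t')))" ..
    then show "simul E E' s t" unfolding simul_def by (intro exI[where x = "\<lambda>s t. Z (?e s t)"])
  qed
  note R' = delta1_comp[OF R delta1_pair, simplified]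
  show ?thesis unfolding eq ext_step_def
    by (rule sigma1_ex, rule delta1_imp_sigma1) (intro delta1_intros delta1_prod_encode delta1_take delta1_length R' delta1_comp[OF delta1_code]
        delta1_app_fst delta1_app_snd delta1_comp[OF a(1)] delta1_comp[OF a(2)] delta1_comp[OF a(3)] delta1_comp[OF a(4)])
qed

lemma sigma1_normal_form_coded:
  fixes P :: "'a::coded \<Rightarrow> bool"
  assumes "sigma1 x P"
  obtains R where "delta1 x (\<lambda>p. R (fst p) (snd p))" "\<And>a. P a \<longleftrightarrow> inf_path (ext_step R a) []"
proof -
  have "sigma1 x (\<lambda>n. P (decode n))" by (rule sigma1_subst[OF assms]) (rule delta1_decode)
  then obtain R where R: "delta1 x (\<lambda>p. R (fst p) (snd p))"
    "\<And>n. P (decode n) \<longleftrightarrow> (\<exists>h. \<forall>k. R n (init h k :: nat list))"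
    using sigma1_normal_form[of x "\<lambda>n. P (decode n)"] by blast
  note R' = delta1_comp[OF R(1) delta1_pair, simplified]
  show ?thesis
  proof (rule that)
    show "delta1 x (\<lambda>p :: 'a \<times> nat list. R (code (fst p)) (snd p))"
      by (intro R' delta1_comp[OF delta1_code] delta1_basic)
    show "P a \<longleftrightarrow> inf_path (ext_step (\<lambda>a. R (code a)) a) []" for a
      using R(2)[of "code a"] path_ext[of "\<lambda>a. R (code a)" a] by simp
  qed
qed

lemma open_contains_cylinder:
  assumes "open U" "y \<in> U" shows "\<exists>n. cylinder (init y n) \<subseteq> U"
proof -
  have "openin (product_topology (\<lambda>i::nat. euclidean :: bool topology) UNIV) U"
    using assms(1) by (simp add: open_fun_def)
  from product_topology_open_contains_basis[OF this assms(2)]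
  obtain X where X: "y \<in> (\<Pi>\<^sub>E i\<in>UNIV. X i)" "finite {i. X i \<noteq> topspace (euclidean :: bool topology)}"
    "(\<Pi>\<^sub>E i\<in>UNIV. X i) \<subseteq> U" by blast
  obtain n where n: "\<And>i. X i \<noteq> UNIV \<Longrightarrow> i < n" using X(2) finite_nat_set_iff_bounded by auto
  have "cylinder (init y n) \<subseteq> (\<Pi>\<^sub>E i\<in>UNIV. X i)"
  proof
    fix z assume z: "z \<in> cylinder (init y n)"
    have "z i \<in> X i" for i
    proof (cases "i < n")
      case True
      then show ?thesis using z X(1) by (auto simp: cylinder_def)
    next
      case False
      then have "X i = UNIV" using n by blast
      then show ?thesis by simp
    qed
    then show "z \<in> (\<Pi>\<^sub>E i\<in>UNIV. X i)" by (simp add: PiE_UNIV_domain)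
  qed
  with X(3) show ?thesis by blast
qed

lemma in_cylinder_init [simp]: "y \<in> cylinder (init y n)"
  by (simp add: cylinder_def)

text \<open>If the strings ranked below some \<open>\<tau>\<close> with \<open>cylinder \<tau> \<subseteq> U\<close> cover \<open>U\<close>, they form a \<open>\<Delta>\<^sup>1\<^sub>1\<close> set.
  Otherwise \<open>{\<sigma>. cylinder \<sigma> \<subseteq> U}\<close> itself is \<open>\<Sigma>\<^sup>1\<^sub>1\<close>: membership of \<open>\<tau>\<close> is witnessed by a point of \<open>U\<close> all of
  whose neighbourhoods rank above \<open>\<tau>\<close>.\<close>

theorem open_delta11_generated:
  assumes U: "delta1 x (\<lambda>y. y \<in> U)" and op: "open U"
  obtains W where "delta1 x (\<lambda>\<sigma>. \<sigma> \<in> W)" "U = (\<Union>\<sigma>\<in>W. cylinder \<sigma>)"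
proof -
  define P where "P \<sigma> \<longleftrightarrow> \<not> cylinder \<sigma> \<subseteq> U" for \<sigma>
  have cover: "\<exists>\<sigma>. \<not> P \<sigma> \<and> y \<in> cylinder \<sigma>" if "y \<in> U" for y
    using open_contains_cylinder[OF op that] in_cylinder_init unfolding P_def by blast
  have P_eq: "P \<sigma> \<longleftrightarrow> (\<exists>y. y \<in> cylinder \<sigma> \<and> \<not> y \<in> U)" for \<sigma> by (auto simp: P_def)
  have sigP: "sigma1 x P" unfolding P_eq[abs_def]
    by (rule sigma1_ex, rule delta1_imp_sigma1) (intro delta1_intros delta1_cylinder delta1_comp[OF U])
  obtain R where R: "delta1 x (\<lambda>p. R (fst p) (snd p))" and PR: "\<And>\<sigma>. P \<sigma> \<longleftrightarrow> inf_path (ext_step R \<sigma>) []"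
    using sigma1_normal_form_coded[OF sigP] by blast
  \<comment> \<open>\<open>le\<close> and \<open>lt\<close> compare the ranks of two trees. Both are
    \<open>\<Sigma>\<^sup>1\<^sub>1\<close>, and \<open>le \<sigma> \<tau>\<close> is the negation
    of \<open>lt \<tau> \<sigma>\<close> as soon as the tree of \<open>\<tau>\<close> is
    well-founded, that is, \<open>\<not> P \<tau>\<close>.\<close>
  define le where "le \<sigma> \<tau> \<longleftrightarrow> simul (ext_step R \<sigma>) (ext_step R \<tau>) [] []" for \<sigma> \<tau>
  define lt where "lt \<sigma> \<tau> \<longleftrightarrow> (\<exists>s'. ext_step R \<tau> [] s' \<and> simul (ext_step R \<sigma>) (ext_step R \<tau>) [] s')" for \<sigma> \<tau>
  have sigma1_le: "sigma1 x (\<lambda>c. le (s c) (t c))" if "delta1 x s" "delta1 x t" for s t :: "'c::point \<Rightarrow> bool list"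
    unfolding le_def by (intro sigma1_simul R that delta1_const)
  note R' = delta1_comp[OF R delta1_pair, simplified]
  have sigma1_lt: "sigma1 x (\<lambda>c. lt (s c) (t c))" if "delta1 x s" "delta1 x t" for s t :: "'c::point \<Rightarrow> bool list"
    unfolding lt_def
  proof (rule sigma1_ex, rule sigma1_conj)
    show "sigma1 x (\<lambda>p. ext_step R (t (fst p)) [] (snd p))" unfolding ext_step_def
      by (intro delta1_imp_sigma1 R' delta1_intros delta1_take delta1_length delta1_comp[OF that(2)])
    show "sigma1 x (\<lambda>p. simul (ext_step R (s (fst p))) (ext_step R (t (fst p))) [] (snd p))"
      by (rule sigma1_simul[OF R delta1_comp[OF that(1) delta1_fst[OF delta1_id]] delta1_comp[OF that(2) delta1_fst[OF delta1_id]]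
           delta1_const delta1_snd[OF delta1_id]])
  qed
  have not_le: "lt \<tau> \<sigma>" if "\<not> le \<sigma> \<tau>" for \<sigma> \<tau>
    unfolding lt_def by (rule not_simul[OF that[unfolded le_def]])
  have not_lt: "\<not> lt \<tau> \<sigma>" if "le \<sigma> \<tau>" "\<not> P \<tau>" for \<sigma> \<tau>
    unfolding lt_def using not_simul_child[OF that(2)[unfolded PR] that(1)[unfolded le_def]] by auto
  show ?thesis
  proof (cases "\<exists>\<tau>. \<not> P \<tau> \<and> (\<forall>y\<in>U. \<exists>\<sigma>. le \<sigma> \<tau> \<and> y \<in> cylinder \<sigma>)")
    case True
    then obtain \<tau> where \<tau>: "\<not> P \<tau>" "\<And>y. y \<in> U \<Longrightarrow> \<exists>\<sigma>. le \<sigma> \<tau> \<and> y \<in> cylinder \<sigma>" by blast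
    show ?thesis
    proof (rule that[of "{\<sigma>. le \<sigma> \<tau>}"])
      have "\<not> le \<sigma> \<tau> \<longleftrightarrow> lt \<tau> \<sigma>" for \<sigma> using not_le not_lt \<tau>(1) by blast
      then show "delta1 x (\<lambda>\<sigma>. \<sigma> \<in> {\<sigma>. le \<sigma> \<tau>})"
        by (simp add: delta1_bool sigma1_le sigma1_lt delta1_id delta1_const)
      have "\<not> P \<sigma>" if "le \<sigma> \<tau>" for \<sigma>
        using simul_path[OF that[unfolded le_def]] \<tau>(1) unfolding PR by auto
      then show "U = (\<Union>\<sigma>\<in>{\<sigma>. le \<sigma> \<tau>}. cylinder \<sigma>)" using \<tau>(2) unfolding P_def by blast
    qed
  next
    case False
    have Q: "\<not> P \<tau> \<longleftrightarrow> (\<exists>y. y \<in> U \<and> (\<forall>\<sigma>. y \<in> cylinder \<sigma> \<longrightarrow> lt \<tau> \<sigma>))" for \<tau>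
    proof
      assume "\<not> P \<tau>"
      then show "\<exists>y. y \<in> U \<and> (\<forall>\<sigma>. y \<in> cylinder \<sigma> \<longrightarrow> lt \<tau> \<sigma>)" using False not_le by blast
    next
      assume "\<exists>y. y \<in> U \<and> (\<forall>\<sigma>. y \<in> cylinder \<sigma> \<longrightarrow> lt \<tau> \<sigma>)"
      \<comment> \<open>Some neighbourhood of \<open>y\<close> lies inside \<open>U\<close> and has
        a well-founded tree. The tree of \<open>\<tau>\<close> is simulated strictly below its root
        and is therefore well-founded too.\<close>
      then obtain \<sigma> where \<sigma>: "\<not> P \<sigma>" "lt \<tau> \<sigma>" using cover by blast
      from \<sigma>(2) obtain s' where "ext_step R \<sigma> [] s'" "simul (ext_step R \<tau>) (ext_step R \<sigma>) [] s'"
        unfolding lt_def by auto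
      then show "\<not> P \<tau>" using \<sigma>(1) path_Cons simul_path unfolding PR by metis
    qed
    show ?thesis
    proof (rule that[of "{\<sigma>. \<not> P \<sigma>}"])
      have "sigma1 x (\<lambda>\<tau>. \<not> P \<tau>)" unfolding Q
        by (rule sigma1_ex, rule sigma1_conj, intro delta1_imp_sigma1 delta1_comp[OF U] delta1_basic, rule sigma1_all, rule sigma1_imp)
          (intro delta1_cylinder delta1_basic sigma1_lt)+
      then show "delta1 x (\<lambda>\<sigma>. \<sigma> \<in> {\<sigma>. \<not> P \<sigma>})" using sigP by (simp add: delta1_bool)
      show "U = (\<Union>\<sigma>\<in>{\<sigma>. \<not> P \<sigma>}. cylinder \<sigma>)" using cover by (auto simp: P_def)
    qed
  qed
qed

section \<open>Measure and Kurtz tests\<close>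

interpretation coin: product_prob_space "\<lambda>_::nat. uniform_count_measure (UNIV :: bool set)" UNIV
  by (simp add: product_prob_space_def product_prob_space_axioms_def product_sigma_finite_def
      prob_space_imp_sigma_finite prob_space_uniform_count_measure)

lemma prob_space_mu: "prob_space \<mu>"
  unfolding \<mu>_def by (rule coin.P.prob_space_axioms)

interpretation mu: prob_space \<mu> by (rule prob_space_mu)

lemma space_mu [simp]: "space \<mu> = UNIV"
  by (simp add: \<mu>_def space_PiM space_uniform_count_measure PiE_UNIV_domain)

lemma
  assumes "finite J"
  shows sets_agree: "{y. \<forall>j\<in>J. y j = h j} \<in> sets \<mu>"
    and measure_agree: "measure \<mu> {y. \<forall>j\<in>J. y j = h j} = (1/2) ^ card J"
proof -
  have eq: "{y. \<forall>j\<in>J. y j = h j} = prod_emb UNIV (\<lambda>_. uniform_count_measure (UNIV :: bool set)) J (\<Pi>\<^sub>E j\<in>J. {h j})"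
    by (rule set_eqI) (simp add: prod_emb_def space_uniform_count_measure PiE_UNIV_domain restrict_PiE_iff Pi_iff)
  show "{y. \<forall>j\<in>J. y j = h j} \<in> sets \<mu>"
    unfolding eq \<mu>_def by (rule sets_PiM_I) (use assms in \<open>auto simp: sets_uniform_count_measure\<close>)
  have "emeasure \<mu> {y. \<forall>j\<in>J. y j = h j} = (\<Prod>j\<in>J. emeasure (uniform_count_measure UNIV) {h j})"
    unfolding eq \<mu>_def
    by (rule coin.emeasure_PiM_emb) (use assms in \<open>auto simp: sets_uniform_count_measure\<close>)
  also have "\<dots> = ennreal ((1/2) ^ card J)"
  proof -
    have "emeasure (uniform_count_measure (UNIV :: bool set)) {b} = ennreal (1/2)" for b
      by (subst emeasure_uniform_count_measure) auto
    then show ?thesis by (simp only: prod_constant) (rule ennreal_power, simp)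
  qed
  finally show "measure \<mu> {y. \<forall>j\<in>J. y j = h j} = (1/2) ^ card J"
    by (simp add: measure_def)
qed

lemma cylinder_agree: "cylinder \<sigma> = {y. \<forall>j\<in>{..<length \<sigma>}. y j = \<sigma> ! j}"
  by (auto simp: cylinder_def)

lemma sets_cylinder [simp]: "cylinder \<sigma> \<in> sets \<mu>"
  unfolding cylinder_agree by (rule sets_agree) simp

lemma measure_cylinder: "measure \<mu> (cylinder \<sigma>) = (1/2) ^ length \<sigma>"
  unfolding cylinder_agree by (subst measure_agree) simp_all

lemma sets_cylinders [simp]: "(\<Union>\<sigma>\<in>W. cylinder \<sigma>) \<in> sets \<mu>"
  by (rule sets.countable_UN'[OF countableI_type]) auto

lemma in_cylinder_iff: "y \<in> cylinder \<sigma> \<longleftrightarrow> init y (length \<sigma>) = \<sigma>"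
  unfolding cylinder_def list_eq_iff_nth_eq by simp

lemma in_cylinders_iff: "y \<in> (\<Union>\<sigma>\<in>W. cylinder \<sigma>) \<longleftrightarrow> (\<exists>n. init y n \<in> W)"
proof
  assume "\<exists>n. init y n \<in> W"
  then obtain n where "init y n \<in> W" ..
  then show "y \<in> (\<Union>\<sigma>\<in>W. cylinder \<sigma>)" by (rule UN_I) (rule in_cylinder_init)
next
  assume "y \<in> (\<Union>\<sigma>\<in>W. cylinder \<sigma>)"
  then obtain \<sigma> where "\<sigma> \<in> W" "init y (length \<sigma>) = \<sigma>" by (auto simp: in_cylinder_iff)
  then have "init y (length \<sigma>) \<in> W" by simp
  then show "\<exists>n. init y n \<in> W" ..
qed

lemma finite_strings [simp]: "finite {\<sigma> :: bool list. length \<sigma> = n}"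
  using finite_lists_length_eq[of "UNIV :: bool set" n] by simp

lemma measure_init:
  assumes "\<And>\<tau>. \<tau> \<in> A \<Longrightarrow> length \<tau> = L"
  shows "{y. init y L \<in> A} \<in> sets \<mu>" and "measure \<mu> {y. init y L \<in> A} = card A / 2 ^ L"
proof -
  have fin: "finite A" by (rule finite_subset[OF _ finite_strings[of L]]) (use assms in auto)
  have eq: "{y. init y L \<in> A} = (\<Union>\<tau>\<in>A. cylinder \<tau>)"
    using assms by (auto simp: in_cylinder_iff)
  show "{y. init y L \<in> A} \<in> sets \<mu>" unfolding eq by simp
  have "measure \<mu> (\<Union>\<tau>\<in>A. cylinder \<tau>) = (\<Sum>\<tau>\<in>A. measure \<mu> (cylinder \<tau>))"
    by (rule mu.finite_measure_finite_Union)
      (use fin assms in \<open>auto simp: disjoint_family_on_def in_cylinder_iff\<close>)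
  also have "\<dots> = (\<Sum>\<tau>\<in>A. (1/2) ^ L)" by (rule sum.cong) (use assms in \<open>auto simp: measure_cylinder\<close>)
  finally show "measure \<mu> {y. init y L \<in> A} = card A / 2 ^ L"
    unfolding eq by (simp add: power_one_over)
qed

definition miss :: "bool list set \<Rightarrow> nat \<Rightarrow> bool list set" where
  "miss W L = {\<tau>. length \<tau> = L \<and> (\<forall>i. take i \<tau> \<notin> W)}"

lemma finite_miss [simp]: "finite (miss W L)"
  by (rule finite_subset[OF _ finite_strings[of L]]) (auto simp: miss_def)

lemma init_in_miss: "init y L \<in> miss W L \<longleftrightarrow> (\<forall>i\<le>L. init y i \<notin> W)"
proof -
  have "(\<forall>i. init y (min i L) \<notin> W) \<longleftrightarrow> (\<forall>i\<le>L. init y i \<notin> W)"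
    by (metis min.absorb1 min.cobounded2)
  then show ?thesis by (simp only: miss_def mem_Collect_eq take_init length_map length_upt diff_zero simp_thms)
qed

text \<open>The reals whose first \<open>L\<close> bits miss \<open>W\<close> decrease with
  \<open>L\<close> to the complement of the generated set, which is null; continuity from above
  applies.\<close>

lemma miss_small:
  assumes "emeasure \<mu> (\<Union>\<sigma>\<in>W. cylinder \<sigma>) = 1" "0 < \<epsilon>"
  shows "\<exists>L0. \<forall>L\<ge>L0. real (card (miss W L)) < \<epsilon> * 2 ^ L"
proof -
  let ?A = "\<lambda>L. {y. init y L \<in> miss W L}"
  have A: "?A L \<in> sets \<mu>" "measure \<mu> (?A L) = card (miss W L) / 2 ^ L" for L
    by (rule measure_init; simp add: miss_def)+
  have "(\<lambda>L. measure \<mu> (?A L)) \<longlonglongrightarrow> measure \<mu> (\<Inter>L. ?A L)"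
    by (rule mu.finite_Lim_measure_decseq) (use A in \<open>auto simp: init_in_miss decseq_def\<close>)
  also have "(\<Inter>L. ?A L) = space \<mu> - (\<Union>\<sigma>\<in>W. cylinder \<sigma>)"
  proof (intro set_eqI iffI)
    fix y assume "y \<in> (\<Inter>L. ?A L)"
    then have "init y n \<notin> W" for n using init_in_miss[of y n W] by blast
    then show "y \<in> space \<mu> - (\<Union>\<sigma>\<in>W. cylinder \<sigma>)" unfolding in_cylinders_iff Diff_iff by simp
  next
    fix y assume "y \<in> space \<mu> - (\<Union>\<sigma>\<in>W. cylinder \<sigma>)"
    then show "y \<in> (\<Inter>L. ?A L)" unfolding in_cylinders_iff Diff_iff init_in_miss by auto
  qed
  also have "measure \<mu> \<dots> = 0"
    using assms(1) by (subst mu.prob_compl) (auto simp: measure_def)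
  finally have "\<forall>\<^sub>F L in sequentially. measure \<mu> (?A L) < \<epsilon>"
    using assms(2) by (rule order_tendstoD(2))
  then show ?thesis
    unfolding A eventually_sequentially by (auto simp: field_simps)
qed

lemma open_cylinder [simp]: "open (cylinder \<sigma>)"
proof -
  have "open {y :: cantor. y i = b}" for i b
  proof -
    have "open ((\<lambda>y :: cantor. y i) -` {b})"
      by (rule open_vimage) (simp_all add: discrete_topology_class.open_discrete)
    then show ?thesis by (simp add: vimage_def)
  qed
  then have "open (\<Inter>i\<in>{..<length \<sigma>}. {y :: cantor. y i = \<sigma> ! i})" by (intro open_INT) auto
  moreover have "cylinder \<sigma> = (\<Inter>i\<in>{..<length \<sigma>}. {y. y i = \<sigma> ! i})" by (auto simp: cylinder_def)
  ultimately show ?thesis by simp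
qed

lemma delta1_in_cylinders:
  assumes "delta1 x (\<lambda>\<sigma>. \<sigma> \<in> W)" shows "delta1 x (\<lambda>y. y \<in> (\<Union>\<sigma>\<in>W. cylinder \<sigma>))"
  unfolding in_cylinders_iff by (intro delta1_ex delta1_comp[OF assms] delta1_map_upt delta1_app_fst delta1_basic)

lemma null_compl_iff: "U \<in> sets \<mu> \<Longrightarrow> - U \<in> null_sets \<mu> \<longleftrightarrow> emeasure \<mu> U = 1"
  using mu.prob_compl[of U] sets.compl_sets[of U \<mu>]
  by (auto simp: Compl_eq_Diff_UNIV null_sets_def mu.emeasure_eq_measure)

lemma kurtz_random_iff:
  "kurtz_random x y \<longleftrightarrow> (\<forall>U. delta11_open x U \<and> emeasure \<mu> U = 1 \<longrightarrow> y \<in> U)"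
proof
  assume y: "kurtz_random x y"
  show "\<forall>U. delta11_open x U \<and> emeasure \<mu> U = 1 \<longrightarrow> y \<in> U"
  proof (intro allI impI)
    fix U assume U: "delta11_open x U \<and> emeasure \<mu> U = 1"
    then obtain W where W: "delta1 x (\<lambda>\<sigma>. \<sigma> \<in> W)" "U = (\<Union>\<sigma>\<in>W. cylinder \<sigma>)"
      unfolding delta11_open_iff by blast
    have "closed (- U)" unfolding W by (intro closed_Compl open_UN ballI open_cylinder)
    moreover have "- U \<in> null_sets \<mu>" using U null_compl_iff[of U] by (simp add: W)
    moreover have "delta11_class x (- U)"
      unfolding delta11_class_iff_delta1 Compl_iff W by (intro delta1_not delta1_in_cylinders W)
    ultimately show "y \<in> U" using y unfolding kurtz_random_def by blast
  qed
next
  assume *: "\<forall>U. delta11_open x U \<and> emeasure \<mu> U = 1 \<longrightarrow> y \<in> U"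
  show "kurtz_random x y" unfolding kurtz_random_def
  proof
    assume "\<exists>C. closed C \<and> C \<in> null_sets \<mu> \<and> delta11_class x C \<and> y \<in> C"
    then obtain C where C: "closed C" "C \<in> null_sets \<mu>" "delta11_class x C" "y \<in> C" by blast
    have d: "delta1 x (\<lambda>y. y \<in> - C)"
      using C(3) unfolding delta11_class_iff_delta1 Compl_iff by (rule delta1_not)
    obtain W where "delta1 x (\<lambda>\<sigma>. \<sigma> \<in> W)" "- C = (\<Union>\<sigma>\<in>W. cylinder \<sigma>)"
      using open_delta11_generated[OF d] C(1) by blast
    then have "delta11_open x (- C)" unfolding delta11_open_iff by blast
    moreover have "emeasure \<mu> (- C) = 1"
    proof -
      have "- C \<in> sets \<mu>" using sets.compl_sets[of C \<mu>] C(2) by (auto simp: Compl_eq_Diff_UNIV)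
      then show ?thesis using null_compl_iff[of "- C"] C(2) by simp
    qed
    ultimately show False using * C(4) by blast
  qed
qed

lemma delta11_open_mono: "delta11_open empty_real U \<Longrightarrow> delta11_open x U"
  unfolding delta11_open_iff using delta1_mono by blast

lemma kurtz_random_mono: "kurtz_random x y \<Longrightarrow> kurtz_random empty_real y"
  unfolding kurtz_random_iff using delta11_open_mono by blast

lemma low_tests_imp_low_randomness:
  assumes "low_for_kurtz_tests x" shows "low_for_kurtz_randomness x"
proof -
  have "kurtz_random x y" if y: "kurtz_random empty_real y" for y
    unfolding kurtz_random_iff
  proof (intro allI impI)
    fix U assume "delta11_open x U \<and> emeasure \<mu> U = 1"
    then obtain V where "delta11_open empty_real V" "V \<subseteq> U" "emeasure \<mu> V = 1"
      using assms unfolding low_for_kurtz_tests_def by blast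
    then show "y \<in> U" using y unfolding kurtz_random_iff by blast
  qed
  then show ?thesis unfolding low_for_kurtz_randomness_def using kurtz_random_mono by blast
qed

section \<open>From domination and semi-traceability to tests\<close>

lemma full_measureI:
  assumes "\<And>k. measure \<mu> (space \<mu> - U) \<le> c * (1/2) ^ k" "U \<in> sets \<mu>"
  shows "emeasure \<mu> U = 1"
proof -
  have "(\<lambda>k. c * (1/2 :: real) ^ k) \<longlonglongrightarrow> c * 0"
    by (intro tendsto_mult_left LIMSEQ_power_zero) simp
  then have "measure \<mu> (space \<mu> - U) \<le> c * 0"
    by (rule LIMSEQ_le_const) (use assms(1) in blast)
  then have "measure \<mu> (space \<mu> - U) = 0" using measure_nonneg[of \<mu> "space \<mu> - U"] by linarith
  then have "measure \<mu> U = 1" using mu.prob_compl[OF assms(2)] by linarith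
  then show ?thesis by (simp add: mu.emeasure_eq_measure)
qed

lemma geometric_tail: "(\<Sum>m\<in>{j..n}. (1/2 :: real) ^ m) \<le> 2 * (1/2) ^ j"
proof (cases "j \<le> n")
  case True
  have "(\<Sum>m\<in>{j..j+k}. (1/2 :: real) ^ m) = 2 * (1/2) ^ j - (1/2) ^ (j + k)" for k
  proof (induction k)
    case (Suc k)
    have "(\<Sum>m\<in>{j..j + Suc k}. (1/2 :: real) ^ m) = (\<Sum>m\<in>{j..j + k}. (1/2) ^ m) + (1/2) ^ (j + k) / 2"
      by simp
    then show ?case unfolding Suc by simp
  qed simp
  from this[of "n - j"] True show ?thesis by simp
qed simp

lemma dominated_semi_traceable_imp_low:
  assumes dom: "delta11_dominated x" and tr: "delta11_semi_traceable x"
  shows "low_for_kurtz_tests x"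
  unfolding low_for_kurtz_tests_def
proof (intro allI impI)
  fix U assume U: "delta11_open x U \<and> emeasure \<mu> U = 1"
  then obtain W where W: "delta1 x (\<lambda>\<sigma>. \<sigma> \<in> W)" and UW: "U = (\<Union>\<sigma>\<in>W. cylinder \<sigma>)"
    unfolding delta11_open_iff by blast
  have W1: "emeasure \<mu> (\<Union>\<sigma>\<in>W. cylinder \<sigma>) = 1" using U UW by simp
  \<comment> \<open>The correct guess: a list of exactly the strings of some length \<open>L\<close>
    that miss \<open>W\<close>, with at most \<open>2 ^ (L - n)\<close> entries. Being exhaustive,
    it covers the complement of \<open>U\<close>.\<close>
  define h where "h n = (LEAST c. \<exists>L. (\<forall>\<tau>. \<tau> \<in> set (decode c) \<longleftrightarrow> length \<tau> = L \<and> (\<forall>i. take i \<tau> \<notin> W)) \<and>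
      length (decode c :: bool list list) * 2 ^ n \<le> 2 ^ L)" for n
  have "delta1 x h" unfolding h_def[abs_def]
    by (intro delta1_Least delta1_intros delta1_member delta1_length delta1_take delta1_power delta1_comp[OF W] delta1_comp[OF delta1_decode])
  have h: "\<exists>L. set (decode (h n)) = miss W L \<and> length (decode (h n) :: bool list list) * 2 ^ n \<le> 2 ^ L" for n
  proof -
    obtain L where L: "real (card (miss W L)) < (1/2) ^ n * 2 ^ L"
      using miss_small[OF W1, of "(1/2) ^ n"] by auto
    obtain xs where xs: "set xs = miss W L" "distinct xs" using finite_distinct_list[OF finite_miss] by blast
    have "real (length xs * 2 ^ n) \<le> real (2 ^ L)"
      using L xs distinct_card[OF xs(2)] by (simp add: field_simps power_one_over)
    then have "length xs * 2 ^ n \<le> 2 ^ L" by (simp only: of_nat_le_iff)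
    then have "\<exists>L. (\<forall>\<tau>. \<tau> \<in> set (decode (code xs)) \<longleftrightarrow> length \<tau> = L \<and> (\<forall>i. take i \<tau> \<notin> W)) \<and>
      length (decode (code xs) :: bool list list) * 2 ^ n \<le> 2 ^ L"
      using xs(1) by (auto simp: miss_def)
    then have "\<exists>L. (\<forall>\<tau>. \<tau> \<in> set (decode (h n)) \<longleftrightarrow> length \<tau> = L \<and> (\<forall>i. take i \<tau> \<notin> W)) \<and>
      length (decode (h n) :: bool list list) * 2 ^ n \<le> 2 ^ L"
      unfolding h_def by (rule LeastI)
    then show ?thesis by (auto simp: miss_def)
  qed
  obtain k where k: "delta1 empty_real k" "infinite {n. h n = k n}"
    using tr \<open>delta1 x h\<close> unfolding delta11_semi_traceable_def hyp_in_iff_delta1 by blast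
  have kx: "delta1 x k" using delta1_mono[OF k(1)] .
  \<comment> \<open>The first correct guess from \<open>j\<close> on can only be found with the help
    of \<open>x\<close>; domination replaces it by a bound that is independent of
    \<open>x\<close>.\<close>
  define s where "s j = (LEAST m. j \<le> m \<and> h m = k m)" for j
  have "delta1 x s" unfolding s_def[abs_def]
    by (intro delta1_Least delta1_intros delta1_comp[OF \<open>delta1 x h\<close>] delta1_comp[OF kx])
  then obtain g where g: "delta1 empty_real g" "\<And>j. s j \<le> g j"
    using dom unfolding delta11_dominated_def hyp_in_iff_delta1 by blast
  have s: "j \<le> s j \<and> h (s j) = k (s j)" for j
  proof -
    obtain m where "m \<in> {n. h n = k n}" "j \<le> m"
      using k(2) unfolding infinite_nat_iff_unbounded_le by auto
    then have "j \<le> m \<and> h m = k m" by simp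
    then show ?thesis unfolding s_def by (rule LeastI)
  qed
  \<comment> \<open>Correctness of a guess refers to \<open>x\<close>, but the uniform length and
    the size bound do not, and these alone keep the measure of the guess at most
    \<open>2^-n\<close>.\<close>
  define ok where "ok xs n \<longleftrightarrow> (\<exists>L. (\<forall>\<tau>. \<tau> \<in> set xs \<longrightarrow> length \<tau> = L) \<and> length xs * 2 ^ n \<le> 2 ^ L)"
    for xs :: "bool list list" and n :: nat
  let ?d = "\<lambda>m. decode (k m) :: bool list list"
  \<comment> \<open>The innermost clause says that the cylinders of \<open>\<sigma>\<close> and
    \<open>\<tau>\<close> are disjoint.\<close>
  define V where "V = {\<sigma>. \<exists>j. \<forall>m. j \<le> m \<longrightarrow> m \<le> g j \<longrightarrow> ok (?d m) m \<longrightarrow>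
     (\<forall>\<tau>. \<tau> \<in> set (?d m) \<longrightarrow> (\<exists>i. i < length \<sigma> \<and> i < length \<tau> \<and> nth0 \<sigma> i \<noteq> nth0 \<tau> i))}"
  have "delta1 empty_real (\<lambda>\<sigma>. \<sigma> \<in> V)" unfolding V_def mem_Collect_eq ok_def
    by (intro delta1_intros delta1_member delta1_length delta1_nth0 delta1_power delta1_comp[OF delta1_decode] delta1_comp[OF g(1)] delta1_comp[OF k(1)])
  then have "delta11_open empty_real (\<Union>\<sigma>\<in>V. cylinder \<sigma>)" unfolding delta11_open_iff by blast
  moreover have "(\<Union>\<sigma>\<in>V. cylinder \<sigma>) \<subseteq> U"
  proof (rule ccontr)
    assume "\<not> (\<Union>\<sigma>\<in>V. cylinder \<sigma>) \<subseteq> U"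
    then obtain y \<sigma> where y: "\<sigma> \<in> V" "y \<in> cylinder \<sigma>" "y \<notin> U" by blast
    obtain j where j: "\<And>m \<tau>. j \<le> m \<Longrightarrow> m \<le> g j \<Longrightarrow> ok (?d m) m \<Longrightarrow> \<tau> \<in> set (?d m) \<Longrightarrow>
       \<exists>i. i < length \<sigma> \<and> i < length \<tau> \<and> nth0 \<sigma> i \<noteq> nth0 \<tau> i"
      using y(1) unfolding V_def by blast
    obtain L where L: "set (?d (s j)) = miss W L" "length (?d (s j)) * 2 ^ s j \<le> 2 ^ L"
      using h[of "s j"] s[of j] by auto
    then have "ok (?d (s j)) (s j)" unfolding ok_def by (auto simp: miss_def)
    moreover have "init y L \<in> set (?d (s j))"
      using y(3) unfolding L init_in_miss UW in_cylinders_iff by blast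
    ultimately obtain i where "i < length \<sigma>" "i < length (init y L)" "nth0 \<sigma> i \<noteq> nth0 (init y L) i"
      using j[of "s j" "init y L"] s[of j] g(2)[of j] by blast
    then show False using y(2) by (simp add: cylinder_def)
  qed
  moreover have "emeasure \<mu> (\<Union>\<sigma>\<in>V. cylinder \<sigma>) = 1"
  proof -
    let ?V = "\<Union>\<sigma>\<in>V. cylinder \<sigma>"
    let ?B = "\<lambda>m. if ok (?d m) m then (\<Union>\<tau>\<in>set (?d m). cylinder \<tau>) else {}"
    have Bm: "?B m \<in> sets \<mu>" for m by simp
    have B: "measure \<mu> (?B m) \<le> (1/2) ^ m" for m
    proof (cases "ok (?d m) m")
      case True
      then obtain L where L: "\<And>\<tau>. \<tau> \<in> set (?d m) \<Longrightarrow> length \<tau> = L" "length (?d m) * 2 ^ m \<le> 2 ^ L"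
        unfolding ok_def by blast
      have "?B m = {y. init y L \<in> set (?d m)}" using True L(1) by (auto simp: in_cylinder_iff)
      then have "measure \<mu> (?B m) = card (set (?d m)) / 2 ^ L" using measure_init(2)[of "set (?d m)" L] L(1) by simp
      also have "\<dots> \<le> length (?d m) / 2 ^ L" by (simp add: divide_right_mono card_length)
      also have "\<dots> \<le> (1/2) ^ m"
      proof -
        have "real (length (?d m) * 2 ^ m) \<le> real (2 ^ L)" using L(2) by (simp only: of_nat_le_iff)
        then show ?thesis by (simp add: field_simps power_one_over)
      qed
      finally show ?thesis .
    qed simp
    have sub: "space \<mu> - ?V \<subseteq> (\<Union>m\<in>{j..g j}. ?B m)" for j
    proof
      fix y assume y: "y \<in> space \<mu> - ?V"
      show "y \<in> (\<Union>m\<in>{j..g j}. ?B m)"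
      proof (rule ccontr)
        assume no: "y \<notin> (\<Union>m\<in>{j..g j}. ?B m)"
        \<comment> \<open>A prefix of \<open>y\<close> longer than all strings in these finitely
          many guesses exhibits every disagreement, and so belongs to \<open>V\<close>.\<close>
        have "finite (length ` (\<Union>m\<in>{j..g j}. set (?d m)))" by simp
        then obtain n where n': "\<forall>l \<in> length ` (\<Union>m\<in>{j..g j}. set (?d m)). l < n"
          unfolding finite_nat_set_iff_bounded by (rule exE)
        have n: "length \<tau> < n" if "j \<le> m" "m \<le> g j" "\<tau> \<in> set (?d m)" for m \<tau>
          using n' that by auto
        have "\<exists>i. i < n \<and> i < length \<tau> \<and> nth0 (init y n) i \<noteq> nth0 \<tau> i"
          if "j \<le> m" "m \<le> g j" "ok (?d m) m" "\<tau> \<in> set (?d m)" for m \<tau>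
        proof -
          have "y \<notin> cylinder \<tau>" using no that by auto
          then obtain i where "i < length \<tau>" "y i \<noteq> \<tau> ! i" by (auto simp: cylinder_def)
          then show ?thesis using n[OF that(1,2,4)] by (intro exI[of _ i]) auto
        qed
        then have "init y n \<in> V" unfolding V_def by auto
        then have "y \<in> ?V" by (rule UN_I) (rule in_cylinder_init)
        with y show False by blast
      qed
    qed
    have "measure \<mu> (space \<mu> - ?V) \<le> 2 * (1/2) ^ j" for j
    proof -
      have "measure \<mu> (space \<mu> - ?V) \<le> measure \<mu> (\<Union>m\<in>{j..g j}. ?B m)"
        by (rule mu.finite_measure_mono[OF sub]) (use Bm in blast)
      also have "\<dots> \<le> (\<Sum>m\<in>{j..g j}. measure \<mu> (?B m))"
        by (rule mu.finite_measure_subadditive_finite) (use Bm in blast)+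
      also have "\<dots> \<le> (\<Sum>m\<in>{j..g j}. (1/2) ^ m)" by (rule sum_mono) (rule B)
      also have "\<dots> \<le> 2 * (1/2) ^ j" by (rule geometric_tail)
      finally show ?thesis .
    qed
    then show ?thesis by (rule full_measureI) simp
  qed
  ultimately show "\<exists>V. delta11_open empty_real V \<and> V \<subseteq> U \<and> emeasure \<mu> V = 1" by blast
qed

section \<open>Kurtz random reals in sparse closed sets\<close>

instance arith_term :: countable by countable_datatype
instance arith_fm :: countable by countable_datatype

lemma countable_delta_sets: "countable {W :: bool list set. delta1 x (\<lambda>\<sigma>. \<sigma> \<in> W)}"
proof (rule countable_subset)
  let ?F = "\<lambda>p. {\<sigma>. \<exists>f. sat f (\<lambda>_. x) (\<lambda>_. string_code \<sigma>) p}"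
  show "{W. delta1 x (\<lambda>\<sigma>. \<sigma> \<in> W)} \<subseteq> range ?F"
  proof
    fix W :: "bool list set" assume "W \<in> {W. delta1 x (\<lambda>\<sigma>. \<sigma> \<in> W)}"
    then have "sigma11 x (string_code ` W)"
      unfolding mem_Collect_eq delta11_strings_iff_delta1[symmetric] delta11_def by simp
    then obtain p where p: "\<And>n. n \<in> string_code ` W \<longleftrightarrow> (\<exists>f. sat f (\<lambda>_. x) (\<lambda>_. n) p)"
      unfolding sigma11_def by auto
    have "\<sigma> \<in> W \<longleftrightarrow> string_code \<sigma> \<in> string_code ` W" for \<sigma>
      by (auto simp: string_code_eq_code)
    then have "W = ?F p" unfolding p by blast
    then show "W \<in> range ?F" by blast
  qed
qed simp

section \<open>Baire category in the closed set of reals vanishing along \<open>p\<close>\<close>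

definition avoids :: "(nat \<Rightarrow> nat) \<Rightarrow> bool list \<Rightarrow> bool" where
  "avoids p \<sigma> \<longleftrightarrow> (\<forall>i. p i < length \<sigma> \<longrightarrow> \<not> \<sigma> ! p i)"

lemma avoids_append_False: "avoids p \<sigma> \<Longrightarrow> avoids p (\<sigma> @ replicate n False)"
  by (auto simp: avoids_def nth_append)

lemma strict_mono_ge: "strict_mono (p :: nat \<Rightarrow> nat) \<Longrightarrow> n \<le> p n"
  by (rule strict_mono_imp_increasing)

text \<open>A real outside this set vanishes at the first \<open>k\<close> places of
  \<open>p\<close>, an event of measure \<open>(1/2) ^ k\<close>.\<close>

lemma measure_zeros:
  fixes p :: "nat \<Rightarrow> nat"
  assumes "strict_mono p"
  shows "emeasure \<mu> (\<Union>\<sigma>\<in>{\<sigma>. \<exists>i. p i < length \<sigma> \<and> nth0 \<sigma> (p i)}. cylinder \<sigma>) = 1"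
proof -
  let ?U = "\<Union>\<sigma>\<in>{\<sigma>. \<exists>i. p i < length \<sigma> \<and> nth0 \<sigma> (p i)}. cylinder \<sigma>"
  have "measure \<mu> (space \<mu> - ?U) \<le> (1/2) ^ k" for k
  proof -
    have "space \<mu> - ?U \<subseteq> {y. \<forall>j\<in>p ` {..<k}. y j = False}"
    proof
      fix y assume y: "y \<in> space \<mu> - ?U"
      have "\<not> y (p i)" for i
      proof
        assume "y (p i)"
        then have "init y (Suc (p i)) \<in> {\<sigma>. \<exists>i. p i < length \<sigma> \<and> nth0 \<sigma> (p i)}"
          by (auto simp del: upt_Suc intro!: exI[of _ i])
        then have "y \<in> ?U" by (rule UN_I) (rule in_cylinder_init)
        with y show False by blast
      qed
      then show "y \<in> {y. \<forall>j\<in>p ` {..<k}. y j = False}" by auto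
    qed
    then have "measure \<mu> (space \<mu> - ?U) \<le> measure \<mu> {y. \<forall>j\<in>p ` {..<k}. y j = False}"
      by (rule mu.finite_measure_mono) (rule sets_agree, simp)
    also have "\<dots> = (1/2) ^ card (p ` {..<k})"
      using measure_agree[of "p ` {..<k}" "\<lambda>_. False"] by simp
    also have "card (p ` {..<k}) = k"
      using card_image[OF strict_mono_imp_inj_on[OF assms], of "{..<k}"] by simp
    finally show ?thesis .
  qed
  then show ?thesis by (intro full_measureI[where c = 1]) simp_all
qed

lemma generic_chain:
  fixes S :: "nat \<Rightarrow> bool list set"
  assumes step: "\<And>\<sigma> n. avoids p \<sigma> \<Longrightarrow> \<exists>\<tau>. avoids p \<tau> \<and> take (length \<sigma>) \<tau> = \<sigma> \<and> (\<exists>i. take i \<tau> \<in> S n)"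
  obtains y where "\<And>i. \<not> y (p i)" "\<And>n. \<exists>k. init y k \<in> S n"
proof -
  have "\<exists>s. \<forall>n. avoids p (s n) \<and>
     (take (length (s n)) (s (Suc n)) = s n \<and> length (s n) < length (s (Suc n)) \<and> (\<exists>i. take i (s (Suc n)) \<in> S n))"
  proof (rule dependent_nat_choice)
    show "\<exists>\<sigma>. avoids p \<sigma>" by (rule exI[where x = "[]"]) (simp add: avoids_def)
    fix \<sigma> n assume "avoids p \<sigma>"
    then obtain \<tau> i where \<tau>: "avoids p \<tau>" "take (length \<sigma>) \<tau> = \<sigma>" "take i \<tau> \<in> S n" using step by blast
    \<comment> \<open>The extra bit makes the lengths grow strictly, so that the chain determines a
      real; \<open>False\<close> is allowed at every place.\<close>
    let ?\<tau> = "\<tau> @ replicate 1 False"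
    have l: "length \<sigma> \<le> length \<tau>" using arg_cong[OF \<tau>(2), of length] by simp
    have "take (min i (length \<tau>)) ?\<tau> = take i \<tau>" by (simp add: min_def)
    then have "take (min i (length \<tau>)) ?\<tau> \<in> S n" using \<tau>(3) by (simp only:)
    then have "\<exists>i. take i ?\<tau> \<in> S n" by blast
    then have "avoids p ?\<tau> \<and> take (length \<sigma>) ?\<tau> = \<sigma> \<and> length \<sigma> < length ?\<tau> \<and> (\<exists>i. take i ?\<tau> \<in> S n)"
      using avoids_append_False[OF \<tau>(1), of 1] \<tau>(2) l by (intro conjI) simp_all
    then show "\<exists>\<tau>. avoids p \<tau> \<and> (take (length \<sigma>) \<tau> = \<sigma> \<and> length \<sigma> < length \<tau> \<and> (\<exists>i. take i \<tau> \<in> S n))" by blast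
  qed
  then obtain s where s: "\<And>n. avoids p (s n)" "\<And>n. take (length (s n)) (s (Suc n)) = s n"
    "\<And>n. length (s n) < length (s (Suc n))" "\<And>n. \<exists>i. take i (s (Suc n)) \<in> S n" by blast
  have len: "n \<le> length (s n)" for n
  proof (induction n)
    case (Suc n)
    then show ?case using s(3)[of n] by simp
  qed simp
  have mono: "length (s n) \<le> length (s m) \<and> take (length (s n)) (s m) = s n" if "n \<le> m" for n m
    using that
  proof (induction m rule: dec_induct)
    case (step m)
    have "take (length (s n)) (s (Suc m)) = take (length (s n)) (take (length (s m)) (s (Suc m)))"
      using step.IH by (simp add: min_def)
    then show ?case using step.IH s(2,3)[of m] by simp
  qed simp
  define y where "y i = s (Suc i) ! i" for i
  have y: "y i = s n ! i" if "i < length (s n)" for i n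
  proof (cases "n \<le> Suc i")
    case True
    then have "s n ! i = take (length (s n)) (s (Suc i)) ! i" using mono by simp
    then show ?thesis using that by (simp add: y_def)
  next
    case False
    then have "s (Suc i) ! i = take (length (s (Suc i))) (s n) ! i" using mono[of "Suc i" n] by simp
    then show ?thesis using len[of "Suc i"] by (simp add: y_def)
  qed
  have s_eq: "init y (length (s n)) = s n" for n by (rule nth_equalityI) (auto simp: y)
  show ?thesis
  proof (rule that)
    fix i
    have "p i < length (s (Suc (p i)))" using len[of "Suc (p i)"] by simp
    then show "\<not> y (p i)" using s(1)[of "Suc (p i)"] y by (simp add: avoids_def)
  next
    fix n
    obtain i where "take i (s (Suc n)) \<in> S n" using s(4) by blast
    then have "take i (init y (length (s (Suc n)))) \<in> S n" by (simp only: s_eq)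
    then show "\<exists>k. init y k \<in> S n" unfolding take_init by blast
  qed
qed

text \<open>\<open>meet\<close> makes each of the countably many unrelativised tests dense in the
  set of reals vanishing along \<open>p\<close>. A generic real of that set passes them all, yet the
  set itself is closed, null and \<open>\<Delta>\<^sup>1\<^sub>1\<close> relative to
  \<open>x\<close>.\<close>

lemma not_low_randomness:
  assumes p: "delta1 x p" "strict_mono p"
    and meet: "\<And>W \<sigma>. delta1 empty_real (\<lambda>\<sigma>. \<sigma> \<in> W) \<Longrightarrow> emeasure \<mu> (\<Union>\<sigma>\<in>W. cylinder \<sigma>) = 1 \<Longrightarrow> avoids p \<sigma> \<Longrightarrow>
       \<exists>\<tau>. avoids p \<tau> \<and> take (length \<sigma>) \<tau> = \<sigma> \<and> (\<exists>i. take i \<tau> \<in> W)"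
  shows "\<not> low_for_kurtz_randomness x"
proof
  assume low: "low_for_kurtz_randomness x"
  let ?F = "{W. delta1 empty_real (\<lambda>\<sigma>. \<sigma> \<in> W) \<and> emeasure \<mu> (\<Union>\<sigma>\<in>W. cylinder \<sigma>) = 1}"
  have cF: "countable ?F" by (rule countable_subset[OF _ countable_delta_sets]) auto
  have UF: "UNIV \<in> ?F"
  proof -
    have "y \<in> cylinder []" for y by (simp add: cylinder_def)
    then have "(\<Union>\<sigma>. cylinder \<sigma>) = space \<mu>" by auto
    then have "emeasure \<mu> (\<Union>\<sigma>. cylinder \<sigma>) = 1" by (simp only: mu.emeasure_space_1)
    then show ?thesis by (simp add: delta1_const)
  qed
  from UF have "?F \<noteq> {}" by blast
  then have rng: "range (from_nat_into ?F) = ?F" using cF by (rule range_from_nat_into)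
  have mem: "from_nat_into ?F n \<in> ?F" for n using rng by blast
  obtain y where y: "\<And>i. \<not> y (p i)" "\<And>n. \<exists>k. init y k \<in> from_nat_into ?F n"
  proof (rule generic_chain[of p "from_nat_into ?F"])
    fix \<sigma> n assume "avoids p \<sigma>"
    then show "\<exists>\<tau>. avoids p \<tau> \<and> take (length \<sigma>) \<tau> = \<sigma> \<and> (\<exists>i. take i \<tau> \<in> from_nat_into ?F n)"
      using meet mem[of n] by blast
  qed blast
  have "kurtz_random empty_real y" unfolding kurtz_random_iff delta11_open_iff
  proof (intro allI impI)
    fix U assume "(\<exists>W. delta1 empty_real (\<lambda>\<sigma>. \<sigma> \<in> W) \<and> U = (\<Union>\<sigma>\<in>W. cylinder \<sigma>)) \<and> emeasure \<mu> U = 1"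
    then obtain W where W: "W \<in> ?F" "U = (\<Union>\<sigma>\<in>W. cylinder \<sigma>)" by blast
    then obtain n where "W = from_nat_into ?F n" using rng by (metis (no_types, lifting) imageE)
    then show "y \<in> U" using y(2)[of n] unfolding W(2) in_cylinders_iff by simp
  qed
  then have "kurtz_random x y" using low unfolding low_for_kurtz_randomness_def by blast
  moreover have "delta1 x (\<lambda>\<sigma>. \<sigma> \<in> {\<sigma>. \<exists>i. p i < length \<sigma> \<and> nth0 \<sigma> (p i)})"
    unfolding mem_Collect_eq by (intro delta1_intros delta1_length delta1_nth0 delta1_comp[OF p(1)])
  ultimately have "y \<in> (\<Union>\<sigma>\<in>{\<sigma>. \<exists>i. p i < length \<sigma> \<and> nth0 \<sigma> (p i)}. cylinder \<sigma>)"
    using measure_zeros[OF p(2)] unfolding kurtz_random_iff delta11_open_iff by blast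
  then show False using y(1) unfolding in_cylinders_iff by (auto split: if_splits)
qed

section \<open>Low for randomness implies domination\<close>

lemma exists_hitting_extension:
  assumes "emeasure \<mu> (\<Union>\<sigma>\<in>W. cylinder \<sigma>) = 1"
  shows "\<exists>\<tau>. take (length \<sigma>) \<tau> = \<sigma> \<and> (\<exists>i. take i \<tau> \<in> W)"
proof -
  let ?U = "\<Union>\<sigma>\<in>W. cylinder \<sigma>"
  have "cylinder \<sigma> \<inter> ?U \<noteq> {}"
  proof
    assume "cylinder \<sigma> \<inter> ?U = {}"
    then have "measure \<mu> (cylinder \<sigma>) \<le> measure \<mu> (space \<mu> - ?U)"
      by (intro mu.finite_measure_mono sets.compl_sets sets_cylinders) auto
    also have "\<dots> = 0" using assms by (subst mu.prob_compl) (auto simp: measure_def)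
    finally show False using zero_less_power[of "1/2 :: real" "length \<sigma>"] unfolding measure_cylinder by linarith
  qed
  then obtain y where y: "y \<in> cylinder \<sigma>" "y \<in> ?U" by blast
  then obtain n where n: "init y n \<in> W" unfolding in_cylinders_iff by blast
  show ?thesis
    by (rule exI[where x = "init y (max n (length \<sigma>))"])
      (use n y(1) in \<open>auto simp only: take_init in_cylinder_iff min.absorb1 max.cobounded1 max.cobounded2 intro!: exI[where x = n]\<close>)
qed

lemma low_randomness_imp_dominated:
  assumes "low_for_kurtz_randomness x" shows "delta11_dominated x"
proof (rule ccontr)
  assume "\<not> delta11_dominated x"
  then obtain f :: "nat \<Rightarrow> nat" where f: "delta1 x f" and nd: "\<not> (\<exists>g. delta1 empty_real g \<and> (\<forall>n. f n \<le> g n))"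
    unfolding delta11_dominated_def hyp_in_iff_delta1 by blast
  define ft where "ft n = (LEAST v. \<forall>i. i \<le> n \<longrightarrow> f i \<le> v)" for n
  have ft: "f i \<le> ft n" if "i \<le> n" for i n
  proof -
    have "\<forall>i. i \<le> n \<longrightarrow> f i \<le> Max (f ` {..n})" by simp
    then have "\<forall>i. i \<le> n \<longrightarrow> f i \<le> ft n" unfolding ft_def by (rule LeastI)
    with that show ?thesis by blast
  qed
  have dft: "delta1 x ft" unfolding ft_def[abs_def]
    by (intro delta1_Least delta1_intros delta1_comp[OF f])
  \<comment> \<open>The gap after \<open>p n\<close> exceeds \<open>ft (p n)\<close>, where
    \<open>ft\<close> is the running maximum of \<open>f\<close>; monotonicity is used when
    \<open>g\<close> is compared with \<open>f\<close>.\<close>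
  define p where "p n = rec_nat 0 (\<lambda>k r. Suc (r + ft r)) n" for n
  have dp: "delta1 x p" unfolding p_def[abs_def]
    by (intro delta1_rec delta1_intros delta1_comp[OF dft])
  have pS: "p (Suc n) = Suc (p n + ft (p n))" for n by (simp add: p_def)
  have pm: "strict_mono p" by (rule strict_monoI_Suc) (simp add: pS)
  have "\<not> low_for_kurtz_randomness x"
  proof (rule not_low_randomness[OF dp pm])
    fix W \<sigma>
    assume W: "delta1 empty_real (\<lambda>\<sigma>. \<sigma> \<in> W)" and W1: "emeasure \<mu> (\<Union>\<sigma>\<in>W. cylinder \<sigma>) = 1" and \<sigma>: "avoids p \<sigma>"
    \<comment> \<open>The least such \<open>m\<close> is a length within which every string of
      length at most \<open>l\<close> can be extended into the test; it is hyperarithmetic because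
      \<open>W\<close> is.\<close>
    define Q where "Q l m \<longleftrightarrow> l \<le> m \<and> (\<forall>\<sigma>. length \<sigma> \<le> l \<longrightarrow>
       (\<exists>\<tau>. length \<tau> \<le> m \<and> take (length \<sigma>) \<tau> = \<sigma> \<and> (\<exists>i. take i \<tau> \<in> W)))" for l m
    define h where "h l = (LEAST m. Q l m)" for l
    have dh: "delta1 empty_real h" unfolding h_def[abs_def] Q_def
      by (intro delta1_Least delta1_intros delta1_length delta1_take delta1_comp[OF W])
    have Qh: "Q l (h l)" for l
    proof -
      have "\<forall>\<sigma>. \<exists>\<tau>. take (length \<sigma>) \<tau> = \<sigma> \<and> (\<exists>i. take i \<tau> \<in> W)" using exists_hitting_extension[OF W1] by blast
      from choice[OF this] obtain e where e: "\<And>\<sigma>. take (length \<sigma>) (e \<sigma>) = \<sigma> \<and> (\<exists>i. take i (e \<sigma>) \<in> W)" by blast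
      let ?S = "{\<sigma> :: bool list. length \<sigma> \<le> l}"
      have fin: "finite ?S" using finite_lists_length_le[of "UNIV :: bool set" l] by simp
      define m where "m = Max (insert l ((\<lambda>\<sigma>. length (e \<sigma>)) ` ?S))"
      have "l \<le> m" unfolding m_def using fin by simp
      moreover have "length (e \<sigma>) \<le> m" if "length \<sigma> \<le> l" for \<sigma>
        unfolding m_def by (rule Max_ge) (use fin that in auto)
      ultimately have "Q l m" unfolding Q_def using e by blast
      then show ?thesis unfolding h_def by (rule LeastI)
    qed
    have hm: "h l \<le> h l'" if "l \<le> l'" for l l'
    proof -
      have "Q l (h l')" using Qh[of l'] that unfolding Q_def by auto
      then show ?thesis unfolding h_def[of l] by (rule Least_le)
    qed
    have "\<exists>n. length \<sigma> \<le> n \<and> h (Suc (p n)) < p (Suc n)"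
    proof (rule ccontr)
      assume "\<not> (\<exists>n. length \<sigma> \<le> n \<and> h (Suc (p n)) < p (Suc n))"
      then have le: "p (Suc n) \<le> h (Suc (p n))" if "length \<sigma> \<le> n" for n
        using that by (auto simp: not_less)
      let ?N = "length \<sigma>"
      \<comment> \<open>If all later gaps are short and \<open>p n \<le> k < p (Suc n)\<close>, then
        \<open>f k \<le> ft (p (Suc n)) \<le> p (Suc (Suc n)) \<le> h (Suc (p (Suc n))) \<le> h (Suc
        (h (Suc k)))\<close>. The constant summand serves \<open>k \<le> p ?N\<close>.\<close>
      define g where "g k = h (Suc (h (Suc k))) + ft (p ?N)" for k
      have "delta1 empty_real g" unfolding g_def[abs_def]
        by (intro delta1_intros delta1_comp[OF dh])
      moreover have "f k \<le> g k" for k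
      proof (cases "k \<le> p ?N")
        case True
        then show ?thesis using ft[OF True] by (simp add: g_def)
      next
        case False
        define m where "m = (LEAST m. k < p m)"
        have "k < p (Suc k)" using strict_mono_ge[OF pm, of "Suc k"] by simp
        then have m: "k < p m" unfolding m_def by (rule LeastI)
        then have "m \<noteq> 0" by (cases m) (auto simp: p_def)
        then obtain n where n: "m = Suc n" by (cases m) auto
        then have "n < (LEAST m. k < p m)" unfolding m_def by simp
        then have "\<not> k < p n" by (rule not_less_Least)
        have "p ?N < p m" using False m by simp
        then have "?N < m" using strict_mono_less[OF pm] by blast
        then have N: "?N \<le> n" using n by simp
        have "f k \<le> ft (p (Suc n))" using m n by (intro ft) simp
        also have "\<dots> \<le> p (Suc (Suc n))" by (simp add: pS)
        also have "\<dots> \<le> h (Suc (p (Suc n)))" using le[of "Suc n"] N by simp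
        also have "\<dots> \<le> h (Suc (h (Suc k)))"
        proof (rule hm)
          have "p (Suc n) \<le> h (Suc (p n))" using le N by simp
          also have "\<dots> \<le> h (Suc k)" using \<open>\<not> k < p n\<close> by (intro hm) simp
          finally show "Suc (p (Suc n)) \<le> Suc (h (Suc k))" by simp
        qed
        finally show ?thesis by (simp add: g_def)
      qed
      ultimately show False using nd by blast
    qed
    then obtain n where n: "length \<sigma> \<le> n" "h (Suc (p n)) < p (Suc n)" by blast
    \<comment> \<open>Padding with \<open>False\<close> to just beyond \<open>p n\<close> is
      allowed, and the extension into the test then ends before \<open>p (Suc n)\<close>, so it
      meets no new place of \<open>p\<close>.\<close>
    let ?\<sigma> = "\<sigma> @ replicate (Suc (p n) - length \<sigma>) False"
    have "length \<sigma> \<le> p n" using n(1) strict_mono_ge[OF pm, of n] by simp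
    then have len: "length ?\<sigma> = Suc (p n)" by simp
    then obtain \<tau> where \<tau>: "length \<tau> \<le> h (Suc (p n))" "take (length ?\<sigma>) \<tau> = ?\<sigma>" "\<exists>i. take i \<tau> \<in> W"
      using Qh[of "Suc (p n)"] unfolding Q_def by (metis order_refl)
    have "avoids p \<tau>" unfolding avoids_def
    proof (intro allI impI)
      fix i assume "p i < length \<tau>"
      then have "p i < p (Suc n)" using \<tau>(1) n(2) by simp
      then have "p i < length ?\<sigma>" unfolding len using pm by (simp add: strict_mono_less strict_mono_less_eq less_Suc_eq_le)
      moreover from this have "\<tau> ! p i = ?\<sigma> ! p i" by (metis \<tau>(2) nth_take)
      ultimately show "\<not> \<tau> ! p i" using avoids_append_False[OF \<sigma>] unfolding avoids_def by metis
    qed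
    moreover have "take (length \<sigma>) \<tau> = \<sigma>"
    proof -
      have "take (length \<sigma>) (take (length ?\<sigma>) \<tau>) = take (length \<sigma>) ?\<sigma>" by (simp only: \<tau>(2))
      then show ?thesis by (simp add: min_def)
    qed
    ultimately show "\<exists>\<tau>. avoids p \<tau> \<and> take (length \<sigma>) \<tau> = \<sigma> \<and> (\<exists>i. take i \<tau> \<in> W)" using \<tau>(3) by blast
  qed
  with assms show False by blast
qed

section \<open>Low for randomness implies semi-traceability: densities of missed strings\<close>

definition misses :: "bool list set \<Rightarrow> nat \<Rightarrow> bool list \<Rightarrow> nat" where
  "misses W D \<sigma> = card {\<tau>. length \<tau> = D \<and> take (length \<sigma>) \<tau> = \<sigma> \<and> (\<forall>i. take i \<tau> \<notin> W)}"

lemma delta1_misses: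
  assumes W: "delta1 x (\<lambda>\<sigma>. \<sigma> \<in> W)" and "delta1 x D" "delta1 x s"
  shows "delta1 x (\<lambda>a. misses W (D a) (s a))"
  unfolding misses_def
proof (rule delta1_card)
  show "finite {\<tau>. length \<tau> = D a \<and> take (length (s a)) \<tau> = s a \<and> (\<forall>i. take i \<tau> \<notin> W)}" for a
    by (rule finite_subset[OF _ finite_strings[of "D a"]]) auto
  show "delta1 x (\<lambda>p. length (snd p) = D (fst p) \<and> take (length (s (fst p))) (snd p) = s (fst p) \<and> (\<forall>i. take i (snd p) \<notin> W))"
    by (intro delta1_intros delta1_length delta1_take delta1_comp[OF W] delta1_comp[OF assms(2)] delta1_comp[OF assms(3)])
qed

lemma misses_le: "misses W D \<sigma> \<le> card (miss W D)"
  unfolding misses_def by (rule card_mono) (auto simp: miss_def)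

lemma sum_misses_le:
  assumes B: "\<And>\<tau>. \<tau> \<in> B \<Longrightarrow> length \<tau> = L \<and> take (length \<sigma>) \<tau> = \<sigma>" and "length \<sigma> \<le> L"
  shows "(\<Sum>\<tau>\<in>B. misses W D \<tau>) \<le> misses W D \<sigma>"
proof -
  let ?N = "\<lambda>\<sigma>. {\<tau>. length \<tau> = D \<and> take (length \<sigma>) \<tau> = \<sigma> \<and> (\<forall>i. take i \<tau> \<notin> W)}"
  have fin: "finite (?N \<tau>)" for \<tau> by (rule finite_subset[OF _ finite_strings[of D]]) auto
  have "finite B" by (rule finite_subset[OF _ finite_strings[of L]]) (use B in auto)
  then have "(\<Sum>\<tau>\<in>B. misses W D \<tau>) = card (\<Union>\<tau>\<in>B. ?N \<tau>)"
    unfolding misses_def by (intro card_UN_disjoint[symmetric]) (use fin B in auto)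
  also have "\<dots> \<le> misses W D \<sigma>" unfolding misses_def
  proof (rule card_mono[OF fin], rule subsetI)
    fix \<rho> assume "\<rho> \<in> (\<Union>\<tau>\<in>B. ?N \<tau>)"
    then obtain \<tau> where \<tau>: "\<tau> \<in> B" "\<rho> \<in> ?N \<tau>" by blast
    have "take (length \<sigma>) (take L \<rho>) = \<sigma>" using B[OF \<tau>(1)] \<tau>(2) by simp
    then have "take (length \<sigma>) \<rho> = \<sigma>" using assms(2) by (simp add: min_def)
    then show "\<rho> \<in> ?N \<sigma>" using \<tau>(2) by simp
  qed
  finally show ?thesis .
qed

text \<open>The count is obtained from \<open>\<mu>\<close>: the event that all selected places
  carry \<open>True\<close> is removed from the cylinder of \<open>\<sigma>\<close>.\<close>

lemma card_some_zero:
  assumes "length \<sigma> \<le> L" and S: "\<And>v. v \<in> S \<Longrightarrow> length \<sigma> + v < L"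
  shows "real (card {\<tau>. length \<tau> = L \<and> take (length \<sigma>) \<tau> = \<sigma> \<and> (\<exists>v\<in>S. \<not> \<tau> ! (length \<sigma> + v))}) * 2 ^ (length \<sigma> + card S)
    = 2 ^ L * (2 ^ card S - 1)"
proof -
  let ?c = "length \<sigma>"
  let ?B = "{\<tau>. length \<tau> = L \<and> take ?c \<tau> = \<sigma> \<and> (\<exists>v\<in>S. \<not> \<tau> ! (?c + v))}"
  let ?J = "{..<?c} \<union> (\<lambda>v. ?c + v) ` S"
  let ?h = "\<lambda>j. if j < ?c then \<sigma> ! j else True"
  have finS: "finite S" by (rule finite_subset[of _ "{..<L}"]) (use S in force)+
  have cJ: "card ?J = ?c + card S"
    using finS by (subst card_Un_disjoint) (auto simp: card_image inj_on_def)
  have "{y. \<forall>j\<in>?J. y j = ?h j} \<subseteq> cylinder \<sigma>" by (auto simp: cylinder_def)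
  moreover have "{y. init y L \<in> ?B} = cylinder \<sigma> - {y. \<forall>j\<in>?J. y j = ?h j}"
  proof (intro set_eqI)
    fix y
    have "take ?c (init y L) = \<sigma> \<longleftrightarrow> y \<in> cylinder \<sigma>"
      unfolding take_init in_cylinder_iff using assms(1) by (simp add: min_def)
    moreover have "(\<exists>v\<in>S. \<not> init y L ! (?c + v)) \<longleftrightarrow> (\<exists>v\<in>S. \<not> y (?c + v))"
      using S by (intro bex_cong) auto
    moreover have "y \<in> cylinder \<sigma> \<Longrightarrow> (\<forall>j\<in>?J. y j = ?h j) \<longleftrightarrow> (\<forall>v\<in>S. y (?c + v))"
      by (auto simp: cylinder_def)
    ultimately show "y \<in> {y. init y L \<in> ?B} \<longleftrightarrow> y \<in> cylinder \<sigma> - {y. \<forall>j\<in>?J. y j = ?h j}"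
      by auto
  qed
  ultimately have "measure \<mu> {y. init y L \<in> ?B} = measure \<mu> (cylinder \<sigma>) - measure \<mu> {y. \<forall>j\<in>?J. y j = ?h j}"
    using sets_agree[of ?J ?h] finS by (simp only:) (intro mu.finite_measure_Diff, auto)
  also have "\<dots> = (1/2) ^ ?c - (1/2) ^ (?c + card S)"
    using measure_agree[of ?J ?h] finS by (simp add: measure_cylinder cJ)
  finally have "card ?B / 2 ^ L = (1/2) ^ ?c - (1/2 :: real) ^ (?c + card S)"
    using measure_init(2)[of ?B L] by simp
  then show ?thesis by (simp add: field_simps power_add power_one_over)
qed

text \<open>Distinct \<open>v \<in> S\<close> give independent events \<open>\<not> y (length \<sigma> + v)\<close>, so their union has relative
  measure \<open>1 - 2 ^ - card S\<close> above \<open>\<sigma>\<close>; on all of it the density of missed strings exceeds the one above \<open>\<sigma>\<close>.\<close>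

lemma few_bad_positions:
  assumes len: "length \<sigma> = c" "c \<le> L" and S: "\<And>v. v \<in> S \<Longrightarrow> c + v < L" and "i \<le> c"
    and small: "misses W D \<sigma> * (i + 1) * 2 ^ c \<le> i * 2 ^ D"
    and big: "\<And>\<tau> v. v \<in> S \<Longrightarrow> length \<tau> = L \<Longrightarrow> take c \<tau> = \<sigma> \<Longrightarrow> \<not> \<tau> ! (c + v) \<Longrightarrow>
        (i + 1) * 2 ^ D \<le> misses W D \<tau> * ((i + 2) * 2 ^ L)"
  shows "card S < 2 * (c + 1)"
proof (rule ccontr)
  assume K: "\<not> card S < 2 * (c + 1)"
  let ?B = "{\<tau>. length \<tau> = L \<and> take c \<tau> = \<sigma> \<and> (\<exists>v\<in>S. \<not> \<tau> ! (c + v))}"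
  have "card ?B * ((i + 1) * 2 ^ D) \<le> (\<Sum>\<tau>\<in>?B. misses W D \<tau> * ((i + 2) * 2 ^ L))"
    using sum_bounded_below[of ?B "(i + 1) * 2 ^ D" "\<lambda>\<tau>. misses W D \<tau> * ((i + 2) * 2 ^ L)"] big by auto
  also have "\<dots> = (\<Sum>\<tau>\<in>?B. misses W D \<tau>) * ((i + 2) * 2 ^ L)" by (rule sum_distrib_right[symmetric])
  also have "\<dots> \<le> misses W D \<sigma> * ((i + 2) * 2 ^ L)"
    by (intro mult_right_mono sum_misses_le[where L = L]) (use len in auto)
  finally have "real (card ?B * ((i + 1) * 2 ^ D)) \<le> real (misses W D \<sigma> * ((i + 2) * 2 ^ L))"
    by (simp only: of_nat_le_iff)
  then have 1: "real (card ?B) * ((real i + 1) * 2 ^ D) \<le> real (misses W D \<sigma>) * ((real i + 2) * 2 ^ L)"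
    by (simp add: algebra_simps)
  have "real (misses W D \<sigma> * (i + 1) * 2 ^ c) \<le> real (i * 2 ^ D)" using small by (simp only: of_nat_le_iff)
  then have 2: "real (misses W D \<sigma>) * (real i + 1) * 2 ^ c \<le> real i * 2 ^ D"
    by (simp add: algebra_simps)
  have 3: "real (card ?B) * 2 ^ (c + card S) = 2 ^ L * (2 ^ card S - 1)"
    using card_some_zero[of \<sigma> L S] len S by simp
  \<comment> \<open>With \<open>K = card S\<close> the bounds combine to
    \<open>(2^K - 1) * (i + 1)^2 \<le> i * (i + 2) * 2^K\<close>. Since
    \<open>i * (i + 2) = (i + 1)^2 - 1\<close>, this amounts to \<open>2^K \<le> (i + 1)^2\<close>,
    too small for the assumed size of \<open>S\<close>.\<close>
  have "2 ^ L * 2 ^ D * ((2 ^ card S - 1) * (real i + 1)^2)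
      = (real (card ?B) * ((real i + 1) * 2 ^ D)) * ((real i + 1) * 2 ^ (c + card S))"
    using 3 by (simp add: power2_eq_square)
  also have "\<dots> \<le> (real (misses W D \<sigma>) * ((real i + 2) * 2 ^ L)) * ((real i + 1) * 2 ^ (c + card S))"
    by (rule mult_right_mono[OF 1]) simp
  also have "\<dots> = (real (misses W D \<sigma>) * (real i + 1) * 2 ^ c) * ((real i + 2) * 2 ^ L * 2 ^ card S)"
    by (simp add: power_add)
  also have "\<dots> \<le> (real i * 2 ^ D) * ((real i + 2) * 2 ^ L * 2 ^ card S)"
    by (rule mult_right_mono[OF 2]) simp
  also have "\<dots> = 2 ^ L * 2 ^ D * (real i * (real i + 2) * 2 ^ card S)" by simp
  finally have "(2 ^ card S - 1) * (real i + 1)^2 \<le> real i * (real i + 2) * 2 ^ card S"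
    by (rule mult_left_le_imp_le) simp
  then have "2 ^ card S \<le> (real i + 1)^2" by (simp add: power2_eq_square algebra_simps)
  also have "\<dots> \<le> (real (c + 1))^2" using \<open>i \<le> c\<close> by (intro power_mono) auto
  also have "\<dots> < (2 ^ (c + 1))^2"
    using of_nat_less_two_power[of "c + 1", where 'a = real] by (intro power_strict_mono) auto
  also have "\<dots> = 2 ^ (2 * (c + 1))" by (simp only: power_mult[symmetric] mult.commute)
  also have "\<dots> \<le> 2 ^ card S" using K by (intro power_increasing) auto
  finally show False by simp
qed

lemma low_randomness_imp_semi_traceable:
  assumes low: "low_for_kurtz_randomness x" shows "delta11_semi_traceable x"
proof (rule ccontr)
  assume "\<not> delta11_semi_traceable x"
  then obtain f :: "nat \<Rightarrow> nat" where f: "delta1 x f" and nt: "\<And>g. delta1 empty_real g \<Longrightarrow> finite {n. f n = g n}"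
    unfolding delta11_semi_traceable_def hyp_in_iff_delta1 by blast
  define \<Phi> where "\<Phi> n = code (map f [0..<n])" for n
  have d\<Phi>: "delta1 x \<Phi>" unfolding \<Phi>_def[abs_def]
    by (intro delta1_comp[OF delta1_code] delta1_map_upt delta1_comp[OF f] delta1_intros)
  then obtain G where dG: "delta1 empty_real G" and G: "\<And>n. \<Phi> n \<le> G n"
    using low_randomness_imp_dominated[OF low] unfolding delta11_dominated_def hyp_in_iff_delta1 by blast
  \<comment> \<open>The summand after \<open>c\<close> bounds the number of traced values in a block
    starting at \<open>c\<close>: at most \<open>c + 1\<close> starting stages, \<open>2 ^ c\<close>
    strings, and \<open>2 * (c + 1)\<close> bad values for each pair.\<close>
  define \<beta> where "\<beta> c = c + (c + 1) * (2 ^ c * (2 * (c + 1)))" for c :: nat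
  \<comment> \<open>The increments leave room for the offset of \<open>p i\<close>, which is at most
    \<open>G (\<beta> (cc i))\<close>, and make the intervals from \<open>cc i\<close> to
    \<open>\<beta> (cc i)\<close> disjoint. Thanks to \<open>G\<close> the block boundaries are
    hyperarithmetic, although \<open>p\<close> is built from \<open>f\<close>.\<close>
  define cc where "cc i = rec_nat 0 (\<lambda>k r. Suc (r + \<beta> r + G (\<beta> r))) i" for i
  define p where "p i = cc i + \<Phi> (\<beta> (cc i))" for i
  have d\<beta>: "delta1 y \<beta>" for y unfolding \<beta>_def[abs_def] by (intro delta1_intros delta1_power)
  have dcc: "delta1 empty_real cc" unfolding cc_def[abs_def]
    by (intro delta1_rec delta1_intros delta1_comp[OF d\<beta>] delta1_comp[OF dG])
  have dp: "delta1 x p" unfolding p_def[abs_def]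
    by (intro delta1_intros delta1_comp[OF d\<Phi>] delta1_comp[OF d\<beta>] delta1_comp[OF delta1_mono[OF dcc]])
  have ccS: "cc (Suc i) = Suc (cc i + \<beta> (cc i) + G (\<beta> (cc i)))" for i by (simp add: cc_def)
  have cm: "strict_mono cc" by (rule strict_monoI_Suc) (simp add: ccS)
  have p_less: "p i < cc (Suc i)" for i using G[of "\<beta> (cc i)"] by (simp add: p_def ccS)
  have pm: "strict_mono p"
  proof (rule strict_monoI_Suc)
    fix i
    have "cc (Suc i) \<le> p (Suc i)" by (simp add: p_def)
    then show "p i < p (Suc i)" using p_less[of i] by simp
  qed
  have p_less_iff: "p j < cc (Suc i) \<longleftrightarrow> j \<le> i" for i j
  proof
    assume "p j < cc (Suc i)"
    then have "cc j < cc (Suc i)" by (simp add: p_def)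
    then show "j \<le> i" using strict_mono_less[OF cm] by (simp add: less_Suc_eq_le)
  next
    assume "j \<le> i"
    then show "p j < cc (Suc i)" using p_less[of j] strict_mono_less_eq[OF cm, of "Suc j" "Suc i"] by simp
  qed
  have "\<not> low_for_kurtz_randomness x"
  proof (rule not_low_randomness[OF dp pm])
    fix W \<sigma>0
    assume W: "delta1 empty_real (\<lambda>\<sigma>. \<sigma> \<in> W)" and W1: "emeasure \<mu> (\<Union>\<sigma>\<in>W. cylinder \<sigma>) = 1" and \<sigma>0: "avoids p \<sigma>0"
    \<comment> \<open>A stage at which at most half of the extensions of each string of length
      \<open>cc n\<close> still miss \<open>W\<close>.\<close>
    define M where "M n = (LEAST m. n < m \<and> (\<forall>\<sigma>. length \<sigma> = cc n \<longrightarrow> misses W (cc m) \<sigma> * 2 * 2 ^ cc n \<le> 2 ^ cc m))" for n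
    \<comment> \<open>A value \<open>v\<close> is bad if the density of missed strings above
      \<open>\<sigma>\<close> is at most \<open>i / (i + 1)\<close>, but every extension through the
      block with a zero at offset \<open>v\<close> pushes it above
      \<open>(i + 1) / (i + 2)\<close>.\<close>
    define bad where "bad D i \<sigma> v \<longleftrightarrow> length \<sigma> = cc i \<and> misses W D \<sigma> * (i + 1) * 2 ^ cc i \<le> i * 2 ^ D \<and>
       (\<forall>\<tau>. length \<tau> = cc (Suc i) \<longrightarrow> take (cc i) \<tau> = \<sigma> \<longrightarrow> \<not> nth0 \<tau> (cc i + v) \<longrightarrow>
          (i + 1) * 2 ^ D < misses W D \<tau> * ((i + 2) * 2 ^ cc (Suc i)))" for D i \<sigma> v
    \<comment> \<open>All starting stages \<open>n \<le> i\<close> are included: the stage actually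
      used is chosen only after \<open>q0\<close>, which depends on \<open>T\<close>.\<close>
    define T where "T i v \<longleftrightarrow> v \<le> G (\<beta> (cc i)) \<and> (\<exists>n. n \<le> i \<and> i < M n \<and> (\<exists>\<sigma>. bad (cc (M n)) i \<sigma> v))" for i v
    have dM: "delta1 empty_real M" unfolding M_def[abs_def]
      by (intro delta1_Least delta1_intros delta1_power delta1_length delta1_misses[OF W] delta1_comp[OF dcc])
    have M: "n < M n \<and> (\<forall>\<sigma>. length \<sigma> = cc n \<longrightarrow> misses W (cc (M n)) \<sigma> * 2 * 2 ^ cc n \<le> 2 ^ cc (M n))" for n
    proof -
      have "0 < 1 / (2 * 2 ^ cc n :: real)" by simp
      from miss_small[OF W1 this]
      obtain L0 where L0: "\<And>L. L0 \<le> L \<Longrightarrow> real (card (miss W L)) < 1 / (2 * 2 ^ cc n) * 2 ^ L" by blast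
      let ?m = "max (Suc n) L0"
      have "L0 \<le> cc ?m" using strict_mono_ge[OF cm, of ?m] by simp
      then have "real (card (miss W (cc ?m))) < 1 / (2 * 2 ^ cc n) * 2 ^ cc ?m" by (rule L0)
      then have "real (card (miss W (cc ?m)) * 2 * 2 ^ cc n) \<le> real (2 ^ cc ?m)" by (simp add: field_simps)
      then have le: "card (miss W (cc ?m)) * 2 * 2 ^ cc n \<le> 2 ^ cc ?m" by (simp only: of_nat_le_iff)
      have "misses W (cc ?m) \<sigma> * 2 * 2 ^ cc n \<le> 2 ^ cc ?m" for \<sigma>
        by (rule order_trans[OF _ le]) (simp add: misses_le)
      then have "n < ?m \<and> (\<forall>\<sigma>. length \<sigma> = cc n \<longrightarrow> misses W (cc ?m) \<sigma> * 2 * 2 ^ cc n \<le> 2 ^ cc ?m)" by simp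
      then show ?thesis unfolding M_def by (rule LeastI)
    qed
    have dT: "delta1 empty_real (\<lambda>p. T (fst p) (snd p))" unfolding T_def bad_def
      by (intro delta1_intros delta1_power delta1_length delta1_take delta1_nth0 delta1_misses[OF W] delta1_comp[OF dcc]
          delta1_comp[OF dG] delta1_comp[OF d\<beta>] delta1_comp[OF dM])
    have few: "card {v. v \<le> G (\<beta> (cc i)) \<and> bad (cc (M n)) i \<sigma> v} \<le> 2 * (cc i + 1)" if "i < M n" for n i \<sigma>
    proof (cases "\<exists>v. bad (cc (M n)) i \<sigma> v")
      case True
      then have \<sigma>: "length \<sigma> = cc i" "misses W (cc (M n)) \<sigma> * (i + 1) * 2 ^ cc i \<le> i * 2 ^ cc (M n)"
        unfolding bad_def by blast+
      have "card {v. v \<le> G (\<beta> (cc i)) \<and> bad (cc (M n)) i \<sigma> v} < 2 * (cc i + 1)"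
      proof (rule few_bad_positions[OF \<sigma>(1) _ _ _ \<sigma>(2), of "cc (Suc i)"])
        fix \<tau> v
        assume "v \<in> {v. v \<le> G (\<beta> (cc i)) \<and> bad (cc (M n)) i \<sigma> v}" and \<tau>: "length \<tau> = cc (Suc i)"
          "take (cc i) \<tau> = \<sigma>" "\<not> \<tau> ! (cc i + v)"
        then have v: "v \<le> G (\<beta> (cc i))" "bad (cc (M n)) i \<sigma> v" by auto
        have "nth0 \<tau> (cc i + v) = \<tau> ! (cc i + v)" using v(1) \<tau>(1) by (simp add: ccS)
        then have "(i + 1) * 2 ^ cc (M n) < misses W (cc (M n)) \<tau> * ((i + 2) * 2 ^ cc (Suc i))"
          using v(2) \<tau> unfolding bad_def by blast
        then show "(i + 1) * 2 ^ cc (M n) \<le> misses W (cc (M n)) \<tau> * ((i + 2) * 2 ^ cc (Suc i))" by (rule less_imp_le)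
      qed (use strict_mono_ge[OF cm, of i] in \<open>auto simp: ccS\<close>)
      then show ?thesis by simp
    qed simp
    have cardT: "card {v. T i v} \<le> \<beta> (cc i) - cc i" for i
    proof -
      let ?S = "\<lambda>n \<sigma>. if i < M n then {v. v \<le> G (\<beta> (cc i)) \<and> bad (cc (M n)) i \<sigma> v} else {}"
      let ?A = "{\<sigma> :: bool list. length \<sigma> = cc i}"
      have cA: "card ?A = 2 ^ cc i" using card_lists_length_eq[of "UNIV :: bool set" "cc i"] by simp
      have s: "card (?S n \<sigma>) \<le> 2 * (cc i + 1)" for n \<sigma> using few by simp
      have "{v. T i v} \<subseteq> (\<Union>n\<in>{..i}. \<Union>\<sigma>\<in>?A. ?S n \<sigma>)"
        unfolding T_def bad_def by fastforce
      then have "card {v. T i v} \<le> card (\<Union>n\<in>{..i}. \<Union>\<sigma>\<in>?A. ?S n \<sigma>)"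
        by (rule card_mono[rotated]) (auto intro!: finite_UN_I)
      also have "\<dots> \<le> (\<Sum>n\<in>{..i}. card (\<Union>\<sigma>\<in>?A. ?S n \<sigma>))" by (rule card_UN_le) simp
      also have "\<dots> \<le> (\<Sum>n\<in>{..i}. \<Sum>\<sigma>\<in>?A. card (?S n \<sigma>))" by (intro sum_mono card_UN_le finite_strings)
      also have "\<dots> \<le> (\<Sum>n\<in>{..i}. \<Sum>\<sigma>\<in>?A. 2 * (cc i + 1))" by (intro sum_mono s)
      also have "\<dots> = (i + 1) * (2 ^ cc i * (2 * (cc i + 1)))" by (simp add: cA)
      also have "\<dots> \<le> (cc i + 1) * (2 ^ cc i * (2 * (cc i + 1)))"
        using strict_mono_ge[OF cm, of i] by (intro mult_right_mono) auto
      also have "\<dots> = \<beta> (cc i) - cc i" by (simp add: \<beta>_def)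
      finally show ?thesis .
    qed
    define X where "X i = (LEAST c. (\<forall>v. v \<in> set (decode c :: nat list) \<longleftrightarrow> T i v) \<and>
        length (decode c :: nat list) \<le> \<beta> (cc i) - cc i)" for i
    note dT' = delta1_comp[OF dT delta1_pair, simplified]
    have dX: "delta1 empty_real X" unfolding X_def[abs_def]
      by (intro dT' delta1_Least delta1_intros delta1_member delta1_length delta1_minus delta1_comp[OF delta1_decode] delta1_comp[OF dcc]
          delta1_comp[OF d\<beta>])
    have X: "(\<forall>v. v \<in> set (decode (X i) :: nat list) \<longleftrightarrow> T i v) \<and> length (decode (X i) :: nat list) \<le> \<beta> (cc i) - cc i" for i
    proof -
      have "finite {v. T i v}" by (rule finite_subset[of _ "{..G (\<beta> (cc i))}"]) (auto simp: T_def)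
      then obtain xs where xs: "set xs = {v. T i v}" "distinct xs" using finite_distinct_list by blast
      then have "length xs \<le> \<beta> (cc i) - cc i" using cardT[of i] distinct_card[OF xs(2)] by simp
      then have "(\<forall>v. v \<in> set (decode (code xs) :: nat list) \<longleftrightarrow> T i v) \<and> length (decode (code xs) :: nat list) \<le> \<beta> (cc i) - cc i"
        using xs(1) by auto
      then show ?thesis unfolding X_def by (rule LeastI)
    qed
    define I where "I q = (LEAST i. q < \<beta> (cc i))" for q
    \<comment> \<open>For \<open>q\<close> in the interval of block \<open>i\<close>, entry
      \<open>q - cc i\<close> of the trace is read as a code of an initial segment of
      \<open>f\<close>, whose place \<open>q\<close> predicts \<open>f q\<close>. A correct trace
      entry thus gives an agreement at its own argument.\<close>
    define g where "g q = nth0 (decode (nth0 (decode (X (I q)) :: nat list) (q - cc (I q))) :: nat list) q" for q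
    have dI: "delta1 empty_real I" unfolding I_def[abs_def]
      by (intro delta1_Least delta1_intros delta1_comp[OF dcc] delta1_comp[OF d\<beta>])
    have "delta1 empty_real g" unfolding g_def[abs_def]
      by (intro delta1_nth0 delta1_comp[OF delta1_decode] delta1_intros delta1_minus delta1_comp[OF dX] delta1_comp[OF dI] delta1_comp[OF dcc])
    then have "finite {q. f q = g q}" by (rule nt)
    then obtain q0 where q0: "\<And>q. f q = g q \<Longrightarrow> q < q0" unfolding finite_nat_set_iff_bounded by auto
    have notT: "\<not> T i (\<Phi> (\<beta> (cc i)))" if "q0 \<le> i" for i
    proof
      assume "T i (\<Phi> (\<beta> (cc i)))"
      then have "\<Phi> (\<beta> (cc i)) \<in> set (decode (X i) :: nat list)" using X by blast
      then obtain j where j: "j < length (decode (X i) :: nat list)" "(decode (X i) :: nat list) ! j = \<Phi> (\<beta> (cc i))"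
        unfolding in_set_conv_nth by blast
      let ?q = "cc i + j"
      have q: "?q < \<beta> (cc i)" using j(1) X[of i] by linarith
      have "I ?q = i" unfolding I_def
      proof (rule Least_equality)
        fix k assume k: "?q < \<beta> (cc k)"
        show "i \<le> k"
        proof (rule ccontr)
          assume "\<not> i \<le> k"
          then have "cc (Suc k) \<le> cc i" using strict_mono_less_eq[OF cm] by simp
          then show False using k by (simp add: ccS)
        qed
      qed (rule q)
      then have "g ?q = nth0 (decode (\<Phi> (\<beta> (cc i))) :: nat list) ?q" using j by (simp add: g_def)
      also have "\<dots> = f ?q" using q by (simp add: \<Phi>_def)
      finally have "?q < q0" using q0 by simp
      then show False using that strict_mono_ge[OF cm, of i] by simp
    qed
    \<comment> \<open>From \<open>q0\<close> on the offsets of \<open>p\<close> are untraced, the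
      length of \<open>\<sigma>0\<close> must fit below \<open>cc n\<close>, and
      \<open>1 \<le> n\<close> ensures that the initial density \<open>1/2\<close> is at most
      \<open>n / (n + 1)\<close>.\<close>
    define n where "n = Suc (max q0 (length \<sigma>0))"
    let ?D = "cc (M n)"
    let ?good = "\<lambda>i \<tau>. length \<tau> = cc i \<and> take (length \<sigma>0) \<tau> = \<sigma>0 \<and> avoids p \<tau> \<and>
        misses W ?D \<tau> * (i + 1) * 2 ^ cc i \<le> i * 2 ^ ?D"
    have len0: "length \<sigma>0 \<le> cc n" using strict_mono_ge[OF cm, of n] by (simp add: n_def)
    have "\<exists>\<tau>. ?good i \<tau>" if "n \<le> i" "i \<le> M n" for i
      using that
    proof (induction i rule: dec_induct)
      case base
      let ?\<tau> = "\<sigma>0 @ replicate (cc n - length \<sigma>0) False"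
      have l: "length ?\<tau> = cc n" using len0 by simp
      then have le: "misses W ?D ?\<tau> * 2 * 2 ^ cc n \<le> 2 ^ ?D" using M[of n] by blast
      have "misses W ?D ?\<tau> * (n + 1) * 2 ^ cc n \<le> n * (misses W ?D ?\<tau> * 2 * 2 ^ cc n)"
      proof -
        have "1 \<le> n" by (simp add: n_def)
        then have "n + 1 \<le> n * 2" by linarith
        then have "misses W ?D ?\<tau> * (n + 1) * 2 ^ cc n \<le> misses W ?D ?\<tau> * (n * 2) * 2 ^ cc n"
          by (intro mult_right_mono mult_left_mono) auto
        then show ?thesis by (simp add: mult_ac)
      qed
      also have "\<dots> \<le> n * 2 ^ ?D" using le by (rule mult_left_mono) simp
      finally show ?case using l avoids_append_False[OF \<sigma>0] by (intro exI[of _ ?\<tau>]) simp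
    next
      case (step i)
      then obtain \<tau> where \<tau>: "?good i \<tau>" by auto
      have "q0 \<le> i" using step.hyps by (simp add: n_def)
      then have "\<not> T i (\<Phi> (\<beta> (cc i)))" by (rule notT)
      then have "\<not> bad ?D i \<tau> (\<Phi> (\<beta> (cc i)))"
        using G[of "\<beta> (cc i)"] step.hyps step.prems unfolding T_def by auto
      \<comment> \<open>As the offset of \<open>p i\<close> is not bad, some extension with
        \<open>False\<close> there keeps the density at most
        \<open>(i + 1) / (i + 2)\<close>.\<close>
      then obtain \<rho> where \<rho>: "length \<rho> = cc (Suc i)" "take (cc i) \<rho> = \<tau>" "\<not> nth0 \<rho> (p i)"
        "\<not> (i + 1) * 2 ^ ?D < misses W ?D \<rho> * ((i + 2) * 2 ^ cc (Suc i))"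
        using \<tau> unfolding bad_def p_def by blast
      have "take (length \<sigma>0) (take (cc i) \<rho>) = \<sigma>0" using \<tau> \<rho>(2) by simp
      moreover have "length \<sigma>0 \<le> cc i" using len0 step.hyps strict_mono_less_eq[OF cm, of n i] by simp
      ultimately have "take (length \<sigma>0) \<rho> = \<sigma>0" by (simp add: min_def)
      moreover have "avoids p \<rho>" unfolding avoids_def
      proof (intro allI impI)
        fix j assume j: "p j < length \<rho>"
        then have "j \<le> i" using p_less_iff \<rho>(1) by simp
        show "\<not> \<rho> ! p j"
        proof (cases "j = i")
          case True
          then show ?thesis using \<rho>(3) j by simp
        next
          case False
          then obtain k where k: "i = Suc k" "j \<le> k" using \<open>j \<le> i\<close> by (cases i) auto
          then have "p j < cc i" using p_less_iff by simp
          moreover from this have "\<rho> ! p j = \<tau> ! p j" using \<rho>(2) by (metis nth_take)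
          ultimately show ?thesis using \<tau> by (simp add: avoids_def)
        qed
      qed
      moreover have "misses W ?D \<rho> * (Suc i + 1) * 2 ^ cc (Suc i) \<le> Suc i * 2 ^ ?D"
        using \<rho>(4) by (simp add: not_less algebra_simps)
      ultimately show ?case using \<rho>(1) by blast
    qed
    from this[of "M n"] obtain \<tau> where \<tau>: "?good (M n) \<tau>" using M[of n] by auto
    \<comment> \<open>At full depth only \<open>\<tau>\<close> itself can be counted, and a density
      of at most \<open>M n / (M n + 1)\<close> excludes even that.\<close>
    have "misses W ?D \<tau> = 0"
    proof (rule ccontr)
      assume "misses W ?D \<tau> \<noteq> 0"
      then have "1 * (M n + 1) * 2 ^ ?D \<le> misses W ?D \<tau> * (M n + 1) * 2 ^ ?D" by (intro mult_right_mono) auto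
      then have "(M n + 1) * 2 ^ ?D \<le> M n * 2 ^ ?D" using \<tau> by linarith
      then show False by simp
    qed
    moreover have "finite {\<rho>. length \<rho> = ?D \<and> take (length \<tau>) \<rho> = \<tau> \<and> (\<forall>i. take i \<rho> \<notin> W)}"
      by (rule finite_subset[OF _ finite_strings[of ?D]]) auto
    ultimately have "\<tau> \<notin> {\<rho>. length \<rho> = ?D \<and> take (length \<tau>) \<rho> = \<tau> \<and> (\<forall>i. take i \<rho> \<notin> W)}"
      unfolding misses_def by auto
    then have "\<exists>i. take i \<tau> \<in> W" using \<tau> by simp
    then show "\<exists>\<tau>. avoids p \<tau> \<and> take (length \<sigma>0) \<tau> = \<sigma>0 \<and> (\<exists>i. take i \<tau> \<in> W)" using \<tau> by blast
  qed
  with low show False by blast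
qed

theorem theorem5p6:
  fixes x :: cantor
  shows "(low_for_kurtz_tests x \<longleftrightarrow> low_for_kurtz_randomness x) \<and>
         (low_for_kurtz_randomness x \<longleftrightarrow> delta11_dominated x \<and> delta11_semi_traceable x)"
  using low_tests_imp_low_randomness low_randomness_imp_dominated low_randomness_imp_semi_traceable
    dominated_semi_traceable_imp_low by blast

end
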